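(* Let $G=\mathrm{SL}_3(\mathbb{R})$, $\Gamma=\mathrm{SL}_3(\mathbb{Z})$, $X=G/\Gamma$. Let $F=\{g_t:t\in\mathbb{R}\}$ be a one-parameter diagonalizable subgroup of $G$, and let $F^+=\{g_t:t\ge 0\}$. Then the set $$E(F^+)=\{\Lambda\in X: F^+\Lambda\text{ is bounded}\}$$ is HAW on $X$.
   Context: A one-parameter subgroup is the image of a continuous homomorphism $t\mapsto g_t$ from $\mathbb{R}$ to $G$; it is diagonalizable if its elements are diagonalizable over $\mathbb{C}$ (not necessarily over $\mathbb{R}$). $G$ acts on $X$ by left translations, and a subset of $X$ is bounded if it is contained in a compact subset of $X$. Hyperplane absolute game. Let $W\subset\mathbb{R}^d$ be open, $S\subset\mathbb{R}^d$ a target set, $\beta\in(0,\frac13)$. For an affine hyperplane $L\subset\mathbb{R}^d$ and $\rho>0$ put $L^{(\rho)}=\{\mathbf{x}\in\mathbb{R}^d:\mathrm{dist}(\mathbf{x},L)<\rho\}$. Bob begins by choosing a closed ball $B_0\subset W$ of radius $\rho_0>0$. After Bob chooses a closed ball $B_i$ of radius $\rho_i$, Alice chooses a hyperplane neighborhood $L_i^{(\rho_i')}$ with $\rho_i'\le\beta\rho_i$, and then Bob chooses a closed ball $B_{i+1}\subset B_i\setminus L_i^{(\rho_i')}$ of radius $\rho_{i+1}\ge\beta\rho_i$. Alice wins if and only if $\bigcap_{i=0}^\infty B_i\cap S\neq\varnothing$. The set $S$ is HAW (hyperplane absolute winning) on $W$ if for every $\beta\in(0,\frac13)$ Alice has a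 winning strategy. HAW on a manifold. Let $M$ be a $d$-dimensional $C^1$ manifold with a $C^1$ atlas $\{(U_\alpha,\varphi_\alpha)\}$ ($\varphi_\alpha$ a $C^1$ diffeomorphism from $U_\alpha$ onto an open subset of $\mathbb{R}^d$). A subset $S\subset M$ is HAW on $M$ if for each $\alpha$ the set $\varphi_\alpha(S\cap U_\alpha)$ is HAW on $\varphi_\alpha(U_\alpha)$. (This is independent of the choice of atlas.) *)

theory Defs
  imports "HOL-Analysis.Analysis" "HOL-Algebra.Left_Coset"
begin

section \<open>The hyperplane absolute game\<close>

definition affine_hyperplane :: "'a::euclidean_space set \<Rightarrow> bool" where
  "affine_hyperplane L \<longleftrightarrow> (\<exists>a b. a \<noteq> 0 \<and> L = {x. a \<bullet> x = b})"

definition nbhd :: "'a::euclidean_space set \<Rightarrow> real \<Rightarrow> 'a set" where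
  "nbhd L r = {x. infdist x L < r}"

text \<open>Closed balls are played as pairs (centre, radius).\<close>

definition ball_set :: "'a::euclidean_space \<times> real \<Rightarrow> 'a set" where
  "ball_set B = cball (fst B) (snd B)"

text \<open>
  A strategy of Alice answers the nonempty list of the balls chosen by Bob so far (her own earlier
  moves are determined by it) with a hyperplane and a radius. Legality is demanded for every such
  list, also for lists that cannot occur in a play: this is no restriction, since a strategy may
  be altered there, and it excludes a strategy that stops the play by an illegal move.
\<close>

definition legal_strategy ::
    "real \<Rightarrow> (('a::euclidean_space \<times> real) list \<Rightarrow> 'a set \<times> real) \<Rightarrow> bool" where
  "legal_strategy \<beta> \<sigma> \<longleftrightarrow>
    (\<forall>Bs. Bs \<noteq> [] \<and> 0 < snd (last Bs) \<longrightarrow>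
      affine_hyperplane (fst (\<sigma> Bs)) \<and>
      0 < snd (\<sigma> Bs) \<and> snd (\<sigma> Bs) \<le> \<beta> * snd (last Bs))"

definition play_against ::
    "real \<Rightarrow> 'a::euclidean_space set \<Rightarrow> (('a \<times> real) list \<Rightarrow> 'a set \<times> real) \<Rightarrow>
      (nat \<Rightarrow> 'a \<times> real) \<Rightarrow> bool" where
  "play_against \<beta> W \<sigma> B \<longleftrightarrow>
    0 < snd (B 0) \<and> ball_set (B 0) \<subseteq> W \<and>
    (\<forall>i. let (L, r) = \<sigma> (map B [0..<Suc i]) in
      ball_set (B (Suc i)) \<subseteq> ball_set (B i) - nbhd L r \<and>
      \<beta> * snd (B i) \<le> snd (B (Suc i)))"

definition winning_strategy ::
    "real \<Rightarrow> 'a::euclidean_space set \<Rightarrow> 'a set \<Rightarrow>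
      (('a \<times> real) list \<Rightarrow> 'a set \<times> real) \<Rightarrow> bool" where
  "winning_strategy \<beta> W S \<sigma> \<longleftrightarrow>
    legal_strategy \<beta> \<sigma> \<and>
    (\<forall>B. play_against \<beta> W \<sigma> B \<longrightarrow> (\<Inter>i. ball_set (B i)) \<inter> S \<noteq> {})"

definition HAW_on :: "'a::euclidean_space set \<Rightarrow> 'a set \<Rightarrow> bool" where
  "HAW_on W S \<longleftrightarrow> (\<forall>\<beta>. 0 < \<beta> \<and> \<beta> < 1/3 \<longrightarrow> (\<exists>\<sigma>. winning_strategy \<beta> W S \<sigma>))"


section \<open>Manifolds of class C1\<close>

definition C1_on ::
    "('a::real_normed_vector \<Rightarrow> 'b::real_normed_vector) \<Rightarrow> 'a set \<Rightarrow> bool" where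
  "C1_on f S \<longleftrightarrow>
    (\<exists>f' :: 'a \<Rightarrow> 'a \<Rightarrow>\<^sub>L 'b.
      (\<forall>x\<in>S. (f has_derivative blinfun_apply (f' x)) (at x)) \<and> continuous_on S f')"

definition C1_immersion_on ::
    "('a::real_normed_vector \<Rightarrow> 'b::real_normed_vector) \<Rightarrow> 'a set \<Rightarrow> bool" where
  "C1_immersion_on f S \<longleftrightarrow> C1_on f S \<and> (\<forall>x\<in>S. inj (frechet_derivative f (at x)))"

type_synonym ('m, 'e) chart = "'m set \<times> ('m \<Rightarrow> 'e)"

definition C1_atlas :: "'m topology \<Rightarrow> ('m, 'e::euclidean_space) chart set \<Rightarrow> bool" where
  "C1_atlas T A \<longleftrightarrow>
    (\<forall>(U, \<phi>)\<in>A. openin T U \<and> open (\<phi> ` U) \<and>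
      homeomorphic_map (subtopology T U) (top_of_set (\<phi> ` U)) \<phi>) \<and>
    (\<Union>(U, \<phi>)\<in>A. U) = topspace T \<and>
    (\<forall>(U, \<phi>)\<in>A. \<forall>(V, \<psi>)\<in>A. C1_on (\<psi> \<circ> inv_into U \<phi>) (\<phi> ` (U \<inter> V)))"

definition HAW_on_manifold :: "('m, 'e::euclidean_space) chart set \<Rightarrow> 'm set \<Rightarrow> bool" where
  "HAW_on_manifold A S \<longleftrightarrow> (\<forall>(U, \<phi>)\<in>A. HAW_on (\<phi> ` U) (\<phi> ` (S \<inter> U)))"

text \<open>
  The charts of a subset of a Euclidean space that is an embedded C1 submanifold: the inverses of
  its regular C1 parametrizations.
\<close>

definition submanifold_charts ::
    "'b::euclidean_space set \<Rightarrow> ('b, 'e::euclidean_space) chart set" where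
  "submanifold_charts M =
    {(W, \<psi>). openin (top_of_set M) W \<and> open (\<psi> ` W) \<and>
      (\<exists>p. homeomorphism W (\<psi> ` W) \<psi> p \<and> C1_immersion_on p (\<psi> ` W))}"

text \<open>
  Both sides are modelled on the same Euclidean space, so an injective derivative is invertible,
  and the condition says that a continuous map is a local C1 diffeomorphism.
\<close>

definition local_C1_diffeo ::
    "('m, 'e::euclidean_space) chart set \<Rightarrow> ('n, 'e) chart set \<Rightarrow> ('m \<Rightarrow> 'n) \<Rightarrow> bool" where
  "local_C1_diffeo A B f \<longleftrightarrow>
    (\<forall>(W, \<psi>)\<in>A. \<forall>(U, \<phi>)\<in>B.
      C1_immersion_on (\<phi> \<circ> f \<circ> inv_into W \<psi>) (\<psi> ` (W \<inter> f -` U)))"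


section \<open>The homogeneous space\<close>

definition SL3R :: "(real^3^3) monoid" where
  "SL3R = \<lparr>carrier = {A. det A = 1}, mult = (**), one = mat 1\<rparr>"

definition SL3Z :: "(real^3^3) set" where
  "SL3Z = {A \<in> carrier SL3R. \<forall>i j. A $ i $ j \<in> \<int>}"

definition coset_proj :: "real^3^3 \<Rightarrow> (real^3^3) set" where
  "coset_proj A = A <#\<^bsub>SL3R\<^esub> SL3Z"

text \<open>The set of left cosets with the quotient topology.\<close>

definition X_space :: "(real^3^3) set topology" where
  "X_space = topology (\<lambda>U. U \<subseteq> lcosets\<^bsub>SL3R\<^esub> SL3Z \<and>
     openin (top_of_set (carrier SL3R)) {A \<in> carrier SL3R. coset_proj A \<in> U})"

lemma openin_X_space:
  "openin X_space U \<longleftrightarrow> U \<subseteq> lcosets\<^bsub>SL3R\<^esub> SL3Z \<and>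
     openin (top_of_set (carrier SL3R)) {A \<in> carrier SL3R. coset_proj A \<in> U}"
proof -
  let ?P = "\<lambda>U. {A \<in> carrier SL3R. coset_proj A \<in> U}"
  have int: "?P (U \<inter> V) = ?P U \<inter> ?P V" for U V by auto
  have un: "?P (\<Union>K) = (\<Union>U\<in>K. ?P U)" for K by auto
  have "istopology (\<lambda>U. U \<subseteq> lcosets\<^bsub>SL3R\<^esub> SL3Z \<and> openin (top_of_set (carrier SL3R)) (?P U))"
    unfolding istopology_def int un by (auto intro!: openin_Int openin_Union)
  then show ?thesis
    by (simp add: X_space_def)
qed

lemma topspace_X_space: "topspace X_space = lcosets\<^bsub>SL3R\<^esub> SL3Z"
proof -
  have "{A \<in> carrier SL3R. coset_proj A \<in> lcosets\<^bsub>SL3R\<^esub> SL3Z} = carrier SL3R"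
    by (auto simp: LCOSETS_def coset_proj_def)
  then have "openin X_space (lcosets\<^bsub>SL3R\<^esub> SL3Z)"
    unfolding openin_X_space by simp
  then show ?thesis
    by (meson openin_X_space openin_subset openin_topspace subset_antisym)
qed

lemma quotient_map_coset_proj:
  "quotient_map (top_of_set (carrier SL3R)) X_space coset_proj"
  unfolding quotient_map_def topspace_X_space openin_X_space
  by (auto simp: LCOSETS_def coset_proj_def)

text \<open>
  The manifold structure of the quotient of the 8-dimensional Lie group by a discrete subgroup:
  the one for which the projection is a local diffeomorphism. The predicate holds for exactly the
  C1 atlases of this structure.
\<close>

definition X_atlas :: "((real^3^3) set, real^8) chart set \<Rightarrow> bool" where
  "X_atlas A \<longleftrightarrow>
    C1_atlas X_space A \<and>
    local_C1_diffeo (submanifold_charts (carrier SL3R)) A coset_proj"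


section \<open>One-parameter subgroups and bounded orbits\<close>

definition one_parameter_hom :: "(real \<Rightarrow> real^3^3) \<Rightarrow> bool" where
  "one_parameter_hom g \<longleftrightarrow>
    continuous_on UNIV g \<and> range g \<subseteq> carrier SL3R \<and>
    (\<forall>s t. g (s + t) = g s \<otimes>\<^bsub>SL3R\<^esub> g t)"

definition diagonalizable_over_C :: "real^'n^'n \<Rightarrow> bool" where
  "diagonalizable_over_C A \<longleftrightarrow>
    (\<exists>P D :: complex^'n^'n. invertible P \<and> (\<forall>i j. i \<noteq> j \<longrightarrow> D $ i $ j = 0) \<and>
      map_matrix complex_of_real A = P ** D ** matrix_inv P)"

definition bounded_in :: "'m topology \<Rightarrow> 'm set \<Rightarrow> bool" where
  "bounded_in T S \<longleftrightarrow> (\<exists>K. compactin T K \<and> S \<subseteq> K)"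

definition bounded_orbit_points :: "(real^3^3) set \<Rightarrow> (real^3^3) set set" where
  "bounded_orbit_points F =
    {\<Lambda> \<in> topspace X_space. bounded_in X_space ((\<lambda>h. h <#\<^bsub>SL3R\<^esub> \<Lambda>) ` F)}"

end

theory Submission
  imports Defs
begin

text \<open>
  Let h = g 1. Taking real or imaginary parts of the complex eigenforms of h gives three independent real
  linear forms whose values grow along the orbit at rates l1, l2, l3 with sum 0, and one may assume
  l1 >= l2 >= 0: otherwise the group is replaced by its contragredient, which does not affect
  compactness. By Mahler's criterion it suffices to keep all nonzero integer vectors away from being
  short at all times n.

  A vector v that is short at time n is orthogonal to a dual integer vector w supplied by Minkowski's
  theorem on linear forms, and the points where v is short lie in a thin neighbourhood of the
  hypersurface on which the most expanded dual form vanishes at w. Two dual vectors w, w' of comparable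
  size that matter in the same ball of the game are parallel, because their cross product would be an
  integer vector that is short at an earlier time. So for each scale of the game and each k only one
  neighbourhood is needed, and its relative thickness decays exponentially in k. Such families of strips
  can be avoided by Alice: she keeps a weighted count of the strips meeting the current ball, and
  compactness of the space of hyperplanes shows that a single move removes a fixed proportion of it. The
  strips may be curved, since only strict differentiability is used; this makes the argument work in
  every C1 chart.
\<close>

section \<open>The game from a given first ball\<close>

text \<open>A short \<open>v\<close> at \<open>x\<close> imposes two conditions, on
  \<open>r1\<close> and on \<open>r2\<close>, and these vary with \<open>v\<close>, while a move of
  Alice removes a neighbourhood of a single hyperplane. A dual vector \<open>w\<close> orthogonal to
  \<open>v\<close> leaves one condition: \<open>r1 x \<times> r2 x\<close> is almost orthogonal to
  \<open>w\<close>. With rates scaled to \<open>l1 + l2 = 1\<close>, its value at \<open>w\<close>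
  has size exp(-n) and \<open>w\<close> has size exp(l1 n - k), so the strip has width about exp(-(1
  + l1) n + k). It is announced on balls larger by exp(k/100): this makes the relative widths
  summable over \<open>k\<close>, at the price of displacement errors of size exp(k/100). They
  matter only for large \<open>k\<close>, and there time goes back by 8k/10. The fraction must
  exceed 1.01/1.5, so that the balls are small enough for the earlier time to have been settled
  (\<open>1 + l1\<close> is at least 3/2), and stay below 1, so that the third form of the cross
  product is still small there. Order of constants: \<beta> and the local chart fix the exponent
  \<gamma> and the budget \<kappa> of the game; the shortness \<open>s\<close> comes last and may
  depend on Bob's first ball, because any positive lower bound on lengths gives a bounded
  orbit.\<close>

definition wins_from ::
    "real \<Rightarrow> 'a::euclidean_space set \<Rightarrow> 'a \<times> real \<Rightarrow> (('a \<times> real) list \<Rightarrow> 'a set \<times> real) \<Rightarrow> bool" where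
  "wins_from \<beta> S b \<sigma> \<longleftrightarrow> legal_strategy \<beta> \<sigma> \<and>
    (\<forall>B. play_against \<beta> UNIV \<sigma> B \<and> B 0 = b \<longrightarrow> (\<Inter>i. ball_set (B i)) \<inter> S \<noteq> {})"

text \<open>A move with two uses: a legal default wherever a strategy needs some answer, and a way
  to make the radii tend to 0, which the rules do not demand of Bob. The normal is an arbitrary unit
  vector, the width the largest allowed.\<close>

definition centre_cut :: "real \<Rightarrow> 'a::euclidean_space \<times> real \<Rightarrow> 'a set \<times> real" where
  "centre_cut \<beta> b = ({y. (SOME e. norm e = 1) \<bullet> y = (SOME e. norm e = 1) \<bullet> fst b}, \<beta> * snd b)"

lemma some_unit: "norm (SOME e::'a::euclidean_space. norm e = 1) = 1"
  by (rule someI_ex) (metis nonempty_Basis norm_Basis ex_in_conv)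

lemma centre_cut_legal:
  assumes "0 < \<beta>" "0 < snd b"
  shows "affine_hyperplane (fst (centre_cut \<beta> b))" "0 < snd (centre_cut \<beta> b)"
    "snd (centre_cut \<beta> b) \<le> \<beta> * snd b"
proof -
  have "(SOME e::'a. norm e = 1) \<noteq> 0"
    using some_unit by (metis norm_zero zero_neq_one)
  then show "affine_hyperplane (fst (centre_cut \<beta> b))"
    unfolding affine_hyperplane_def centre_cut_def by auto
qed (use assms in \<open>auto simp: centre_cut_def\<close>)

lemma infdist_hyperplane_le:
  fixes a :: "'a::euclidean_space"
  assumes "a \<noteq> 0"
  shows "infdist x {y. a \<bullet> y = b} \<le> \<bar>a \<bullet> x - b\<bar> / norm a"
proof -
  let ?y = "x - ((a \<bullet> x - b) / (a \<bullet> a)) *\<^sub>R a"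
  have "a \<bullet> ?y = b"
    using assms by (simp add: inner_diff_right)
  then have "infdist x {y. a \<bullet> y = b} \<le> dist x ?y"
    by (intro infdist_le) simp
  also have "dist x ?y = \<bar>a \<bullet> x - b\<bar> / norm a"
    using assms by (simp add: dist_norm power2_norm_eq_inner[symmetric] power2_eq_square abs_mult)
  finally show ?thesis .
qed

text \<open>The new centre is at distance at least \<open>\<beta> * r\<close> from the hyperplane
  through \<open>c\<close>, and the point \<open>z\<close> of the new ball farthest from that
  hyperplane must still be within \<open>r\<close> of \<open>c\<close>; hence
  \<open>\<beta> * r + s \<le> r\<close>.\<close>

lemma centre_cut_shrinks:
  fixes c :: "'a::euclidean_space"
  assumes "0 < \<beta>" "0 < s"
    and sub: "cball c' s \<subseteq> cball c r - nbhd (fst (centre_cut \<beta> (c, r))) (snd (centre_cut \<beta> (c, r)))"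
  shows "s \<le> (1 - \<beta>) * r"
proof -
  define e where "e = (SOME e::'a. norm e = 1)"
  have e: "norm e = 1" unfolding e_def by (rule some_unit)
  then have e0: "e \<noteq> 0" by auto
  define t where "t = e \<bullet> (c' - c)"
  have "c' \<notin> nbhd {y. e \<bullet> y = e \<bullet> c} (\<beta> * r)"
  proof -
    have "c' \<in> cball c' s" using \<open>0 < s\<close> by simp
    then have "c' \<notin> nbhd (fst (centre_cut \<beta> (c, r))) (snd (centre_cut \<beta> (c, r)))" using sub by blast
    then show ?thesis by (simp add: centre_cut_def e_def)
  qed
  then have "\<beta> * r \<le> infdist c' {y. e \<bullet> y = e \<bullet> c}"
    by (simp add: nbhd_def)
  also have "\<dots> \<le> \<bar>t\<bar>"
    using infdist_hyperplane_le[OF e0, of c' "e \<bullet> c"] e by (simp add: t_def inner_diff_right)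
  finally have t: "\<beta> * r \<le> \<bar>t\<bar>" .
  define z where "z = c' + (if t \<ge> 0 then s else - s) *\<^sub>R e"
  have "z \<in> cball c' s"
    using e \<open>0 < s\<close> by (simp add: z_def dist_norm)
  then have "norm (z - c) \<le> r"
    using sub by (auto simp: dist_norm norm_minus_commute)
  moreover have "\<bar>e \<bullet> (z - c)\<bar> \<le> norm (z - c)"
    using Cauchy_Schwarz_ineq2[of e "z - c"] e by simp
  moreover have "e \<bullet> (z - c) = t + (if t \<ge> 0 then s else - s)"
    using e by (simp add: z_def t_def inner_diff_right inner_add_right power2_norm_eq_inner[symmetric]
        dot_square_norm)
  ultimately show ?thesis
    using t \<open>0 < s\<close> by (auto simp: algebra_simps split: if_splits)
qed

lemma playD:
  assumes "play_against \<beta> W \<sigma> B"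
  shows "0 < snd (B 0)" "ball_set (B 0) \<subseteq> W"
    "ball_set (B (Suc i)) \<subseteq> ball_set (B i) -
      nbhd (fst (\<sigma> (map B [0..<Suc i]))) (snd (\<sigma> (map B [0..<Suc i])))"
    "\<beta> * snd (B i) \<le> snd (B (Suc i))"
  using assms unfolding play_against_def by (auto simp: case_prod_beta Let_def)

lemma play_radius_pos:
  assumes "play_against \<beta> W \<sigma> B" "0 < \<beta>"
  shows "0 < snd (B i)"
proof (induction i)
  case 0
  show ?case using playD(1)[OF assms(1)] .
next
  case (Suc i)
  then have "0 < \<beta> * snd (B i)" using \<open>0 < \<beta>\<close> by simp
  then show ?case using playD(4)[OF assms(1), of i] by linarith
qed

lemma play_nested:
  assumes "play_against \<beta> W \<sigma> B" "i \<le> j"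
  shows "ball_set (B j) \<subseteq> ball_set (B i)"
  using assms(2)
proof (induction rule: dec_induct)
  case (step n)
  then show ?case using playD(3)[OF assms(1), of n] by blast
qed simp

lemma play_radius_antimono:
  assumes "play_against \<beta> W \<sigma> B" "0 < \<beta>" "i \<le> j"
  shows "snd (B j) \<le> snd (B i)"
proof -
  have "cball (fst (B j)) (snd (B j)) \<subseteq> cball (fst (B i)) (snd (B i))"
    using play_nested[OF assms(1,3)] by (simp add: ball_set_def)
  then have "dist (fst (B j)) (fst (B i)) + snd (B j) \<le> snd (B i)"
    using play_radius_pos[OF assms(1,2), of j] unfolding cball_subset_cball_iff by linarith
  then show ?thesis
    using zero_le_dist[of "fst (B j)" "fst (B i)"] by linarith
qed

lemma play_cong:
  assumes "play_against \<beta> W \<sigma> B" "\<And>i. \<sigma> (map B [0..<Suc i]) = \<sigma>' (map B [0..<Suc i])"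
    "ball_set (B 0) \<subseteq> W'"
  shows "play_against \<beta> W' \<sigma>' B"
  using assms unfolding play_against_def by simp

text \<open>The head of the list is Bob's first ball, so the strategy may be selected by it.
  Inadmissible first balls are answered by centre cuts, since legality is demanded on every
  list.\<close>

lemma wins_from_collect:
  fixes S :: "'a::euclidean_space set"
  assumes "0 < \<beta>"
    and "\<And>b. 0 < snd b \<Longrightarrow> ball_set b \<subseteq> W \<Longrightarrow> \<exists>\<sigma>. wins_from \<beta> S b \<sigma>"
  shows "\<exists>\<sigma>. winning_strategy \<beta> W S \<sigma>"
proof -
  define sel where "sel b = (if 0 < snd b \<and> ball_set b \<subseteq> W then (SOME \<sigma>. wins_from \<beta> S b \<sigma>)
     else (\<lambda>Bs. centre_cut \<beta> (last Bs)))" for b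
  have win: "wins_from \<beta> S b (sel b)" if "0 < snd b" "ball_set b \<subseteq> W" for b
    using assms(2)[OF that] that unfolding sel_def by (simp add: someI_ex)
  have "legal_strategy \<beta> (sel b)" for b
  proof (cases "0 < snd b \<and> ball_set b \<subseteq> W")
    case True
    then show ?thesis using win by (auto simp: wins_from_def)
  next
    case False
    then have "sel b = (\<lambda>Bs. centre_cut \<beta> (last Bs))" by (auto simp: sel_def)
    then show ?thesis
      unfolding legal_strategy_def using centre_cut_legal[OF \<open>0 < \<beta>\<close>] by metis
  qed
  then have legal: "legal_strategy \<beta> (\<lambda>Bs. sel (hd Bs) Bs)"
    by (auto simp: legal_strategy_def)
  have "(\<Inter>i. ball_set (B i)) \<inter> S \<noteq> {}" if P: "play_against \<beta> W (\<lambda>Bs. sel (hd Bs) Bs) B" for B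
  proof -
    have "play_against \<beta> UNIV (sel (B 0)) B"
      by (rule play_cong[OF P]) (auto simp: hd_map simp del: upt_Suc)
    then show ?thesis
      using win[OF playD(1,2)[OF P]] by (auto simp: wins_from_def)
  qed
  with legal show ?thesis unfolding winning_strategy_def by blast
qed

text \<open>Alice waits with centre cuts until the radius first drops to \<delta>, then follows the
  strategy for that ball as if the play began there.\<close>

lemma wins_from_small:
  fixes S :: "'a::euclidean_space set"
  assumes \<beta>: "0 < \<beta>" "\<beta> < 1/3" and "0 < \<delta>"
    and small: "\<And>b. 0 < snd b \<Longrightarrow> snd b \<le> \<delta> \<Longrightarrow> ball_set b \<subseteq> ball_set b0 \<Longrightarrow> \<exists>\<sigma>. wins_from \<beta> S b \<sigma>"
  shows "\<exists>\<sigma>. wins_from \<beta> S b0 \<sigma>"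
proof -
  \<comment> \<open>The history as the later strategy sees it: the initial balls of radius above
    \<delta> are deleted.\<close>
  define dw where "dw Bs = dropWhile (\<lambda>b. \<delta> < snd b) Bs" for Bs :: "('a \<times> real) list"
  define good where "good b \<longleftrightarrow> 0 < snd b \<and> snd b \<le> \<delta> \<and> ball_set b \<subseteq> ball_set b0" for b
  define sel where "sel b = (SOME \<sigma>. wins_from \<beta> S b \<sigma>)" for b
  have sel: "wins_from \<beta> S b (sel b)" if "good b" for b
    using small[of b] that unfolding sel_def good_def by (simp add: someI_ex)
  define \<sigma> where "\<sigma> Bs = (if dw Bs \<noteq> [] \<and> good (hd (dw Bs)) then sel (hd (dw Bs)) (dw Bs)
     else centre_cut \<beta> (last Bs))" for Bs
  have "legal_strategy \<beta> \<sigma>"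
    unfolding legal_strategy_def
  proof (intro allI impI)
    fix Bs :: "('a \<times> real) list"
    assume A: "Bs \<noteq> [] \<and> 0 < snd (last Bs)"
    show "affine_hyperplane (fst (\<sigma> Bs)) \<and> 0 < snd (\<sigma> Bs) \<and> snd (\<sigma> Bs) \<le> \<beta> * snd (last Bs)"
    proof (cases "dw Bs \<noteq> [] \<and> good (hd (dw Bs))")
      case True
      then have "last (dw Bs) = last Bs"
        unfolding dw_def dropWhile_eq_drop by (metis drop_eq_Nil last_drop not_le)
      with True A sel[of "hd (dw Bs)"] show ?thesis
        unfolding \<sigma>_def wins_from_def legal_strategy_def by auto
    next
      case False
      then show ?thesis using centre_cut_legal[OF \<beta>(1), of "last Bs"] A by (auto simp: \<sigma>_def)
    qed
  qed
  moreover have "(\<Inter>i. ball_set (B i)) \<inter> S \<noteq> {}" if P: "play_against \<beta> UNIV \<sigma> B" and B0: "B 0 = b0" for B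
  proof -
    note pos = play_radius_pos[OF P \<beta>(1)]
    \<comment> \<open>If all radii stayed above \<delta>, \<open>dw\<close> would always be empty
      and Alice would cut through the centre for ever, which forces geometric decay.\<close>
    have ex: "\<exists>m. snd (B m) \<le> \<delta>"
    proof (rule ccontr)
      assume "\<not> ?thesis"
      then have big: "\<delta> < snd (B m)" for m by (meson not_le)
      have dwe: "dw (map B [0..<Suc i]) = []" for i
        using big by (auto simp: dw_def)
      have "snd (B i) \<le> (1 - \<beta>) ^ i * snd (B 0)" for i
      proof (induction i)
        case (Suc i)
        have "snd (B (Suc i)) \<le> (1 - \<beta>) * snd (B i)"
        proof (rule centre_cut_shrinks[OF \<beta>(1) pos])
          show "cball (fst (B (Suc i))) (snd (B (Suc i))) \<subseteq> cball (fst (B i)) (snd (B i)) -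
             nbhd (fst (centre_cut \<beta> (fst (B i), snd (B i)))) (snd (centre_cut \<beta> (fst (B i), snd (B i))))"
            using playD(3)[OF P, of i] dwe[of i] by (simp add: \<sigma>_def ball_set_def)
        qed
        also have "\<dots> \<le> (1 - \<beta>) * ((1 - \<beta>) ^ i * snd (B 0))"
          using Suc \<beta> by (intro mult_left_mono) auto
        finally show ?case by simp
      qed simp
      moreover have "(\<lambda>i. (1 - \<beta>) ^ i * snd (B 0)) \<longlonglongrightarrow> 0"
        using \<beta> by (intro tendsto_mult_left_zero LIMSEQ_power_zero) auto
      moreover obtain i where "(1 - \<beta>) ^ i * snd (B 0) < \<delta>"
        using order_tendstoD(2)[OF calculation(2) \<open>0 < \<delta>\<close>] by (auto simp: eventually_sequentially)
      ultimately have "snd (B i) < \<delta>" by (meson le_less_trans)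
      then show False using big by (meson less_asym)
    qed
    define m where "m = (LEAST m. snd (B m) \<le> \<delta>)"
    have m: "snd (B m) \<le> \<delta>" "\<And>j. j < m \<Longrightarrow> \<delta> < snd (B j)"
      unfolding m_def using LeastI_ex[OF ex] not_less_Least by (auto simp: not_le[symmetric])
    have gm: "good (B m)"
      using m(1) pos play_nested[OF P, of 0 m] B0 by (auto simp: good_def)
    define C where "C i = B (m + i)" for i
    have dwC: "dw (map B [0..<Suc (m + i)]) = map C [0..<Suc i]" for i
    proof -
      have "[0..<Suc (m + i)] = [0..<m] @ [m..<m + Suc i]"
        using upt_add_eq_append[of 0 m "Suc i"] by simp
      moreover have "map B [m..<m + Suc i] = map C [0..<Suc i]"
        by (intro nth_equalityI) (simp_all add: C_def del: upt_Suc)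
      ultimately have "map B [0..<Suc (m + i)] = map B [0..<m] @ map C [0..<Suc i]"
        by (simp del: upt_Suc)
      moreover have "dw (map B [0..<m] @ map C [0..<Suc i]) = dw (map C [0..<Suc i])"
        unfolding dw_def by (rule dropWhile_append2) (use m(2) in auto)
      moreover have "dw (map C [0..<Suc i]) = map C [0..<Suc i]"
        unfolding dw_def dropWhile_eq_self_iff using m(1) by (simp add: hd_map C_def del: upt_Suc)
      ultimately show ?thesis by (simp del: upt_Suc)
    qed
    have "play_against \<beta> UNIV (sel (C 0)) C"
      unfolding play_against_def
    proof (intro conjI allI)
      fix i
      have "\<sigma> (map B [0..<Suc (m + i)]) = sel (C 0) (map C [0..<Suc i])"
        unfolding \<sigma>_def dwC using gm by (auto simp: hd_map C_def simp del: upt_Suc)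
      then show "let (L, r) = sel (C 0) (map C [0..<Suc i]) in
         ball_set (C (Suc i)) \<subseteq> ball_set (C i) - nbhd L r \<and> \<beta> * snd (C i) \<le> snd (C (Suc i))"
        using playD(3,4)[OF P, of "m + i"] by (simp add: C_def case_prod_beta Let_def)
    qed (use pos in \<open>auto simp: C_def\<close>)
    then have "(\<Inter>i. ball_set (C i)) \<inter> S \<noteq> {}"
      using sel[OF gm] unfolding wins_from_def C_def by auto
    moreover have "ball_set (C i) \<subseteq> ball_set (B i)" for i
      unfolding C_def by (rule play_nested[OF P]) simp
    ultimately show ?thesis by blast
  qed
  ultimately show ?thesis unfolding wins_from_def by blast
qed

text \<open>The first ball is compact, so the local radii admit a Lebesgue number \<open>e\<close>;
  \<open>wins_from_small\<close> leads from the first ball to balls of radius at most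
  \<open>e / 2\<close>.\<close>

lemma winning_strategy_local:
  fixes S :: "'a::euclidean_space set"
  assumes \<beta>: "0 < \<beta>" "\<beta> < 1/3"
    and loc: "\<And>x. x \<in> W \<Longrightarrow> \<exists>\<delta>>0. \<forall>b. 0 < snd b \<longrightarrow> ball_set b \<subseteq> ball x \<delta> \<longrightarrow> (\<exists>\<sigma>. wins_from \<beta> S b \<sigma>)"
  shows "\<exists>\<sigma>. winning_strategy \<beta> W S \<sigma>"
proof (rule wins_from_collect[OF \<beta>(1)])
  fix b0 :: "'a \<times> real"
  assume b0: "0 < snd b0" "ball_set b0 \<subseteq> W"
  obtain d where d: "\<And>x. x \<in> W \<Longrightarrow> 0 < d x \<and> (\<forall>b. 0 < snd b \<longrightarrow> ball_set b \<subseteq> ball x (d x) \<longrightarrow> (\<exists>\<sigma>. wins_from \<beta> S b \<sigma>))"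
    using loc by metis
  have "compact (ball_set b0)" by (simp add: ball_set_def)
  moreover have "ball_set b0 \<subseteq> \<Union>((\<lambda>x. ball x (d x)) ` ball_set b0)"
  proof
    fix x assume x: "x \<in> ball_set b0"
    then have "0 < d x" using d b0(2) by blast
    then show "x \<in> \<Union>((\<lambda>x. ball x (d x)) ` ball_set b0)" using x by (intro UN_I[of x]) auto
  qed
  ultimately obtain e where e: "0 < e"
      "\<And>x. x \<in> ball_set b0 \<Longrightarrow> \<exists>G\<in>(\<lambda>x. ball x (d x)) ` ball_set b0. ball x e \<subseteq> G"
    by (rule Heine_Borel_lemma) auto
  show "\<exists>\<sigma>. wins_from \<beta> S b0 \<sigma>"
  proof (rule wins_from_small[OF \<beta>, of "e/2"])
    fix b :: "'a \<times> real"
    assume b: "0 < snd b" "snd b \<le> e / 2" "ball_set b \<subseteq> ball_set b0"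
    then have "fst b \<in> ball_set b" by (simp add: ball_set_def)
    then have "fst b \<in> ball_set b0" using b(3) by blast
    then obtain x where x: "x \<in> ball_set b0" "ball (fst b) e \<subseteq> ball x (d x)" using e(2) by auto
    have "ball_set b \<subseteq> ball (fst b) e"
      using b(2) e(1) by (auto simp: ball_set_def)
    then show "\<exists>\<sigma>. wins_from \<beta> S b \<sigma>"
      using d[of x] x b0(2) b(1) by blast
  qed (use e in auto)
qed

section \<open>Avoiding countably many thin curved strips\<close>

text \<open>Both points vary while the linear map is fixed. This gives one linearization valid
  around the centre of every small ball near \<open>x0\<close>, which a derivative at
  \<open>x0\<close> alone would not. The property follows from C1 and passes to continuous local
  inverses.\<close>

definition strict_deriv ::
    "('a::real_normed_vector \<Rightarrow> 'b::real_normed_vector) \<Rightarrow> ('a \<Rightarrow> 'b) \<Rightarrow> 'a \<Rightarrow> bool" where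
  "strict_deriv f T x0 \<longleftrightarrow> bounded_linear T \<and>
    (\<forall>\<eta>>0. \<exists>\<delta>>0. \<forall>x\<in>ball x0 \<delta>. \<forall>y\<in>ball x0 \<delta>. norm (f y - f x - T (y - x)) \<le> \<eta> * norm (y - x))"

text \<open>Relative to \<open>radius powr \<gamma>\<close>, a fixed weight grows by at most
  \<open>\<beta> powr (-\<gamma>)\<close> per turn. Removing the share \<open>1 / N\<close> once has
  to pay for two turns, as every second move is a centre cut; hence the square.\<close>

lemma exists_small_exponent:
  fixes \<beta> N :: real
  assumes "0 < \<beta>" "\<beta> < 1" "2 \<le> N"
  obtains \<gamma> where "0 < \<gamma>" "\<beta> powr (-\<gamma>) \<le> 2" "1 \<le> \<beta> powr (-\<gamma>)"
    "(\<beta> powr (-\<gamma>))\<^sup>2 * (1 - 1/N) \<le> 1 - 1/(2*N)"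
proof -
  \<comment> \<open>The value of the square that turns the last claim into an equality.\<close>
  define q where "q = (1 - 1/(2*N)) / (1 - 1/N)"
  have N: "0 < 1 - 1/N" using assms by (simp add: field_simps)
  have q1: "1 < q" and q2: "q \<le> 2" using assms N by (auto simp: q_def field_simps)
  define \<gamma> where "\<gamma> = ln q / (- 2 * ln \<beta>)"
  have lb: "ln \<beta> < 0" using assms by simp
  have g: "0 < \<gamma>" unfolding \<gamma>_def using q1 lb by (intro divide_pos_pos) auto
  have "\<beta> powr (-\<gamma>) = exp (ln q / 2)"
    using assms lb by (simp add: powr_def \<gamma>_def)
  then have sq: "(\<beta> powr (-\<gamma>))\<^sup>2 = q"
    using q1 by (simp add: power2_eq_square mult_exp_exp)
  have ge: "1 \<le> \<beta> powr (-\<gamma>)" using g assms by (simp add: powr_def mult_nonneg_nonpos2 lb less_imp_le mult_nonneg_nonpos)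
  have le: "\<beta> powr (-\<gamma>) \<le> 2"
    by (rule power2_le_imp_le) (use sq q2 in auto)
  show ?thesis
    by (rule that[OF g le ge]) (use N in \<open>simp add: sq q_def\<close>)
qed

lemma weighted_pigeonhole:
  fixes w :: "'b \<Rightarrow> real"
  assumes fin: "finite J" "finite Y" and "Y \<noteq> {}" and N: "real (card Y) \<le> N"
    and w: "\<And>j. j \<in> J \<Longrightarrow> 0 \<le> w j"
    and cov: "\<And>j. j \<in> J \<Longrightarrow> \<exists>y\<in>Y. R y j"
  shows "\<exists>y\<in>Y. sum w J \<le> N * sum w {j\<in>J. R y j}"
proof (rule ccontr)
  assume "\<not> ?thesis"
  then have less: "N * sum w {j\<in>J. R y j} < sum w J" if "y \<in> Y" for y
    using that by (auto simp: not_le)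
  have N0: "0 < N" using N fin \<open>Y \<noteq> {}\<close> card_gt_0_iff[of Y] by linarith
  have "sum w J \<le> (\<Sum>j\<in>J. \<Sum>y\<in>Y. if R y j then w j else 0)"
  proof (rule sum_mono)
    fix j assume j: "j \<in> J"
    then obtain y where y: "y \<in> Y" "R y j" using cov by blast
    have "(if R y j then w j else 0) \<le> (\<Sum>y\<in>Y. if R y j then w j else 0)"
      by (rule member_le_sum) (use y fin w[OF j] in auto)
    then show "w j \<le> (\<Sum>y\<in>Y. if R y j then w j else 0)" using y by simp
  qed
  also have "\<dots> = (\<Sum>y\<in>Y. \<Sum>j\<in>J. if R y j then w j else 0)" by (rule sum.swap)
  also have "\<dots> = (\<Sum>y\<in>Y. sum w {j\<in>J. R y j})"
    using fin by (simp add: sum.inter_filter)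
  also have "\<dots> < (\<Sum>y\<in>Y. sum w J / N)"
    by (rule sum_strict_mono) (use fin \<open>Y \<noteq> {}\<close> less N0 in \<open>auto simp: field_simps\<close>)
  also have "\<dots> = real (card Y) / N * sum w J" by simp
  also have "\<dots> \<le> 1 * sum w J"
    using N N0 w by (intro mult_right_mono) (auto simp: sum_nonneg)
  finally show False by simp
qed

text \<open>
  A pair (u, r) stands for the strip of all x with |u . f x| at most r; Alice wants to avoid the
  strips F(b) attached to each ball b of the play.
\<close>

definition thin_strips ::
    "real \<Rightarrow> real \<Rightarrow> ('a::euclidean_space \<times> real \<Rightarrow> ('b::euclidean_space \<times> real) set) \<Rightarrow> bool" where
  "thin_strips \<gamma> \<kappa> \<F> \<longleftrightarrow> (\<forall>b. 0 < snd b \<longrightarrow>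
    finite (\<F> b) \<and> (\<forall>j\<in>\<F> b. norm (fst j) = 1 \<and> 0 < snd j) \<and>
    (\<Sum>j\<in>\<F> b. snd j powr \<gamma>) \<le> \<kappa> * snd b powr \<gamma>)"

text \<open>The last clause says that a strip wider than the current ball no longer meets it, so
  every strip is left behind once the radii are below its width. The potential is the sum of
  \<open>snd j powr \<gamma>\<close> over the announced strips that still meet the ball; it is kept
  below a multiple of \<open>radius powr \<gamma>\<close>. The quantifiers matter: \<delta>,
  \<gamma>, \<kappa> are fixed before the family \<open>\<F>\<close> and the first ball.\<close>

lemma avoid_strips:
  fixes f :: "'a::euclidean_space \<Rightarrow> 'b::euclidean_space"
  assumes \<beta>: "0 < \<beta>" "\<beta> < 1/3"
    and strict: "strict_deriv f T x0"
    and surj: "\<And>u. norm u = 1 \<Longrightarrow> \<exists>\<xi>. u \<bullet> T \<xi> \<noteq> 0"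
  obtains \<delta> \<gamma> \<kappa> :: real where "0 < \<delta>" "0 < \<gamma>" "0 < \<kappa>"
    "\<forall>\<F> b. 0 < snd b \<and> ball_set b \<subseteq> ball x0 \<delta> \<and> thin_strips \<gamma> \<kappa> \<F> \<longrightarrow>
      (\<exists>\<sigma>. legal_strategy \<beta> \<sigma> \<and> (\<forall>B. play_against \<beta> UNIV \<sigma> B \<and> B 0 = b \<longrightarrow>
        (\<forall>e>0. \<exists>i. snd (B i) < e) \<and>
        (\<forall>m i j x. m \<le> i \<and> j \<in> \<F> (B m) \<and> x \<in> ball_set (B i) \<and> \<bar>fst j \<bullet> f x\<bar> \<le> snd j \<longrightarrow>
          snd j \<le> snd (B i))))"
proof -

  \<comment> \<open>Normals of strips, the error margin and a finite net of positions\<close>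
  have blT: "bounded_linear T" using strict by (simp add: strict_deriv_def)
  then have linT: "linear T" by (simp add: bounded_linear.linear)
  \<comment> \<open>Near a centre \<open>c\<close> the form \<open>u \<bullet> f x\<close> is
    \<open>u \<bullet> f c + nv u \<bullet> (x - c)\<close> up to the linearization error, so
    \<open>nv u\<close> is the normal of the strip in the domain. By \<open>surj\<close> it does not
    vanish, and \<open>a\<close> bounds its length from below for unit \<open>u\<close>.\<close>
  define nv where "nv = adjoint T"
  have linn: "linear nv" unfolding nv_def by (rule adjoint_linear[OF linT])
  have nv: "nv u \<bullet> \<xi> = u \<bullet> T \<xi>" for u \<xi>
    unfolding nv_def using adjoint_works[OF linT, of \<xi> u] by (simp add: inner_commute)
  have "inj nv"
    unfolding linear_injective_0[OF linn]
  proof (intro allI impI)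
    fix u assume "nv u = 0"
    then have z: "u \<bullet> T \<xi> = 0" for \<xi> using nv[of u \<xi>] by simp
    show "u = 0"
    proof (rule ccontr)
      assume "u \<noteq> 0"
      then have "norm (u /\<^sub>R norm u) = 1" by simp
      from surj[OF this] show False using z by auto
    qed
  qed
  then obtain a where a: "0 < a" "\<And>u. a * norm u \<le> norm (nv u)"
    using linear_inj_bounded_below_pos[OF linn] by metis
  obtain \<tau> where \<tau>: "0 < \<tau>" "\<And>u. norm (nv u) \<le> norm u * \<tau>"
    using bounded_linear.pos_bounded[OF linear_conv_bounded_linear[THEN iffD1, OF linn]] by blast
  \<comment> \<open>Four errors, in units of the radius, must fit into Alice's half width \<beta>
    times the length \<open>a\<close> of the normal: linearization and strip width (\<eta> each),
    and the deviation from the net in offset (\<eta>) and in direction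
    (\<open>\<eta> * \<tau>\<close>).\<close>
  define \<eta> where "\<eta> = min 1 (a * \<beta> / (4 + \<tau>))"
  have \<eta>: "0 < \<eta>" "\<eta> \<le> 1" "\<eta> * (3 + \<tau>) < a * \<beta>"
  proof -
    show "0 < \<eta>" "\<eta> \<le> 1" using a \<beta> \<tau> by (auto simp: \<eta>_def)
    have "\<eta> * (4 + \<tau>) \<le> a * \<beta>"
      using \<tau> by (simp add: \<eta>_def pos_le_divide_eq[symmetric])
    then show "\<eta> * (3 + \<tau>) < a * \<beta>" using \<open>0 < \<eta>\<close> by (simp add: algebra_simps)
  qed
  obtain \<delta> where \<delta>: "0 < \<delta>"
    "\<And>x y. x \<in> ball x0 \<delta> \<Longrightarrow> y \<in> ball x0 \<delta> \<Longrightarrow> norm (f y - f x - T (y - x)) \<le> \<eta> * norm (y - x)"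
    using strict \<eta>(1) unfolding strict_deriv_def by meson
  \<comment> \<open>Positions of strips relative to a ball with centre \<open>c\<close> and radius
    \<rho>, recorded as \<open>u\<close> and \<open>u \<bullet> f c / \<rho>\<close>. For a strip
    that meets the ball the offset is at most width plus error plus \<tau>. One finite net thus
    serves the balls of every scale.\<close>
  define KK where "KK = sphere (0::'b) 1 \<times> {-(2 + \<tau>)..2 + \<tau>}"
  have "compact KK" unfolding KK_def by (intro compact_Times) auto
  then obtain Y where Y: "finite Y" "Y \<subseteq> KK" "KK \<subseteq> (\<Union>y\<in>Y. ball y \<eta>)"
    using seq_compact_imp_totally_bounded[OF compact_imp_seq_compact[OF \<open>compact KK\<close>]] \<eta>(1) by metis
  obtain e0 :: 'b where e0: "e0 \<in> Basis" using nonempty_Basis by blast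
  then have "(e0, 0) \<in> KK" using \<tau> by (simp add: KK_def)
  then have Yne: "Y \<noteq> {}" using Y(3) by blast
  define N where "N = real (card Y) + 1"
  have N2: "2 \<le> N" using Y(1) Yne card_gt_0_iff[of Y] by (simp add: N_def)

  \<comment> \<open>Exponent and budget of the weights\<close>
  have "\<beta> < 1" using \<beta> by simp
  then obtain \<gamma> where \<gamma>: "0 < \<gamma>" "\<beta> powr (-\<gamma>) \<le> 2" "1 \<le> \<beta> powr (-\<gamma>)"
    "(\<beta> powr (-\<gamma>))\<^sup>2 * (1 - 1/N) \<le> 1 - 1/(2*N)"
    using exists_small_exponent[OF \<beta>(1) _ N2] by metis
  define G where "G = \<beta> powr (-\<gamma>)"
  \<comment> \<open>Half of \<open>\<eta> powr \<gamma>\<close>, so that even a potential of twice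
    the invariant forces each single strip to have half width at most \<eta> times the
    radius.\<close>
  define q where "q = \<eta> powr \<gamma> / 2"
  have q: "0 < q" using \<eta> by (simp add: q_def)
  \<comment> \<open>The strips announced in two turns cost at most
    \<open>\<kappa> * G + \<kappa> \<le> 3 * \<kappa> = q / (2 * N)\<close>, exactly the gap that
    \<open>exists_small_exponent\<close> leaves.\<close>
  define \<kappa> where "\<kappa> = q / (6 * N)"
  have \<kappa>: "0 < \<kappa>" "\<kappa> \<le> q" using q N2 by (auto simp: \<kappa>_def field_simps)
  have fact1: "(1 - 1/N) * q * G + \<kappa> \<le> 2 * q"
  proof -
    have "(1 - 1/N) * G \<le> (1 - 1/N) * G\<^sup>2"
      using \<gamma>(3) N2 unfolding G_def by (intro mult_left_mono) (auto simp: self_le_power)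
    also have "\<dots> \<le> 1" using \<gamma>(4) N2 unfolding G_def by (simp add: mult.commute) (smt (verit) divide_nonneg_nonneg)
    finally have "(1 - 1/N) * G * q \<le> 1 * q" using q by (intro mult_right_mono) auto
    then show ?thesis using \<kappa>(2) by (simp add: mult_ac)
  qed
  have fact2: "((1 - 1/N) * q * G + \<kappa>) * G + \<kappa> \<le> q"
  proof -
    have "(1 - 1/N) * G\<^sup>2 * q \<le> (1 - 1/(2*N)) * q"
      using \<gamma>(4) q unfolding G_def by (intro mult_right_mono) (auto simp: mult.commute)
    moreover have "\<kappa> * G \<le> \<kappa> * 2" using \<gamma>(2) \<kappa>(1) unfolding G_def by (intro mult_left_mono) auto
    moreover have "(1 - 1/(2*N)) * q + 3 * \<kappa> = q" using N2 by (simp add: \<kappa>_def field_simps)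
    ultimately show ?thesis by (simp add: algebra_simps power2_eq_square)
  qed
  show ?thesis
  proof (rule that[OF \<delta>(1) \<gamma>(1) \<kappa>(1)], intro allI impI)
    fix \<F> :: "'a \<times> real \<Rightarrow> ('b \<times> real) set" and b :: "'a \<times> real"
    assume asm: "0 < snd b \<and> ball_set b \<subseteq> ball x0 \<delta> \<and> thin_strips \<gamma> \<kappa> \<F>"
    then have b: "0 < snd b" "ball_set b \<subseteq> ball x0 \<delta>" by auto
    have F: "finite (\<F> b') \<and> (\<forall>j\<in>\<F> b'. norm (fst j) = 1 \<and> 0 < snd j) \<and>
        (\<Sum>j\<in>\<F> b'. snd j powr \<gamma>) \<le> \<kappa> * snd b' powr \<gamma>" if "0 < snd b'" for b'
      using asm that unfolding thin_strips_def by blast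

    \<comment> \<open>Alice's strategy\<close>
    define wt where "wt j = snd j powr \<gamma>" for j :: "'b \<times> real"
    define st where "st Bs = {j \<in> \<Union>(\<F> ` set Bs). \<exists>x\<in>ball_set (last Bs). \<bar>fst j \<bullet> f x\<bar> \<le> snd j}" for Bs
    define cell where "cell b y j \<longleftrightarrow> dist (fst j, fst j \<bullet> f (fst b) / snd b) y < \<eta>"
      for b :: "'a \<times> real" and y :: "'b \<times> real" and j :: "'b \<times> real"
    define good where "good Bs y \<longleftrightarrow> sum wt (st Bs) \<le> N * sum wt {j \<in> st Bs. cell (last Bs) y j}" for Bs y
    define pick where "pick Bs = (SOME y. y \<in> Y \<and> ((\<exists>y'\<in>Y. good Bs y') \<longrightarrow> good Bs y))" for Bs
    have "\<exists>y. y \<in> Y \<and> ((\<exists>y'\<in>Y. good Bs y') \<longrightarrow> good Bs y)" for Bs using Yne by blast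
    from someI_ex[OF this] have pick: "pick Bs \<in> Y" "(\<exists>y'\<in>Y. good Bs y') \<longrightarrow> good Bs (pick Bs)" for Bs
      unfolding pick_def by auto
    \<comment> \<open>Zero set of the linearized form in the position \<open>y\<close>:
      \<open>snd y * radius + nv (fst y) \<bullet> (z - centre)\<close>.\<close>
    define hyp where "hyp b y = ({z. nv (fst y) \<bullet> z = nv (fst y) \<bullet> fst b - snd y * snd b}, \<beta> * snd b)"
      for b :: "'a \<times> real" and y :: "'b \<times> real"
    \<comment> \<open>After ball \<open>i\<close> the history has length \<open>i + 1\<close>:
      strips are attacked at even \<open>i\<close>, the radius is cut at odd
      \<open>i\<close>.\<close>
    define \<sigma> where "\<sigma> Bs = (if odd (length Bs) then hyp (last Bs) (pick Bs) else centre_cut \<beta> (last Bs))" for Bs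
    have Ynz: "norm (fst y) = 1" "a \<le> norm (nv (fst y))" "nv (fst y) \<noteq> 0" if "y \<in> Y" for y
    proof -
      show 1: "norm (fst y) = 1" using that Y(2) by (auto simp: KK_def)
      show "a \<le> norm (nv (fst y))" using a(2)[of "fst y"] 1 by simp
      then show "nv (fst y) \<noteq> 0" using a(1) by auto
    qed
    have legal: "legal_strategy \<beta> \<sigma>"
      unfolding legal_strategy_def
    proof (intro allI impI)
      fix Bs :: "('a \<times> real) list"
      assume A: "Bs \<noteq> [] \<and> 0 < snd (last Bs)"
      show "affine_hyperplane (fst (\<sigma> Bs)) \<and> 0 < snd (\<sigma> Bs) \<and> snd (\<sigma> Bs) \<le> \<beta> * snd (last Bs)"
      proof (cases "odd (length Bs)")
        case True
        then show ?thesis using A \<beta> Ynz(3)[OF pick(1)]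
          by (auto simp: \<sigma>_def hyp_def affine_hyperplane_def)
      next
        case False
        then show ?thesis using centre_cut_legal[OF \<beta>(1), of "last Bs"] A by (auto simp: \<sigma>_def)
      qed
    qed
    have main: "(\<forall>e>0. \<exists>i. snd (B i) < e) \<and>
        (\<forall>m i j x. m \<le> i \<and> j \<in> \<F> (B m) \<and> x \<in> ball_set (B i) \<and> \<bar>fst j \<bullet> f x\<bar> \<le> snd j \<longrightarrow> snd j \<le> snd (B i))"
      if P: "play_against \<beta> UNIV \<sigma> B" and B0: "B 0 = b" for B
    proof -

      \<comment> \<open>The potential along a play\<close>
      note pos = play_radius_pos[OF P \<beta>(1)]
      define S where "S i = st (map B [0..<Suc i])" for i
      define \<Phi> where "\<Phi> i = sum wt (S i)" for i
      have S_eq: "S i = {j. (\<exists>m\<le>i. j \<in> \<F> (B m)) \<and> (\<exists>x\<in>ball_set (B i). \<bar>fst j \<bullet> f x\<bar> \<le> snd j)}" for i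
      proof -
        have "set (map B [0..<Suc i]) = B ` {..i}" by (simp add: atLeast0LessThan lessThan_Suc_atMost del: upt_Suc)
        moreover have "last (map B [0..<Suc i]) = B i" by simp
        ultimately show ?thesis unfolding S_def st_def by auto
      qed
      have finS: "finite (S i)" for i
        by (rule finite_subset[of _ "\<Union>m\<le>i. \<F> (B m)"]) (use F pos in \<open>auto simp: S_eq\<close>)
      have FB: "finite (\<F> (B i))" "\<And>j. j \<in> \<F> (B i) \<Longrightarrow> norm (fst j) = 1 \<and> 0 < snd j" for i
        using F[OF pos[of i]] by auto
      have Sj: "norm (fst j) = 1" "0 < snd j" if "j \<in> S i" for i j
        using that FB(2) unfolding S_eq by blast+
      have wt0: "0 \<le> wt j" for j by (simp add: wt_def)
      have S_Suc: "S (Suc i) \<subseteq> S i \<union> \<F> (B (Suc i))" for i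
        using play_nested[OF P, of i "Suc i"] by (auto simp: S_eq le_Suc_eq)
      have sumF: "sum wt (\<F> (B i)) \<le> \<kappa> * snd (B i) powr \<gamma>" for i
        using F[OF pos] by (simp add: wt_def)
      have step: "sum wt (S (Suc i)) \<le> sum wt (S i - D) + \<kappa> * snd (B (Suc i)) powr \<gamma>"
        if "D \<inter> S (Suc i) = {}" for i D
      proof -
        have "sum wt (S (Suc i)) \<le> sum wt ((S i - D) \<union> \<F> (B (Suc i)))"
          by (rule sum_mono2) (use finS FB(1) S_Suc[of i] that wt0 in auto)
        also have "\<dots> \<le> sum wt (S i - D) + sum wt (\<F> (B (Suc i)))"
          using sum_Un2[of "S i - D" "\<F> (B (Suc i))" wt] finS FB(1) wt0
            sum.union_inter[of "S i - D" "\<F> (B (Suc i))" wt] sum_nonneg[of "(S i - D) \<inter> \<F> (B (Suc i))" wt]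
          by (simp del: sum_nonneg)
        finally show ?thesis using sumF[of "Suc i"] by linarith
      qed
      have grow: "snd (B i) powr \<gamma> \<le> G * snd (B (Suc i)) powr \<gamma>" for i
      proof -
        have "(\<beta> * snd (B i)) powr \<gamma> \<le> snd (B (Suc i)) powr \<gamma>"
          using playD(4)[OF P, of i] pos[of i] \<beta> \<gamma>(1) by (intro powr_mono2) auto
        then have "G * (\<beta> powr \<gamma> * snd (B i) powr \<gamma>) \<le> G * snd (B (Suc i)) powr \<gamma>"
          using pos[of i] \<beta> by (intro mult_left_mono) (auto simp: powr_mult G_def)
        moreover have "G * \<beta> powr \<gamma> = 1" using \<beta> by (simp add: G_def powr_minus)
        ultimately show ?thesis by (simp add: mult.assoc[symmetric])
      qed
      \<comment> \<open>A single summand is at most the whole potential; the final claim about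
        surviving strips follows from the invariant in this way too.\<close>
      have small: "snd j \<le> \<eta> * snd (B i)" if "\<Phi> i \<le> 2 * q * snd (B i) powr \<gamma>" "j \<in> S i" for i j
      proof -
        have "wt j \<le> \<Phi> i" unfolding \<Phi>_def by (rule member_le_sum) (use that finS wt0 in auto)
        also have "\<dots> \<le> (\<eta> * snd (B i)) powr \<gamma>"
          using that(1) pos[of i] \<eta> by (simp add: q_def powr_mult)
        finally show ?thesis
          unfolding wt_def using Sj(2)[OF that(2)] \<eta> pos[of i] \<gamma>(1)
          by (meson less_imp_le mult_nonneg_nonneg not_le powr_less_mono2)
      qed
      have sub: "ball_set (B i) \<subseteq> ball x0 \<delta>" for i
        using play_nested[OF P, of 0 i] b(2) B0 by auto
      \<comment> \<open>Within the current ball, all strips of one net cell lie in one hyperplane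
        neighbourhood that Alice may choose, and the best cell carries at least the share
        \<open>1 / N\<close> of the potential.\<close>
      have kill: "\<Phi> (Suc i) \<le> (1 - 1/N) * \<Phi> i + \<kappa> * snd (B (Suc i)) powr \<gamma>"
        if ev: "even i" and bd: "\<Phi> i \<le> 2 * q * snd (B i) powr \<gamma>" for i
      proof -
        define c where "c = fst (B i)"
        define \<rho> where "\<rho> = snd (B i)"
        have \<rho>: "0 < \<rho>" using pos by (simp add: \<rho>_def)
        let ?Bs = "map B [0..<Suc i]"
        have last: "last ?Bs = B i" by simp
        have cB: "c \<in> ball x0 \<delta>" using sub[of i] pos[of i] by (force simp: c_def ball_set_def)
        have est: "norm (f x - f c - T (x - c)) \<le> \<eta> * \<rho>" "norm (x - c) \<le> \<rho>" if "x \<in> ball_set (B i)" for x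
        proof -
          show n: "norm (x - c) \<le> \<rho>" using that by (simp add: ball_set_def c_def \<rho>_def dist_norm norm_minus_commute)
          have "norm (f x - f c - T (x - c)) \<le> \<eta> * norm (x - c)"
            using that sub by (intro \<delta>(2)[OF cB]) blast
          also have "\<dots> \<le> \<eta> * \<rho>" using n \<eta>(1) by simp
          finally show "norm (f x - f c - T (x - c)) \<le> \<eta> * \<rho>" .
        qed
        have expand: "\<bar>u \<bullet> f x - (u \<bullet> f c + nv u \<bullet> (x - c))\<bar> \<le> \<eta> * \<rho>"
          if "norm u = 1" "x \<in> ball_set (B i)" for u x
        proof -
          have "u \<bullet> f x - (u \<bullet> f c + nv u \<bullet> (x - c)) = u \<bullet> (f x - f c - T (x - c))"
            by (simp add: nv inner_diff_right linear_diff[OF linT])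
          also have "\<bar>\<dots>\<bar> \<le> norm u * norm (f x - f c - T (x - c))" by (rule Cauchy_Schwarz_ineq2)
          finally show ?thesis using est(1)[OF that(2)] that(1) by simp
        qed
        have inKK: "(fst j, fst j \<bullet> f c / \<rho>) \<in> KK" if j: "j \<in> S i" for j
        proof -
          obtain x where x: "x \<in> ball_set (B i)" "\<bar>fst j \<bullet> f x\<bar> \<le> snd j" using j by (auto simp: S_eq)
          have "\<bar>nv (fst j) \<bullet> (x - c)\<bar> \<le> norm (nv (fst j)) * norm (x - c)" by (rule Cauchy_Schwarz_ineq2)
          also have "\<dots> \<le> \<tau> * \<rho>"
            using \<tau>(2)[of "fst j"] Sj(1)[OF j] est(2)[OF x(1)] \<tau>(1) by (intro mult_mono) auto
          finally have "\<bar>fst j \<bullet> f c\<bar> \<le> (\<eta> + \<eta> + \<tau>) * \<rho>"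
            using expand[OF Sj(1)[OF j] x(1)] x(2) small[OF bd j] by (simp add: \<rho>_def algebra_simps)
          also have "\<dots> \<le> (2 + \<tau>) * \<rho>" using \<eta> \<rho> by (intro mult_right_mono) auto
          finally have "\<bar>fst j \<bullet> f c / \<rho>\<bar> \<le> 2 + \<tau>" using \<rho> by (simp add: abs_divide divide_le_eq)
          then have "-(2 + \<tau>) \<le> fst j \<bullet> f c / \<rho> \<and> fst j \<bullet> f c / \<rho> \<le> 2 + \<tau>" by linarith
          then show ?thesis using Sj(1)[OF j] by (simp add: KK_def)
        qed
        have "\<exists>y\<in>Y. sum wt (S i) \<le> N * sum wt {j\<in>S i. cell (B i) y j}"
        proof (rule weighted_pigeonhole[OF finS Y(1) Yne])
          show "real (card Y) \<le> N" by (simp add: N_def)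
          fix j assume "j \<in> S i"
          then have "(fst j, fst j \<bullet> f c / \<rho>) \<in> (\<Union>y\<in>Y. ball y \<eta>)" using inKK Y(3) by blast
          then show "\<exists>y\<in>Y. cell (B i) y j" by (auto simp: cell_def c_def \<rho>_def dist_commute)
        qed (rule wt0)
        then have "\<exists>y\<in>Y. good ?Bs y" unfolding good_def last S_def .
        then have pk: "good ?Bs (pick ?Bs)" using pick(2) by blast
        define y where "y = pick ?Bs"
        have y: "y \<in> Y" "\<Phi> i \<le> N * sum wt {j\<in>S i. cell (B i) y j}"
          using pk pick(1) unfolding y_def good_def last S_def \<Phi>_def by auto
        have sig: "\<sigma> ?Bs = hyp (B i) y" using ev by (simp add: \<sigma>_def y_def)
        define D where "D = {j\<in>S i. cell (B i) y j}"
        have hit: "x \<in> nbhd (fst (hyp (B i) y)) (snd (hyp (B i) y))"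
          if j: "j \<in> D" and x: "x \<in> ball_set (B i)" "\<bar>fst j \<bullet> f x\<bar> \<le> snd j" for j x
        proof -
          have jS: "j \<in> S i" using j by (simp add: D_def)
          define u where "u = fst j"
          define s where "s = u \<bullet> f c / \<rho>"
          have u: "norm u = 1" using Sj(1)[OF jS] by (simp add: u_def)
          have d: "dist (u, s) y < \<eta>" using j by (simp add: D_def cell_def u_def s_def c_def \<rho>_def)
          have d1: "norm (u - fst y) \<le> \<eta>" and d2: "\<bar>s - snd y\<bar> \<le> \<eta>"
            using dist_fst_le[of "(u,s)" y] dist_snd_le[of "(u,s)" y] d by (auto simp: dist_norm)
          have "nv (fst y) \<bullet> (x - c) + snd y * \<rho> =
              (nv u \<bullet> (x - c) + s * \<rho>) - nv (u - fst y) \<bullet> (x - c) - (s - snd y) * \<rho>"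
            by (simp add: linear_diff[OF linn] inner_diff_left algebra_simps)
          moreover have "\<bar>nv u \<bullet> (x - c) + s * \<rho>\<bar> \<le> \<eta> * \<rho> + \<eta> * \<rho>"
            using expand[OF u x(1)] x(2) small[OF bd jS] \<rho> by (simp add: s_def u_def \<rho>_def)
          moreover have "\<bar>nv (u - fst y) \<bullet> (x - c)\<bar> \<le> (\<eta> * \<tau>) * \<rho>"
          proof -
            have "\<bar>nv (u - fst y) \<bullet> (x - c)\<bar> \<le> norm (nv (u - fst y)) * norm (x - c)"
              by (rule Cauchy_Schwarz_ineq2)
            also have "\<dots> \<le> (\<eta> * \<tau>) * \<rho>"
            proof (rule mult_mono)
              show "norm (nv (u - fst y)) \<le> \<eta> * \<tau>"
                using \<tau>(2)[of "u - fst y"] d1 \<tau>(1) by (meson mult_right_mono order_trans less_imp_le)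
            qed (use est(2)[OF x(1)] \<eta> \<tau> in auto)
            finally show ?thesis .
          qed
          moreover have "\<bar>(s - snd y) * \<rho>\<bar> \<le> \<eta> * \<rho>" using d2 \<rho> by (simp add: abs_mult)
          ultimately have "\<bar>nv (fst y) \<bullet> (x - c) + snd y * \<rho>\<bar> \<le> \<eta> * (3 + \<tau>) * \<rho>"
            by (simp add: algebra_simps)
          also have "\<dots> < a * \<beta> * \<rho>" using \<eta>(3) \<rho> by simp
          also have "\<dots> \<le> norm (nv (fst y)) * (\<beta> * \<rho>)"
            using Ynz(2)[OF y(1)] \<beta> \<rho> by (simp add: mult.assoc)
          finally have "\<bar>nv (fst y) \<bullet> (x - c) + snd y * \<rho>\<bar> / norm (nv (fst y)) < \<beta> * \<rho>"
            using Ynz(3)[OF y(1)] by (simp add: divide_less_eq mult.commute)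
          moreover have "nv (fst y) \<bullet> (x - c) + snd y * \<rho> = nv (fst y) \<bullet> x - (nv (fst y) \<bullet> c - snd y * \<rho>)"
            by (simp add: inner_diff_right)
          ultimately have "infdist x {z. nv (fst y) \<bullet> z = nv (fst y) \<bullet> c - snd y * \<rho>} < \<beta> * \<rho>"
            using infdist_hyperplane_le[OF Ynz(3)[OF y(1)], of x "nv (fst y) \<bullet> c - snd y * \<rho>"] by simp
          then show ?thesis by (simp add: nbhd_def hyp_def c_def \<rho>_def)
        qed
        have "D \<inter> S (Suc i) = {}"
        proof (rule ccontr)
          assume "D \<inter> S (Suc i) \<noteq> {}"
          then obtain j x where j: "j \<in> D" "x \<in> ball_set (B (Suc i))" "\<bar>fst j \<bullet> f x\<bar> \<le> snd j"
            by (auto simp: S_eq)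
          then show False using hit[of j x] playD(3)[OF P, of i] unfolding sig by blast
        qed
        from step[OF this] have "\<Phi> (Suc i) \<le> sum wt (S i - D) + \<kappa> * snd (B (Suc i)) powr \<gamma>"
          by (simp add: \<Phi>_def)
        moreover have "sum wt (S i - D) = \<Phi> i - sum wt D"
          unfolding \<Phi>_def by (rule sum_diff) (auto simp: finS D_def)
        moreover have "\<Phi> i / N \<le> sum wt D" using y(2) N2 by (simp add: D_def divide_le_eq mult.commute)
        ultimately show ?thesis by (simp add: algebra_simps)
      qed
      \<comment> \<open>Even indices carry the invariant with \<open>q\<close>. At odd ones the
        constant is larger: \<open>fact1\<close> bounds it by \<open>2 * q\<close>, and
        \<open>fact2\<close> brings it back below \<open>q\<close> one turn later.\<close>
      have inv: "\<Phi> (2 * k) \<le> q * snd (B (2 * k)) powr \<gamma> \<and>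
          \<Phi> (Suc (2 * k)) \<le> ((1 - 1/N) * q * G + \<kappa>) * snd (B (Suc (2 * k))) powr \<gamma>" for k
      proof -
        have odd: "\<Phi> (Suc i) \<le> ((1 - 1/N) * q * G + \<kappa>) * snd (B (Suc i)) powr \<gamma>"
          if "even i" "\<Phi> i \<le> q * snd (B i) powr \<gamma>" for i
        proof -
          have "q * snd (B i) powr \<gamma> \<le> 2 * q * snd (B i) powr \<gamma>" using q by simp
          then have "\<Phi> (Suc i) \<le> (1 - 1/N) * \<Phi> i + \<kappa> * snd (B (Suc i)) powr \<gamma>"
            using kill[OF that(1)] that(2) by linarith
          also have "(1 - 1/N) * \<Phi> i \<le> (1 - 1/N) * (q * (G * snd (B (Suc i)) powr \<gamma>))"
            using that(2) grow[of i] q N2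
            by (intro mult_left_mono) (auto intro: order_trans[OF _ mult_left_mono])
          finally show ?thesis by (simp add: algebra_simps)
        qed
        have even: "\<Phi> (2 * k) \<le> q * snd (B (2 * k)) powr \<gamma>"
        proof (induction k)
          case 0
          have "\<Phi> 0 \<le> sum wt (\<F> (B 0))"
            unfolding \<Phi>_def by (rule sum_mono2) (use F pos wt0 in \<open>auto simp: S_eq\<close>)
          also have "\<dots> \<le> \<kappa> * snd (B 0) powr \<gamma>" by (rule sumF)
          also have "\<dots> \<le> q * snd (B 0) powr \<gamma>" using \<kappa>(2) by (intro mult_right_mono) auto
          finally show ?case by simp
        next
          case (Suc k)
          let ?i = "Suc (2 * k)"
          have "\<Phi> (Suc ?i) \<le> \<Phi> ?i + \<kappa> * snd (B (Suc ?i)) powr \<gamma>"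
            using step[of "{}" ?i] by (simp add: \<Phi>_def)
          also have "\<Phi> ?i \<le> ((1 - 1/N) * q * G + \<kappa>) * (G * snd (B (Suc ?i)) powr \<gamma>)"
          proof (rule order_trans[OF odd[OF _ Suc]])
            show "((1 - 1/N) * q * G + \<kappa>) * snd (B ?i) powr \<gamma> \<le> ((1 - 1/N) * q * G + \<kappa>) * (G * snd (B (Suc ?i)) powr \<gamma>)"
              using grow[of ?i] N2 q \<kappa> by (intro mult_left_mono) (auto simp: G_def)
          qed simp
          finally have "\<Phi> (Suc ?i) \<le> (((1 - 1/N) * q * G + \<kappa>) * G + \<kappa>) * snd (B (Suc ?i)) powr \<gamma>"
            by (simp add: algebra_simps)
          also have "\<dots> \<le> q * snd (B (Suc ?i)) powr \<gamma>" using fact2 by (intro mult_right_mono) auto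
          finally show ?case by simp
        qed
        then show ?thesis using odd[of "2 * k"] by simp
      qed
      have bdd: "\<Phi> i \<le> 2 * q * snd (B i) powr \<gamma>" for i
      proof (cases "even i")
        case True
        then obtain k where "i = 2 * k" by (auto elim: evenE)
        then have "\<Phi> i \<le> q * snd (B i) powr \<gamma>" using inv by simp
        also have "\<dots> \<le> 2 * q * snd (B i) powr \<gamma>" using q by simp
        finally show ?thesis .
      next
        case False
        then obtain k where "i = Suc (2 * k)" by (auto elim: oddE)
        then have "\<Phi> i \<le> ((1 - 1/N) * q * G + \<kappa>) * snd (B i) powr \<gamma>" using inv by simp
        also have "\<dots> \<le> 2 * q * snd (B i) powr \<gamma>" using fact1 by (intro mult_right_mono) auto
        finally show ?thesis .
      qed
      \<comment> \<open>Only the second of each two turns is a centre cut; in the first one the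
        radius merely does not increase.\<close>
      have shrink: "snd (B (2 * k)) \<le> (1 - \<beta>) ^ k * snd (B 0)" for k
      proof (induction k)
        case (Suc k)
        let ?i = "Suc (2 * k)"
        have "snd (B (Suc ?i)) \<le> (1 - \<beta>) * snd (B ?i)"
        proof (rule centre_cut_shrinks[OF \<beta>(1) pos])
          have "\<sigma> (map B [0..<Suc ?i]) = centre_cut \<beta> (B ?i)" by (simp add: \<sigma>_def)
          then show "cball (fst (B (Suc ?i))) (snd (B (Suc ?i))) \<subseteq> cball (fst (B ?i)) (snd (B ?i)) -
             nbhd (fst (centre_cut \<beta> (fst (B ?i), snd (B ?i)))) (snd (centre_cut \<beta> (fst (B ?i), snd (B ?i))))"
            using playD(3)[OF P, of ?i] by (simp add: ball_set_def)
        qed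
        also have "\<dots> \<le> (1 - \<beta>) * ((1 - \<beta>) ^ k * snd (B 0))"
          using Suc play_radius_antimono[OF P \<beta>(1), of "2 * k" ?i] \<beta> by (intro mult_left_mono) auto
        finally show ?case by simp
      qed simp
      have "\<exists>i. snd (B i) < e" if "0 < e" for e
      proof -
        have "(\<lambda>k. (1 - \<beta>) ^ k * snd (B 0)) \<longlonglongrightarrow> 0"
          using \<beta> by (intro tendsto_mult_left_zero LIMSEQ_power_zero) auto
        from order_tendstoD(2)[OF this that] obtain k where "(1 - \<beta>) ^ k * snd (B 0) < e"
          by (auto simp: eventually_sequentially)
        then show ?thesis using shrink[of k] by (meson le_less_trans)
      qed
      moreover have "snd j \<le> snd (B i)"
        if "m \<le> i" "j \<in> \<F> (B m)" "x \<in> ball_set (B i)" "\<bar>fst j \<bullet> f x\<bar> \<le> snd j" for m i j x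
      proof -
        have "j \<in> S i" using that by (auto simp: S_eq)
        from small[OF bdd this] show ?thesis using \<eta> pos[of i]
          by (meson mult_left_le_one_le less_imp_le order_trans)
      qed
      ultimately show ?thesis by blast
    qed
    show "\<exists>\<sigma>. legal_strategy \<beta> \<sigma> \<and> (\<forall>B. play_against \<beta> UNIV \<sigma> B \<and> B 0 = b \<longrightarrow>
        (\<forall>e>0. \<exists>i. snd (B i) < e) \<and>
        (\<forall>m i j x. m \<le> i \<and> j \<in> \<F> (B m) \<and> x \<in> ball_set (B i) \<and> \<bar>fst j \<bullet> f x\<bar> \<le> snd j \<longrightarrow>
          snd j \<le> snd (B i)))"
      using legal main by blast
  qed
qed

section \<open>Small values of three integer linear forms\<close>

definition int_vec :: "real^3 \<Rightarrow> bool" where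
  "int_vec v \<longleftrightarrow> (\<forall>i. v $ i \<in> \<int>)"

lemma int_vec_cross: "int_vec v \<Longrightarrow> int_vec w \<Longrightarrow> int_vec (cross3 v w)"
  unfolding int_vec_def by (auto simp: forall_3 cross_components intro!: Ints_diff Ints_mult)

lemma int_vec_inner: "int_vec v \<Longrightarrow> int_vec w \<Longrightarrow> v \<bullet> w \<in> \<int>"
  unfolding int_vec_def by (auto simp: inner_vec_def sum_3 intro!: Ints_add Ints_mult)

lemma int_vec_diff: "int_vec v \<Longrightarrow> int_vec w \<Longrightarrow> int_vec (v - w)"
  unfolding int_vec_def by (auto intro!: Ints_diff)

lemma Ints_abs_less_1: "x \<in> \<int> \<Longrightarrow> \<bar>x\<bar> < 1 \<Longrightarrow> x = (0::real)"
  by (elim Ints_cases) auto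

lemma int_vec_norm_ge_1:
  assumes "int_vec v" "v \<noteq> 0"
  shows "1 \<le> norm v"
proof -
  obtain i where i: "v $ i \<noteq> 0" using assms(2) by (auto simp: vec_eq_iff)
  then have "1 \<le> \<bar>v $ i\<bar>" using assms(1) Ints_abs_less_1[of "v $ i"] by (force simp: int_vec_def)
  then show ?thesis using component_le_norm_cart[of v i] by linarith
qed

text \<open>Pigeonhole form of Minkowski's theorem: \<open>(N + 1) ^ 3\<close> lattice points of a
  cube fall into at most \<open>N ^ 3\<close> boxes. The values of a form lie in an interval of
  length \<open>6 * K * N\<close>, and rounding the number of boxes up costs at most
  \<open>K * N / A\<close> more, as \<open>N\<close> is chosen with every \<open>A\<close> at most
  \<open>K * N\<close>; hence \<open>343 = 7 ^ 3\<close>.\<close>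

lemma exists_int_vec_small_forms:
  fixes c1 c2 c3 :: "real^3"
  assumes K: "norm c1 \<le> K" "norm c2 \<le> K" "norm c3 \<le> K" "0 < K"
    and A: "0 < A1" "0 < A2" "0 < A3" "343 * K ^ 3 \<le> A1 * A2 * A3"
  shows "\<exists>w. int_vec w \<and> w \<noteq> 0 \<and> \<bar>c1 \<bullet> w\<bar> \<le> A1 \<and> \<bar>c2 \<bullet> w\<bar> \<le> A2 \<and> \<bar>c3 \<bullet> w\<bar> \<le> A3"
proof -
  obtain N :: nat where N: "A1 / K + A2 / K + A3 / K + 1 \<le> real N"
    using real_arch_simple by blast
  have q: "0 < A1 / K" "0 < A2 / K" "0 < A3 / K" using A K by auto
  have "A1 / K \<le> N" "A2 / K \<le> N" "A3 / K \<le> N" using N q by linarith+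
  then have NA: "A1 \<le> K * real N" "A2 \<le> K * real N" "A3 \<le> K * real N"
    using K by (simp_all add: divide_le_eq mult.commute)
  define vv where "vv = (\<lambda>(a::nat, b::nat, c::nat). (vector [real a, real b, real c] :: real^3))"
  define P where "P = {..N} \<times> {..N} \<times> {..N}"
  have inj: "inj_on vv P"
    by (auto simp: inj_on_def vv_def vec_eq_iff forall_3)
  have cP: "card P = (N + 1) ^ 3" by (simp add: P_def card_cartesian_product power3_eq_cube)
  have nv: "norm (vv p) \<le> 3 * real N" if "p \<in> P" for p
  proof -
    obtain a b c where p: "p = (a, b, c)" by (cases p)
    have "norm (vv p) \<le> (\<Sum>i\<in>UNIV. \<bar>vv p $ i\<bar>)" by (rule norm_le_l1_cart)
    also have "\<dots> \<le> 3 * real N" using that by (simp add: sum_3 vv_def p P_def)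
    finally show ?thesis .
  qed
  define F where "F p = (nat \<lfloor>(c1 \<bullet> vv p + 3 * K * N) / A1\<rfloor>, nat \<lfloor>(c2 \<bullet> vv p + 3 * K * N) / A2\<rfloor>,
     nat \<lfloor>(c3 \<bullet> vv p + 3 * K * N) / A3\<rfloor>)" for p
  have bnd: "0 \<le> c \<bullet> vv p + 3 * K * N" "c \<bullet> vv p + 3 * K * N \<le> 6 * K * N"
    if "norm c \<le> K" "p \<in> P" for c p
  proof -
    have "\<bar>c \<bullet> vv p\<bar> \<le> norm c * norm (vv p)" by (rule Cauchy_Schwarz_ineq2)
    also have "\<dots> \<le> K * (3 * real N)" using that nv K by (intro mult_mono) auto
    finally show "0 \<le> c \<bullet> vv p + 3 * K * N" "c \<bullet> vv p + 3 * K * N \<le> 6 * K * N" by auto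
  qed
  define m where "m a = nat \<lfloor>6 * K * N / a\<rfloor>" for a
  have fl: "nat \<lfloor>(c \<bullet> vv p + 3 * K * N) / a\<rfloor> \<le> m a" if "norm c \<le> K" "p \<in> P" "0 < a" for c p a
    unfolding m_def using bnd[OF that(1,2)] that(3) by (intro nat_mono floor_mono divide_right_mono) auto
  have sub: "F ` P \<subseteq> {..m A1} \<times> {..m A2} \<times> {..m A3}"
    using fl K A by (auto simp: F_def)
  have m: "real (m a) + 1 \<le> 7 * K * N / a" if "0 < a" "a \<le> K * N" for a
  proof -
    have "real (m a) \<le> 6 * K * N / a" unfolding m_def using K that by simp
    moreover have "1 \<le> K * N / a" using that by simp
    moreover have "7 * K * N / a = 6 * K * N / a + K * N / a" by (simp add: add_divide_distrib[symmetric])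
    ultimately show ?thesis by linarith
  qed
  have "real (card (F ` P)) \<le> real ((m A1 + 1) * ((m A2 + 1) * (m A3 + 1)))"
    using card_mono[OF _ sub] by (intro of_nat_mono) (simp add: card_cartesian_product)
  also have "\<dots> = (real (m A1) + 1) * ((real (m A2) + 1) * (real (m A3) + 1))"
    by (simp only: of_nat_mult of_nat_add of_nat_1)
  also have "\<dots> \<le> (7 * K * N / A1) * ((7 * K * N / A2) * (7 * K * N / A3))"
    using m A NA K by (intro mult_mono) auto
  also have "\<dots> = 343 * K ^ 3 * real N ^ 3 / (A1 * A2 * A3)" by (simp add: power3_eq_cube mult_ac)
  also have "\<dots> \<le> real N ^ 3"
  proof -
    have "343 * K ^ 3 * real N ^ 3 \<le> (A1 * A2 * A3) * real N ^ 3" using A by (intro mult_right_mono) auto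
    then show ?thesis using A by (simp add: divide_le_eq mult.commute)
  qed
  also have "\<dots> < real ((N + 1) ^ 3)" by (simp add: power_strict_mono)
  finally have "card (F ` P) < card P" unfolding cP of_nat_less_iff .
  then have "\<not> inj_on F P" by (rule pigeonhole)
  then obtain p p' where p: "p \<in> P" "p' \<in> P" "p \<noteq> p'" "F p = F p'"
    unfolding inj_on_def by blast
  define w where "w = vv p - vv p'"
  have "w \<noteq> 0" using inj p unfolding w_def inj_on_def by auto
  moreover have iv: "int_vec (vv q)" for q
    by (cases q) (auto simp: int_vec_def vv_def forall_3)
  have "int_vec w" unfolding w_def by (rule int_vec_diff[OF iv iv])
  moreover have cl: "\<bar>c \<bullet> w\<bar> \<le> a"
    if "nat \<lfloor>(c \<bullet> vv p + 3 * K * N) / a\<rfloor> = nat \<lfloor>(c \<bullet> vv p' + 3 * K * N) / a\<rfloor>" "norm c \<le> K" "0 < a" for c a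
  proof -
    let ?x = "(c \<bullet> vv p + 3 * K * N) / a" and ?y = "(c \<bullet> vv p' + 3 * K * N) / a"
    have "0 \<le> ?x" "0 \<le> ?y" using bnd(1)[OF that(2)] p that(3) by auto
    then have "\<lfloor>?x\<rfloor> = \<lfloor>?y\<rfloor>" using that(1) by (simp add: eq_nat_nat_iff)
    then have "\<bar>?x - ?y\<bar> < 1" by linarith
    moreover have "?x - ?y = c \<bullet> w / a" by (simp add: w_def inner_diff_right diff_divide_distrib[symmetric])
    ultimately show ?thesis using that(3) by (simp add: abs_divide)
  qed
  ultimately show ?thesis
    using cl[OF _ K(1) A(1)] cl[OF _ K(2) A(2)] cl[OF _ K(3) A(3)] p(4) by (auto simp: F_def)
qed

unbundle cross3_syntax

section \<open>Short vectors along the flow\<close>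

text \<open>The vectors \<open>b \<times> c\<close>, \<open>c \<times> a\<close>,
  \<open>a \<times> b\<close> are the dual basis times the determinant. Keeping the determinant on
  the left avoids division and makes this a polynomial identity.\<close>

lemma frame_inner:
  fixes a b c v w :: "real^3"
  shows "(a \<bullet> (b \<times> c)) * (v \<bullet> w) =
    (a \<bullet> v) * ((b \<times> c) \<bullet> w) + (b \<bullet> v) * ((c \<times> a) \<bullet> w) + (c \<bullet> v) * ((a \<times> b) \<bullet> w)"
  by (simp add: cross3_simps)

lemma frame_expand:
  fixes a b c v :: "real^3"
  shows "(a \<bullet> (b \<times> c)) *\<^sub>R v = (a \<bullet> v) *\<^sub>R (b \<times> c) + (b \<bullet> v) *\<^sub>R (c \<times> a) + (c \<bullet> v) *\<^sub>R (a \<times> b)"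
  by (rule vector_eq_rdot[THEN iffD1]) (simp add: inner_add_left frame_inner)

lemma coframe_expand:
  fixes a b c v :: "real^3"
  shows "(a \<bullet> (b \<times> c)) *\<^sub>R v = ((b \<times> c) \<bullet> v) *\<^sub>R a + ((c \<times> a) \<bullet> v) *\<^sub>R b + ((a \<times> b) \<bullet> v) *\<^sub>R c"
proof (rule vector_eq_rdot[THEN iffD1, rule_format])
  fix z
  show "((a \<bullet> (b \<times> c)) *\<^sub>R v) \<bullet> z =
    (((b \<times> c) \<bullet> v) *\<^sub>R a + ((c \<times> a) \<bullet> v) *\<^sub>R b + ((a \<times> b) \<bullet> v) *\<^sub>R c) \<bullet> z"
    using frame_inner[of a b c z v] by (simp add: inner_add_left inner_commute[of v z] mult.commute)
qed

lemma cross_of_crosses: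
  fixes a b c :: "real^3"
  shows "(c \<times> a) \<times> (a \<times> b) = (a \<bullet> (b \<times> c)) *\<^sub>R a"
  by (simp add: vec_eq_iff forall_3 cross_components inner_vec_def sum_3 algebra_simps)

text \<open>Up to the determinant, a form of a cross product is a 2 by 2 minor of dual forms. This
  is how bounds on two dual vectors yield a short vector.\<close>

lemma frame_cross:
  fixes a b c w w' :: "real^3"
  shows "(a \<bullet> (b \<times> c)) * (a \<bullet> (w \<times> w')) =
    ((c \<times> a) \<bullet> w) * ((a \<times> b) \<bullet> w') - ((c \<times> a) \<bullet> w') * ((a \<times> b) \<bullet> w)"
  using dot_cross[of "c \<times> a" "a \<times> b" w w'] by (simp add: cross_of_crosses)

lemma triple_rotate:
  fixes a b c :: "real^3"
  shows "b \<bullet> (c \<times> a) = a \<bullet> (b \<times> c)"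
  by (simp add: cross3_simps)

lemma cross_zero_parallel:
  fixes v w :: "real^3"
  assumes "v \<times> w = 0" "v \<noteq> 0"
  shows "w = ((v \<bullet> w) / (v \<bullet> v)) *\<^sub>R v"
proof -
  have "(v \<bullet> w) *\<^sub>R v = (v \<bullet> v) *\<^sub>R w"
    using Lagrange[of v v w] assms(1) by simp
  then have "(1 / (v \<bullet> v)) *\<^sub>R ((v \<bullet> w) *\<^sub>R v) = (1 / (v \<bullet> v)) *\<^sub>R ((v \<bullet> v) *\<^sub>R w)" by simp
  then show ?thesis using assms(2) by simp
qed

text \<open>In the application \<open>r1 x\<close>, \<open>r2 x\<close>, \<open>r3 x\<close> are the
  two nonnegative-rate forms and the contracted one, pulled back by a lift of the point
  \<open>x\<close>. A single \<open>K\<close> majorizes all constants. The Lipschitz bounds concern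
  the dual forms that get compared at two points of one ball. Time is scaled so that the contraction
  has rate 1, whence \<open>l1\<close> is at least 1/2.\<close>

locale moving_frame =
  fixes r1 r2 r3 :: "'a::euclidean_space \<Rightarrow> real^3" and X :: "'a set" and K l1 l2 :: real
  assumes K1: "1 \<le> K"
    and r_le: "x \<in> X \<Longrightarrow> norm (r1 x) \<le> K" "x \<in> X \<Longrightarrow> norm (r2 x) \<le> K" "x \<in> X \<Longrightarrow> norm (r3 x) \<le> K"
    and c_le: "x \<in> X \<Longrightarrow> norm (r2 x \<times> r3 x) \<le> K" "x \<in> X \<Longrightarrow> norm (r3 x \<times> r1 x) \<le> K"
      "x \<in> X \<Longrightarrow> norm (r1 x \<times> r2 x) \<le> K"
    and vol: "x \<in> X \<Longrightarrow> 1 \<le> K * \<bar>r1 x \<bullet> (r2 x \<times> r3 x)\<bar>"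
    and lip: "x \<in> X \<Longrightarrow> y \<in> X \<Longrightarrow> norm (r3 x \<times> r1 x - r3 y \<times> r1 y) \<le> K * norm (x - y)"
      "x \<in> X \<Longrightarrow> y \<in> X \<Longrightarrow> norm (r1 x \<times> r2 x - r1 y \<times> r2 y) \<le> K * norm (x - y)"
    and l: "0 \<le> l2" "l2 \<le> l1" "l1 + l2 = 1"
begin

abbreviation "c1 x \<equiv> r2 x \<times> r3 x"
abbreviation "c2 x \<equiv> r3 x \<times> r1 x"
abbreviation "c3 x \<equiv> r1 x \<times> r2 x"

abbreviation "a1 x v \<equiv> \<bar>r1 x \<bullet> v\<bar>"
abbreviation "a2 x v \<equiv> \<bar>r2 x \<bullet> v\<bar>"
abbreviation "a3 x v \<equiv> \<bar>r3 x \<bullet> v\<bar>"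
abbreviation "b1 x w \<equiv> \<bar>c1 x \<bullet> w\<bar>"
abbreviation "b2 x w \<equiv> \<bar>c2 x \<bullet> w\<bar>"
abbreviation "b3 x w \<equiv> \<bar>c3 x \<bullet> w\<bar>"

text \<open>By time \<open>t\<close> the forms are multiplied by exp(l1 t), exp(l2 t) and exp(-t);
  all three results are to be at most \<epsilon>.\<close>

definition short :: "real \<Rightarrow> real \<Rightarrow> 'a \<Rightarrow> real^3 \<Rightarrow> bool" where
  "short \<epsilon> t x v \<longleftrightarrow> int_vec v \<and> v \<noteq> 0 \<and> a1 x v \<le> \<epsilon> / exp (l1 * t) \<and> a2 x v \<le> \<epsilon> / exp (l2 * t) \<and>
     a3 x v \<le> \<epsilon> * exp t"

text \<open>Chosen for the pigeonhole in \<open>exists_cls\<close>: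
  \<open>M * M / (8 * K) = 1250 * K ^ 3\<close>, which exceeds \<open>343 * K ^ 3\<close>.\<close>

definition M :: real where "M = 100 * K\<^sup>2"

text \<open>
  A short vector v at time n together with a dual vector w orthogonal to it. The norm of w is about
  exp (l1 * n - k), so k measures how far w is below the size expected from Minkowski's theorem.
\<close>

definition cls :: "real \<Rightarrow> nat \<Rightarrow> nat \<Rightarrow> 'a \<Rightarrow> real^3 \<Rightarrow> real^3 \<Rightarrow> bool" where
  "cls s n k x v w \<longleftrightarrow> short (s\<^sup>2) (real n) x v \<and> s\<^sup>2 * exp (real n) < 3 * a3 x v \<and> int_vec w \<and> w \<noteq> 0 \<and> v \<bullet> w = 0 \<and>
    b2 x w \<le> M * s * exp (l2 * n) \<and> b3 x w \<le> 6 * M * s / exp n \<and>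
    exp (l1 * n) < 3 * exp (real k) * norm w \<and> exp k * norm w \<le> exp (l1 * n) \<and> real k \<le> l1 * n \<and>
    1 \<le> 24 * K\<^sup>2 * M * s * exp k"

lemma l_half: "1/2 \<le> l1" "l1 \<le> 1" using l by auto

lemma exp_l: "exp (real n) = exp (l1 * n) * exp (l2 * n)"
  using l(3) by (simp add: mult_exp_exp distrib_right[symmetric])

lemma scale_vol:
  assumes "x \<in> X" "0 \<le> u" "\<bar>r1 x \<bullet> (c1 x)\<bar> * u \<le> y"
  shows "u \<le> K * y"
proof -
  have "1 * u \<le> (K * \<bar>r1 x \<bullet> (c1 x)\<bar>) * u" using vol[OF assms(1)] assms(2) by (intro mult_right_mono) auto
  also have "\<dots> = K * (\<bar>r1 x \<bullet> (c1 x)\<bar> * u)" by simp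
  also have "\<dots> \<le> K * y" using assms(3) K1 by (intro mult_left_mono) auto
  finally show ?thesis by simp
qed

lemma norm_three:
  fixes a b c :: "real^3"
  assumes "norm a \<le> K" "norm b \<le> K" "norm c \<le> K"
  shows "norm (p *\<^sub>R a + q *\<^sub>R b + r *\<^sub>R c) \<le> K * (\<bar>p\<bar> + \<bar>q\<bar> + \<bar>r\<bar>)"
proof -
  have "norm (p *\<^sub>R a + q *\<^sub>R b + r *\<^sub>R c) \<le> norm (p *\<^sub>R a) + norm (q *\<^sub>R b) + norm (r *\<^sub>R c)"
    by (meson norm_triangle_ineq norm_triangle_le add_right_mono order_trans)
  also have "\<dots> \<le> \<bar>p\<bar> * K + \<bar>q\<bar> * K + \<bar>r\<bar> * K"
    using assms by (auto intro!: add_mono mult_left_mono)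
  finally show ?thesis by (simp add: algebra_simps)
qed

lemma norm_le_forms:
  assumes "x \<in> X"
  shows "norm v \<le> K\<^sup>2 * (a1 x v + a2 x v + a3 x v)"
proof -
  have "\<bar>r1 x \<bullet> (c1 x)\<bar> * norm v = norm ((r1 x \<bullet> (c1 x)) *\<^sub>R v)" by simp
  also have "\<dots> \<le> K * (a1 x v + a2 x v + a3 x v)"
    unfolding frame_expand by (rule norm_three) (use c_le assms in auto)
  finally show ?thesis using scale_vol[OF assms, of "norm v"] by (simp add: power2_eq_square mult.assoc)
qed

lemma norm_le_coforms:
  assumes "x \<in> X"
  shows "norm v \<le> K\<^sup>2 * (b1 x v + b2 x v + b3 x v)"
proof -
  have "\<bar>r1 x \<bullet> (c1 x)\<bar> * norm v = norm ((r1 x \<bullet> (c1 x)) *\<^sub>R v)" by simp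
  also have "\<dots> \<le> K * (b1 x v + b2 x v + b3 x v)"
    unfolding coframe_expand by (rule norm_three) (use r_le assms in auto)
  finally show ?thesis using scale_vol[OF assms, of "norm v"] by (simp add: power2_eq_square mult.assoc)
qed

lemma inner_le:
  assumes "x \<in> X"
  shows "\<bar>v \<bullet> w\<bar> \<le> K * (a1 x v * b1 x w + a2 x v * b2 x w + a3 x v * b3 x w)"
proof (rule scale_vol[OF assms])
  have "\<bar>r1 x \<bullet> (c1 x)\<bar> * \<bar>v \<bullet> w\<bar> = \<bar>(r1 x \<bullet> v) * (c1 x \<bullet> w) + (r2 x \<bullet> v) * (c2 x \<bullet> w) + (r3 x \<bullet> v) * (c3 x \<bullet> w)\<bar>"
    by (simp add: frame_inner[symmetric] abs_mult)
  also have "\<dots> \<le> a1 x v * b1 x w + a2 x v * b2 x w + a3 x v * b3 x w"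
    by (simp add: abs_mult[symmetric])
  finally show "\<bar>r1 x \<bullet> (c1 x)\<bar> * \<bar>v \<bullet> w\<bar> \<le> a1 x v * b1 x w + a2 x v * b2 x w + a3 x v * b3 x w" .
qed simp

lemma orth_le:
  assumes "v \<bullet> w = 0"
  shows "a3 x v * b3 x w \<le> a1 x v * b1 x w + a2 x v * b2 x w"
proof -
  have "(r1 x \<bullet> v) * (c1 x \<bullet> w) + (r2 x \<bullet> v) * (c2 x \<bullet> w) + (r3 x \<bullet> v) * (c3 x \<bullet> w) = 0"
    using frame_inner[of "r1 x" "r2 x" "r3 x" v w] assms by simp
  then have "(r3 x \<bullet> v) * (c3 x \<bullet> w) = - ((r1 x \<bullet> v) * (c1 x \<bullet> w)) - (r2 x \<bullet> v) * (c2 x \<bullet> w)"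
    by linarith
  then have "\<bar>(r3 x \<bullet> v) * (c3 x \<bullet> w)\<bar> \<le> \<bar>(r1 x \<bullet> v) * (c1 x \<bullet> w)\<bar> + \<bar>(r2 x \<bullet> v) * (c2 x \<bullet> w)\<bar>"
    by linarith
  then show ?thesis by (simp add: abs_mult)
qed

lemma cross_forms:
  assumes "x \<in> X"
  shows "a1 x (w \<times> w') \<le> K * (b2 x w * b3 x w' + b2 x w' * b3 x w)"
    "a2 x (w \<times> w') \<le> K * (b3 x w * b1 x w' + b3 x w' * b1 x w)"
    "a3 x (w \<times> w') \<le> K * (b1 x w * b2 x w' + b1 x w' * b2 x w)"
proof -
  have D: "r2 x \<bullet> (r3 x \<times> r1 x) = r1 x \<bullet> (c1 x)" "r3 x \<bullet> (r1 x \<times> r2 x) = r1 x \<bullet> (c1 x)"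
    by (simp_all add: cross3_simps)
  have tri: "\<bar>p * q - r * u\<bar> \<le> \<bar>p\<bar> * \<bar>q\<bar> + \<bar>r\<bar> * \<bar>u\<bar>" for p q r u :: real
    unfolding abs_mult[symmetric] by linarith
  show "a1 x (w \<times> w') \<le> K * (b2 x w * b3 x w' + b2 x w' * b3 x w)"
    by (rule scale_vol[OF assms]) (simp_all add: abs_mult[symmetric] frame_cross tri del: abs_mult)
  show "a2 x (w \<times> w') \<le> K * (b3 x w * b1 x w' + b3 x w' * b1 x w)"
    by (rule scale_vol[OF assms]) (simp_all add: abs_mult[symmetric] frame_cross tri D(1)[symmetric])
  show "a3 x (w \<times> w') \<le> K * (b1 x w * b2 x w' + b1 x w' * b2 x w)"
    by (rule scale_vol[OF assms]) (simp_all add: abs_mult[symmetric] frame_cross tri D(2)[symmetric])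
qed

text \<open>A nonzero integer vector has norm at least 1, so it can be short only when exp t is
  large compared with 1/\<epsilon>. For \<open>\<epsilon> = s\<^sup>2\<close> it follows that
  \<open>1 / exp n\<close> is of order \<open>s\<^sup>2\<close> at every time \<open>n\<close> that
  matters.\<close>

lemma short_time:
  assumes "x \<in> X" "short \<epsilon> t x v" "0 \<le> t"
  shows "1 \<le> 3 * K\<^sup>2 * \<epsilon> * exp t"
proof -
  have b: "a1 x v \<le> \<epsilon> / exp (l1 * t)" "a2 x v \<le> \<epsilon> / exp (l2 * t)" "a3 x v \<le> \<epsilon> * exp t"
    and v: "int_vec v" "v \<noteq> 0" using assms(2) by (auto simp: short_def)
  have "0 \<le> \<epsilon> * exp t" using b(3) by linarith
  then have e: "0 \<le> \<epsilon>" by (simp add: zero_le_mult_iff)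
  have le: "\<epsilon> / exp (q * t) \<le> \<epsilon> * exp t" if "0 \<le> q" for q
  proof -
    have "1 \<le> exp (q * t)" "1 \<le> exp t" using that assms(3) by auto
    then have "\<epsilon> / exp (q * t) \<le> \<epsilon> / 1" using e by (intro divide_left_mono) auto
    also have "\<dots> \<le> \<epsilon> * exp t" using e \<open>1 \<le> exp t\<close> by (simp add: mult_le_cancel_left1)
    finally show ?thesis .
  qed
  have "1 \<le> norm v" using v by (rule int_vec_norm_ge_1)
  also have "\<dots> \<le> K\<^sup>2 * (a1 x v + a2 x v + a3 x v)" by (rule norm_le_forms[OF assms(1)])
  also have "\<dots> \<le> K\<^sup>2 * (3 * (\<epsilon> * exp t))"
  proof (rule mult_left_mono)
    show "a1 x v + a2 x v + a3 x v \<le> 3 * (\<epsilon> * exp t)"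
      using b le[of l1] le[of l2] l l_half by linarith
  qed simp
  finally show ?thesis by (simp add: mult_ac)
qed

text \<open>The sixth power is dictated by the third claim, as
  \<open>K * (K ^ 3 * M * s) = 100 * K ^ 6 * s\<close>.\<close>

lemma small_consequences:
  assumes s: "0 < s" "100000 * K ^ 6 * s \<le> 1"
  shows "100000 * s \<le> 1" "K\<^sup>2 * M * s \<le> 1/1000" "K ^ 3 * M * s \<le> 1 / (1000 * K)" "K ^ 3 * M * s ^ 3 \<le> 1 / (1000 * K)"
    "M * s \<le> 1/1000" "1000 * K^5 * (8 * K\<^sup>2 * s\<^sup>2) \<le> 1" "1000000 * (8 * K\<^sup>2 * s\<^sup>2) \<le> 1"
proof -
  have p: "K ^ i * s \<le> K ^ 6 * s" if "i \<le> 6" for i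
    using K1 that s by (intro mult_right_mono power_increasing) auto
  have P: "1000 * (100 * K ^ i * s) \<le> 1" if "i \<le> 6" for i using p[OF that] s(2) by linarith
  show 0: "100000 * s \<le> 1" using P[of 0] by simp
  have P': "1000 * (100 * K ^ 4 * s) \<le> 1" "1000 * (100 * K ^ 2 * s) \<le> 1" "1000 * (100 * K ^ 6 * s) \<le> 1"
    by (rule P, simp)+
  have e4: "K\<^sup>2 * M * s = 100 * K^4 * s" by (simp add: M_def power2_eq_square eval_nat_numeral)
  show "K\<^sup>2 * M * s \<le> 1/1000" unfolding e4 using P'(1) by linarith
  show "M * s \<le> 1/1000" unfolding M_def using P'(2) by linarith
  have "K * (K ^ 3 * M * s) = 100 * K^6 * s" by (simp add: M_def eval_nat_numeral)
  then have "K * (K ^ 3 * M * s) \<le> 1/1000" using P'(3) by linarith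
  then show 3: "K ^ 3 * M * s \<le> 1 / (1000 * K)" using K1 by (simp add: le_divide_eq mult_ac)
  have s1: "s \<le> 1" using 0 s by linarith
  have "s ^ 3 \<le> s" using s1 s by (simp add: power_le_one power3_eq_cube mult_le_one mult_left_le)
  then have "K ^ 3 * M * s ^ 3 \<le> K ^ 3 * M * s" using K1 by (intro mult_left_mono) (auto simp: M_def)
  then show "K ^ 3 * M * s ^ 3 \<le> 1 / (1000 * K)" using 3 by linarith
  have q: "(K ^ 6 * s) * s \<le> 1 / 100000 * (1 / 100000)" using s 0 by (intro mult_mono) (auto simp: field_simps)
  have "K ^ 7 * s\<^sup>2 \<le> (K ^ 6 * s) * (K ^ 6 * s)"
  proof -
    have "K ^ 7 * s\<^sup>2 \<le> K ^ 12 * s\<^sup>2" using K1 by (intro mult_right_mono power_increasing) auto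
    then show ?thesis by (simp add: power2_eq_square eval_nat_numeral mult_ac)
  qed
  also have "\<dots> \<le> 1 / 100000 * (1 / 100000)" using s K1 by (intro mult_mono) (auto simp: field_simps)
  finally show "1000 * K^5 * (8 * K\<^sup>2 * s\<^sup>2) \<le> 1" by (simp add: eval_nat_numeral mult_ac)
  have "K\<^sup>2 * s\<^sup>2 \<le> (K ^ 6 * s) * s"
  proof -
    have "K\<^sup>2 * s\<^sup>2 \<le> K ^ 6 * s\<^sup>2" using K1 by (intro mult_right_mono power_increasing) auto
    then show ?thesis by (simp add: power2_eq_square mult_ac)
  qed
  then show "1000000 * (8 * K\<^sup>2 * s\<^sup>2) \<le> 1" using q by simp
qed

text \<open>The pigeonhole bounds make \<open>\<bar>v \<bullet> w\<bar> < 1\<close>, so integrality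
  gives orthogonality. Orthogonality in turn improves the third bound on \<open>w\<close> from order
  \<open>1 / (s\<^sup>2 * N)\<close> to order \<open>s / N\<close>.\<close>

lemma exists_cls:
  assumes x: "x \<in> X" and s: "0 < s" "100000 * K ^ 6 * s \<le> 1" and "0 < n"
    and v: "short (s\<^sup>2) (real n) x v" and nv: "\<not> short (s\<^sup>2) (real n - 1) x v"
  shows "\<exists>k w. cls s n k x v w"
proof -
  note sc = small_consequences[OF s]
  define A B N where "A = exp (l1 * n)" and "B = exp (l2 * n)" and "N = exp (real n)"
  have NAB: "N = A * B" unfolding A_def B_def N_def by (rule exp_l)
  have AB: "0 < A" "0 < B" "0 < N" "1 \<le> B" "1 \<le> A" "1 \<le> N" "B \<le> A"
  proof -
    show "B \<le> A" using l(2) by (simp add: A_def B_def mult_right_mono)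
  qed (use l l_half in \<open>auto simp: A_def B_def N_def\<close>)
  have M0: "0 < M" using K1 by (simp add: M_def)
  have vb: "a1 x v \<le> s\<^sup>2 / A" "a2 x v \<le> s\<^sup>2 / B" "a3 x v \<le> s\<^sup>2 * N"
    and vi: "int_vec v" "v \<noteq> 0" using v by (auto simp: short_def A_def B_def N_def)
  \<comment> \<open>One unit of time earlier the bounds on the first two forms are weaker, so only
    the third can have failed; hence it is within a factor exp 1, at most 3, of its maximum.\<close>
  have r3v: "s\<^sup>2 * N < 3 * a3 x v"
  proof -
    have mono: "s\<^sup>2 / exp (q * real n) \<le> s\<^sup>2 / exp (q * (real n - 1))" if "0 \<le> q" for q
      using that by (intro divide_left_mono) (auto intro!: mult_left_mono)
    have "\<not> a3 x v \<le> s\<^sup>2 * exp (real n - 1)"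
      using nv vb mono[of l1] mono[of l2] vi l l_half unfolding short_def A_def B_def by (meson order_trans)
    moreover have "exp (real n - 1) = N / exp 1" by (simp add: N_def exp_diff)
    moreover have "N / 3 \<le> N / exp 1" using AB(3) exp_le by (intro divide_left_mono) auto
    ultimately have "s\<^sup>2 * (N / 3) < a3 x v"
      by (smt (verit) mult_left_mono zero_le_power2)
    then show ?thesis by simp
  qed
  \<comment> \<open>Against the bounds on \<open>v\<close> these leave products
    \<open>M * s ^ 3\<close>, \<open>M * s ^ 3\<close> and \<open>1 / (8 * K)\<close>; the last
    becomes 1/8 in \<open>inner_le\<close>.\<close>
  have "\<exists>w. int_vec w \<and> w \<noteq> 0 \<and> b1 x w \<le> M * s * A \<and> b2 x w \<le> M * s * B \<and>
      b3 x w \<le> 1 / (8 * K * s\<^sup>2 * N)"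
  proof (rule exists_int_vec_small_forms)
    have "343 * K ^ 3 \<le> 1250 * K ^ 3" using K1 by simp
    also have "1250 * K ^ 3 = M * M / (8 * K)"
      using K1 by (simp add: M_def power2_eq_square power3_eq_cube)
    also have "\<dots> = (M * M * s\<^sup>2 * N) * (1 / (8 * K * s\<^sup>2 * N))"
      using AB s by simp
    also have "M * M * s\<^sup>2 * N = (M * s * A) * (M * s * B)"
      by (simp add: NAB power2_eq_square)
    finally show "343 * K ^ 3 \<le> (M * s * A) * (M * s * B) * (1 / (8 * K * s\<^sup>2 * N))" .
  qed (use c_le x K1 M0 s AB in auto)
  then obtain w where w: "int_vec w" "w \<noteq> 0" "b1 x w \<le> M * s * A" "b2 x w \<le> M * s * B"
      "b3 x w \<le> 1 / (8 * K * s\<^sup>2 * N)" by blast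
  have p12: "a1 x v * b1 x w + a2 x v * b2 x w \<le> 2 * M * s ^ 3"
  proof -
    have "a1 x v * b1 x w \<le> (s\<^sup>2 / A) * (M * s * A)"
      by (rule mult_mono[OF vb(1) w(3)]) (use AB in auto)
    moreover have "a2 x v * b2 x w \<le> (s\<^sup>2 / B) * (M * s * B)"
      by (rule mult_mono[OF vb(2) w(4)]) (use AB in auto)
    moreover have "(s\<^sup>2 / A) * (M * s * A) = M * s ^ 3" "(s\<^sup>2 / B) * (M * s * B) = M * s ^ 3"
      using AB by (auto simp: power2_eq_square power3_eq_cube)
    ultimately show ?thesis by linarith
  qed
  have orth: "v \<bullet> w = 0"
  proof (rule Ints_abs_less_1[OF int_vec_inner[OF vi(1) w(1)]])
    have "a3 x v * b3 x w \<le> (s\<^sup>2 * N) * (1 / (8 * K * s\<^sup>2 * N))"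
      by (rule mult_mono[OF vb(3) w(5)]) (use AB in auto)
    also have "\<dots> = 1 / (8 * K)" using AB s by simp
    finally have "\<bar>v \<bullet> w\<bar> \<le> K * (2 * M * s ^ 3 + 1 / (8 * K))"
      using inner_le[OF x, of v w] p12 K1 by (smt (verit) mult_left_mono)
    also have "\<dots> = 2 * (K * M * s ^ 3) + 1/8" using K1 by (simp add: algebra_simps)
    also have "K * M * s ^ 3 \<le> K ^ 3 * M * s ^ 3"
      using K1 M0 s by (intro mult_right_mono) (auto simp: self_le_power)
    also have "\<dots> \<le> 1 / (1000 * K)" by (rule sc(4))
    also have "\<dots> \<le> 1 / 1000" using K1 by (simp add: divide_le_eq)
    finally show "\<bar>v \<bullet> w\<bar> < 1" by simp
  qed
  have c3w: "b3 x w \<le> 6 * M * s / N"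
  proof -
    have "(s\<^sup>2 * N) * b3 x w \<le> 3 * a3 x v * b3 x w" using r3v by (intro mult_right_mono) auto
    also have "\<dots> \<le> 3 * (2 * M * s ^ 3)" using orth_le[OF orth, of x] p12 by linarith
    finally have "s\<^sup>2 * (N * b3 x w) \<le> s\<^sup>2 * (6 * M * s)" by (simp add: power2_eq_square power3_eq_cube mult_ac)
    then have "N * b3 x w \<le> 6 * M * s" using s by (simp add: mult_le_cancel_left_pos)
    then show ?thesis using AB by (simp add: le_divide_eq mult.commute)
  qed
  have wn: "norm w \<le> 8 * K\<^sup>2 * M * s * A"
  proof -
    have "6 * M * s / N \<le> 6 * M * s * A"
    proof -
      have "6 * M * s / N \<le> 6 * M * s / 1" using AB M0 s by (intro divide_left_mono) auto
      also have "\<dots> \<le> 6 * M * s * A" using mult_left_mono[of 1 A "6 * M * s"] AB M0 s(1) by simp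
      finally show ?thesis .
    qed
    moreover have "M * s * B \<le> M * s * A" using AB M0 s by (intro mult_left_mono) auto
    ultimately have "b1 x w + b2 x w + b3 x w \<le> 8 * M * s * A" using w(3,4) c3w by linarith
    then have "K\<^sup>2 * (b1 x w + b2 x w + b3 x w) \<le> K\<^sup>2 * (8 * M * s * A)" by (intro mult_left_mono) auto
    then show ?thesis using norm_le_coforms[OF x, of w] by (simp add: mult_ac)
  qed
  have w1: "1 \<le> norm w" using w by (intro int_vec_norm_ge_1)
  \<comment> \<open>\<open>exp y\<close> is the factor by which \<open>w\<close> is shorter than
    exp(l1 n), and \<open>k\<close> is the integer part of \<open>y\<close>; the rounding accounts
    for the factor 3 in \<open>cls\<close>.\<close>
  define y where "y = l1 * n - ln (norm w)"
  have ey: "exp y = A / norm w" using w(2) by (simp add: y_def exp_diff A_def)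
  have ey1: "1 \<le> 8 * K\<^sup>2 * M * s * exp y" using wn w(2) by (simp add: ey le_divide_eq)
  have y0: "0 \<le> y"
  proof -
    have "8 * K\<^sup>2 * M * s * exp y \<le> 1 * exp y" using sc(2) by (intro mult_right_mono) auto
    then have "1 \<le> exp y" using ey1 by linarith
    then show ?thesis by simp
  qed
  define k where "k = nat \<lfloor>y\<rfloor>"
  have k: "real k \<le> y" "y < real k + 1" using y0 by (auto simp: k_def)
  have ek: "exp k \<le> exp y" "exp y < 3 * exp k"
  proof -
    show "exp k \<le> exp y" using k by simp
    have "exp y < exp (real k + 1)" using k by simp
    also have "\<dots> = exp 1 * exp k" by (simp add: exp_add)
    also have "\<dots> \<le> 3 * exp k" using exp_le by (intro mult_right_mono) auto
    finally show "exp y < 3 * exp k" .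
  qed
  have "cls s n k x v w"
    unfolding cls_def
  proof (intro conjI)
    show "exp (l1 * n) < 3 * exp (real k) * norm w"
      using ek(2) w(2) unfolding ey A_def[symmetric] by (simp add: divide_less_eq)
    show "exp k * norm w \<le> exp (l1 * n)"
      using ek(1) w(2) unfolding ey A_def[symmetric] by (simp add: le_divide_eq)
    show "real k \<le> l1 * n" using k(1) w1 unfolding y_def by (smt (verit) ln_ge_zero)
    have "8 * K\<^sup>2 * M * s * exp y \<le> 8 * K\<^sup>2 * M * s * (3 * exp k)" using ek(2) M0 s by (intro mult_left_mono) auto
    then show "1 \<le> 24 * K\<^sup>2 * M * s * exp k" using ey1 by linarith
  qed (use v r3v w orth c3w in \<open>auto simp: A_def B_def N_def\<close>)
  then show ?thesis by blast
qed

text \<open>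
  Dual vectors of class (n, k) are dealt with by Alice at balls of radius about rhat n k: there a
  single strip of half width thick s n k serves the whole class.
\<close>

definition rhat :: "nat \<Rightarrow> nat \<Rightarrow> real" where
  "rhat n k = exp (- (1 + l1) * n + (1 + 1/100) * k)"

definition thick :: "real \<Rightarrow> nat \<Rightarrow> nat \<Rightarrow> real" where
  "thick s n k = 300 * K ^ 3 * M * s * exp (- (1 + l1) * n + k)"

lemma rhat_alt: "rhat n k = exp (k / 100) * exp k / (exp n * exp (l1 * n))"
  by (simp add: rhat_def exp_add[symmetric] exp_diff[symmetric] algebra_simps)

lemma thick_alt: "thick s n k = 300 * K ^ 3 * M * s * exp k / (exp n * exp (l1 * n))"
proof -
  have "exp (- (1 + l1) * n + k) = exp k / (exp n * exp (l1 * n))"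
    by (simp add: exp_add[symmetric] exp_diff[symmetric] algebra_simps)
  then show ?thesis by (simp add: thick_def)
qed

text \<open>Why one strip per class is enough: \<open>w\<close> was found at \<open>x\<close> for a
  vector \<open>v\<close>, but its strip also contains \<open>x'\<close>, where the class is
  realized by other vectors \<open>v'\<close> and \<open>w'\<close>. The assumption
  \<open>safe\<close> will be the induction hypothesis on time during the play.\<close>

lemma cls_cover:
  assumes x: "x \<in> X" "x' \<in> X" and s: "0 < s" "100000 * K ^ 6 * s \<le> 1"
    and \<rho>: "norm (x - x') \<le> 2 * \<rho>" "\<rho> \<le> rhat n k"
    and c: "cls s n k x v w" and c': "cls s n k x' v' w'"
    and safe: "\<And>n' u. n' < n \<Longrightarrow> \<rho> \<le> exp (- (1 + l1) * real n') \<Longrightarrow> \<not> short (s\<^sup>2) (real n') x u"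
  shows "b3 x' w \<le> thick s n k * norm w"
proof -
  note sc = small_consequences[OF s]
  define A B N \<kappa> d where "A = exp (l1 * n)" and "B = exp (l2 * n)" and "N = exp (real n)"
    and "\<kappa> = exp (real k)" and "d = exp (real k / 100)"
  have M0: "0 < M" using K1 by (simp add: M_def)
  have NAB: "N = A * B" unfolding A_def B_def N_def by (rule exp_l)
  have AB: "0 < A" "0 < B" "0 < N" "1 \<le> B" "1 \<le> A" "1 \<le> N" "1 \<le> \<kappa>" "1 \<le> d"
    using l l_half by (auto simp: A_def B_def N_def \<kappa>_def d_def)
  have kn: "real k \<le> real n"
  proof -
    have "l1 * real n \<le> 1 * real n" using l_half by (intro mult_right_mono) auto
    then show ?thesis using c unfolding cls_def by linarith
  qed
  have d2: "d * d \<le> N" "d \<le> N"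
  proof -
    show "d * d \<le> N" using kn by (simp add: d_def N_def mult_exp_exp)
    show "d \<le> N" using kn by (simp add: d_def N_def)
  qed
  have N1: "1 \<le> 3 * K\<^sup>2 * s\<^sup>2 * N"
    using short_time[OF x(1), of "s\<^sup>2" "real n" v] c by (simp add: cls_def N_def)
  \<comment> \<open>As \<open>k \<le> n\<close>, \<open>d\<close> is at most the square root of
    \<open>N\<close>, and \<open>1 / N\<close> is of order \<open>s\<^sup>2\<close>. So the
    displacement error, although inflated by \<open>d\<close>, stays of order
    \<open>s\<close>.\<close>
  have dN: "d / N \<le> 2 * K * s"
  proof -
    have "(d / N)\<^sup>2 = (d * d) / (N * N)" by (simp add: power2_eq_square)
    also have "\<dots> \<le> N / (N * N)" using d2(1) AB by (intro divide_right_mono) auto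
    also have "\<dots> = 1 / N" using AB by simp
    finally have "(d / N)\<^sup>2 \<le> 1 / N" .
    also have "1 / N \<le> 3 * K\<^sup>2 * s\<^sup>2" using N1 AB(3) by (simp add: divide_le_eq)
    also have "\<dots> \<le> (2 * K * s)\<^sup>2" by (simp add: power_mult_distrib)
    finally show ?thesis by (rule power2_le_imp_le) (use K1 s(1) in simp)
  qed
  have w: "int_vec w" "w \<noteq> 0" "b2 x w \<le> M * s * B" "b3 x w \<le> 6 * M * s / N"
     "A < 3 * \<kappa> * norm w" "\<kappa> * norm w \<le> A" and kap: "1 \<le> 24 * K\<^sup>2 * M * s * \<kappa>"
    using c by (auto simp: cls_def A_def B_def N_def \<kappa>_def)
  have w': "int_vec w'" "w' \<noteq> 0" "v' \<bullet> w' = 0" "b2 x' w' \<le> M * s * B" "b3 x' w' \<le> 6 * M * s / N"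
     "A < 3 * \<kappa> * norm w'" "\<kappa> * norm w' \<le> A"
    using c' by (auto simp: cls_def A_def B_def N_def \<kappa>_def)
  have v': "int_vec v'" "a1 x' v' \<le> s\<^sup>2 / A" "a2 x' v' \<le> s\<^sup>2 / B" "a3 x' v' \<le> s\<^sup>2 * N" "s\<^sup>2 * N < 3 * a3 x' v'"
    using c' by (auto simp: cls_def short_def A_def B_def N_def)
  have nw: "norm u \<le> A / \<kappa>" if "\<kappa> * norm u \<le> A" for u :: "real^3"
    using that AB by (simp add: le_divide_eq mult.commute)
  have c1u: "b1 y u \<le> K * A / \<kappa>" if "y \<in> X" "\<kappa> * norm u \<le> A" for y u
  proof -
    have "b1 y u \<le> norm (c1 y) * norm u" by (rule Cauchy_Schwarz_ineq2)
    also have "\<dots> \<le> K * (A / \<kappa>)" using c_le(1)[OF that(1)] nw[OF that(2)] K1 by (intro mult_mono) auto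
    finally show ?thesis by simp
  qed
  \<comment> \<open>Displacement times length of the dual vector: exp k and exp(l1 n) cancel, and
    only the slack \<open>d\<close> remains over \<open>1 / N\<close>.\<close>
  have move: "\<bar>(p - q) \<bullet> u\<bar> \<le> 2 * K * d / N" if "norm (p - q) \<le> K * norm (x - x')" "\<kappa> * norm u \<le> A" for p q u :: "real^3"
  proof -
    have "\<bar>(p - q) \<bullet> u\<bar> \<le> norm (p - q) * norm u" by (rule Cauchy_Schwarz_ineq2)
    also have "\<dots> \<le> (K * (2 * (d * \<kappa> / (N * A)))) * (A / \<kappa>)"
    proof (rule mult_mono)
      have "norm (x - x') \<le> 2 * (d * \<kappa> / (N * A))"
        using \<rho> by (simp add: rhat_alt d_def \<kappa>_def N_def A_def)
      then have "K * norm (x - x') \<le> K * (2 * (d * \<kappa> / (N * A)))" using K1 by (intro mult_left_mono) auto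
      then show "norm (p - q) \<le> K * (2 * (d * \<kappa> / (N * A)))" using that(1) by linarith
    qed (use nw[OF that(2)] AB K1 in auto)
    also have "\<dots> = 2 * K * d / N" using AB by (simp add: field_simps)
    finally show ?thesis .
  qed
  \<comment> \<open>The claim is homogeneous in \<open>w\<close>, so it may be checked on a parallel
    vector \<open>u\<close> instead.\<close>
  have goal: ?thesis if "b3 x' u * (N * A) * norm w \<le> 300 * K ^ 3 * M * s * \<kappa> * norm w * norm u" "u = w \<or> (norm u > 0 \<and> b3 x' w * norm u = b3 x' u * norm w)" for u
  proof -
    have u0: "0 < norm u" using that(2) w(2) by auto
    have eq: "b3 x' w * norm u = b3 x' u * norm w" using that(2) by auto
    have "(b3 x' w * (N * A)) * norm u = b3 x' u * (N * A) * norm w" using eq by (simp add: mult_ac)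
    also have "\<dots> \<le> (300 * K ^ 3 * M * s * \<kappa> * norm w) * norm u" by (rule that(1))
    finally have "b3 x' w * (N * A) \<le> 300 * K ^ 3 * M * s * \<kappa> * norm w" using u0 by simp
    then show ?thesis
      using AB by (simp add: thick_alt N_def[symmetric] A_def[symmetric] \<kappa>_def[symmetric] le_divide_eq)
  qed
  \<comment> \<open>For moderate k the integer v' \<bullet> w is less than 1 in absolute value, so that w is orthogonal to
    the short vector at x' as well. For large k the vectors w and w' are parallel: otherwise w \<times> w'
    would be a vector that is short at an earlier time, which Alice has already excluded.\<close>
  show ?thesis
  proof (cases "8 * K\<^sup>2 * s\<^sup>2 * d \<le> 1")
    case True
    have b1: "b1 x' w \<le> K * A / \<kappa>" by (rule c1u[OF x(2) w(6)])
    have b2: "b2 x' w \<le> M * s * B + 2 * K * d / N"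
      using move[OF lip(1)[OF x] w(6)] w(3) by (simp add: inner_diff_left)
    have b3: "b3 x' w \<le> 6 * M * s / N + 2 * K * d / N"
      using move[OF lip(2)[OF x] w(6)] w(4) by (simp add: inner_diff_left)
    have p1: "a1 x' v' * b1 x' w \<le> s\<^sup>2 * (24 * K ^ 3 * M * s)"
    proof -
      have "a1 x' v' * b1 x' w \<le> (s\<^sup>2 / A) * (K * A / \<kappa>)"
        by (rule mult_mono[OF v'(2) b1]) (use AB in auto)
      also have "\<dots> = s\<^sup>2 * (K * (1 / \<kappa>))" using AB by simp
      also have "1 / \<kappa> \<le> 24 * K\<^sup>2 * M * s" using kap AB by (simp add: divide_le_eq)
      also have "s\<^sup>2 * (K * (24 * K\<^sup>2 * M * s)) = s\<^sup>2 * (24 * K ^ 3 * M * s)" by (simp add: power2_eq_square power3_eq_cube mult_ac)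
      finally show ?thesis using K1 by (simp add: mult_left_mono)
    qed
    have p2: "a2 x' v' * b2 x' w \<le> s\<^sup>2 * (M * s + 4 * K\<^sup>2 * s)"
    proof -
      have "a2 x' v' * b2 x' w \<le> (s\<^sup>2 / B) * (M * s * B + 2 * K * d / N)"
        by (rule mult_mono[OF v'(3) b2]) (use AB in auto)
      also have "\<dots> = s\<^sup>2 * (M * s + 2 * K * (d / N) / B)" using AB by (simp add: field_simps)
      also have "\<dots> \<le> s\<^sup>2 * (M * s + 2 * K * (2 * K * s) / 1)"
        using dN AB K1 s by (intro mult_left_mono add_left_mono frac_le) auto
      finally show ?thesis by (simp add: power2_eq_square mult.assoc)
    qed
    have KM: "M * s \<le> K ^ 3 * M * s" "K\<^sup>2 * s \<le> K ^ 3 * M * s"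
    proof -
      have "1 * (M * s) \<le> K ^ 3 * (M * s)" using K1 M0 s by (intro mult_right_mono) auto
      then show "M * s \<le> K ^ 3 * M * s" by simp
      have "1 \<le> M" using one_le_power[OF K1, of 2] by (simp add: M_def)
      then have "1 * 1 \<le> K * M" using K1 by (intro mult_mono) auto
      then have "K\<^sup>2 * s * 1 \<le> K\<^sup>2 * s * (K * M)" using s by (intro mult_left_mono) auto
      then show "K\<^sup>2 * s \<le> K ^ 3 * M * s" by (simp add: power2_eq_square power3_eq_cube mult_ac)
    qed
    have p12: "a1 x' v' * b1 x' w + a2 x' v' * b2 x' w \<le> s\<^sup>2 * (30 * (K ^ 3 * M * s))"
    proof -
      have "s\<^sup>2 * (24 * K ^ 3 * M * s) + s\<^sup>2 * (M * s + 4 * K\<^sup>2 * s) \<le> s\<^sup>2 * (30 * (K ^ 3 * M * s))"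
      proof -
        have "0 \<le> M * s" using M0 s(1) by simp
        then have "24 * K ^ 3 * M * s + (M * s + 4 * K\<^sup>2 * s) \<le> 30 * (K ^ 3 * M * s)" using KM by linarith
        then show ?thesis unfolding distrib_left[symmetric] by (intro mult_left_mono) auto
      qed
      then show ?thesis using p1 p2 by linarith
    qed
    \<comment> \<open>The displacement contributes \<open>2 * K\<^sup>2 * d * s\<^sup>2\<close>, at
      most 1/4 by the threshold of the case distinction; the rest is small with
      \<open>s\<close>.\<close>
    have orth: "v' \<bullet> w = 0"
    proof (rule Ints_abs_less_1[OF int_vec_inner[OF v'(1) w(1)]])
      have "a3 x' v' * b3 x' w \<le> (s\<^sup>2 * N) * (6 * M * s / N + 2 * K * d / N)"
        by (rule mult_mono[OF v'(4) b3]) (use AB in auto)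
      also have "\<dots> = s\<^sup>2 * (6 * (M * s)) + 2 * K * d * s\<^sup>2" using AB by (simp add: field_simps)
      also have "\<dots> \<le> s\<^sup>2 * (6 * (K ^ 3 * M * s)) + 2 * K * d * s\<^sup>2"
        using KM by (intro add_right_mono mult_left_mono) auto
      finally have "\<bar>v' \<bullet> w\<bar> \<le> K * (s\<^sup>2 * (30 * (K ^ 3 * M * s)) + (s\<^sup>2 * (6 * (K ^ 3 * M * s)) + 2 * K * d * s\<^sup>2))"
        using p12 inner_le[OF x(2), of v' w] K1 by (smt (verit) mult_left_mono)
      also have "\<dots> = K * (36 * (K ^ 3 * M * s ^ 3)) + (8 * K\<^sup>2 * s\<^sup>2 * d) / 4"
        by (simp add: power2_eq_square power3_eq_cube algebra_simps)
      also have "\<dots> \<le> K * (36 * (1 / (1000 * K))) + 1 / 4"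
        using sc(4) True K1 by (intro add_mono mult_left_mono divide_right_mono) auto
      also have "\<dots> < 1" using K1 by simp
      finally show "\<bar>v' \<bullet> w\<bar> < 1" .
    qed
    show ?thesis
    proof (rule goal[of w])
      have "(s\<^sup>2 * N) * b3 x' w \<le> 3 * a3 x' v' * b3 x' w" using v'(5) by (intro mult_right_mono) auto
      also have "\<dots> \<le> 3 * (s\<^sup>2 * (30 * (K ^ 3 * M * s)))" using orth_le[OF orth, of x'] p12 by linarith
      finally have "s\<^sup>2 * (N * b3 x' w) \<le> s\<^sup>2 * (90 * (K ^ 3 * M * s))" by (simp add: mult_ac)
      then have 1: "N * b3 x' w \<le> 90 * (K ^ 3 * M * s)" using s by (simp add: mult_le_cancel_left_pos)
      \<comment> \<open>The factors 90 and 3 give 270, within the 300 of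
        \<open>thick\<close>.\<close>
      have "(N * b3 x' w) * A \<le> (90 * (K ^ 3 * M * s)) * (3 * \<kappa> * norm w)"
        by (rule mult_mono[OF 1 less_imp_le[OF w(5)]]) (use AB K1 M0 s(1) in auto)
      also have "\<dots> \<le> 300 * K ^ 3 * M * s * \<kappa> * norm w" 
        using K1 M0 s AB by (simp add: mult_ac) 
      finally show "b3 x' w * (N * A) * norm w \<le> 300 * K ^ 3 * M * s * \<kappa> * norm w * norm w"
        by (intro mult_right_mono) (auto simp: mult_ac)
    qed simp
  next
    case False
    have par: "w \<times> w' = 0"
    proof (rule ccontr)
      assume ne: "w \<times> w' \<noteq> 0"
      \<comment> \<open>Now \<open>d > 1 / (8 * K\<^sup>2 * s\<^sup>2)\<close>, so one power of
        \<open>d\<close> pays for \<open>1 / s\<^sup>2\<close> and further powers for all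
        constants.\<close>
      have dbig: "1000 * K ^ 5 \<le> d" "1000000 \<le> d"
      proof -
        have q0: "0 < 8 * K\<^sup>2 * s\<^sup>2" using K1 s by simp
        have 1: "1 < 8 * K\<^sup>2 * s\<^sup>2 * d" using False by simp
        have "(8 * K\<^sup>2 * s\<^sup>2) * (1000 * K ^ 5) \<le> (8 * K\<^sup>2 * s\<^sup>2) * d" using sc(6) 1 by (simp add: mult_ac)
        then show "1000 * K ^ 5 \<le> d" using mult_le_cancel_left_pos[OF q0] by blast
        have "(8 * K\<^sup>2 * s\<^sup>2) * 1000000 \<le> (8 * K\<^sup>2 * s\<^sup>2) * d" using sc(7) 1 by (simp add: mult_ac)
        then show "1000000 \<le> d" using mult_le_cancel_left_pos[OF q0] by blast
      qed
      have k100: "100 < k"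
      proof (rule ccontr)
        assume "\<not> ?thesis"
        then have "d \<le> exp 1" by (simp add: d_def)
        then show False using exp_le dbig(2) by linarith
      qed
      \<comment> \<open>The number of time units to go back. Since 8/10 exceeds 1.01/1.5, the ball
        is small enough for \<open>safe\<close> at time \<open>n - \<sigma>\<close>; since it is
        below 1, the third form keeps a factor \<open>d ^ 20\<close> against the constants. The
        rounding is harmless because \<open>100 < k\<close>.\<close>
      define \<sigma> where "\<sigma> = nat \<lceil>8 * real k / 10\<rceil>"
      have \<sigma>: "8 * real k / 10 \<le> real \<sigma>" "real \<sigma> \<le> 8 * real k / 10 + 1" by (auto simp: \<sigma>_def)
      have \<sigma>n: "\<sigma> \<le> n" "0 < \<sigma>"
      proof -
        have "real \<sigma> \<le> real n" using \<sigma>(2) kn k100 by linarith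
        then show "\<sigma> \<le> n" by simp
        show "0 < \<sigma>" using \<sigma>(1) k100 by linarith
      qed
      define n' where "n' = n - \<sigma>"
      have n': "real n' = real n - real \<sigma>" "n' < n" using \<sigma>n by (auto simp: n'_def)
      have "\<rho> \<le> exp (- (1 + l1) * real n')"
      proof -
        have "(1 + 1/100) * real k \<le> (1 + l1) * real \<sigma>"
        proof -
          have "(3/2) * (8 * real k / 10) \<le> (1 + l1) * real \<sigma>" using \<sigma>(1) l_half by (intro mult_mono) auto
          moreover have "(1 + 1/100) * real k \<le> (3/2) * (8 * real k / 10)" by simp
          ultimately show ?thesis by (rule order_trans[rotated])
        qed
        then have "rhat n k \<le> exp (- (1 + l1) * real n')"
          unfolding rhat_def n' by (simp add: algebra_simps)
        then show ?thesis using \<rho>(2) by linarith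
      qed
      then have ns: "\<not> short (s\<^sup>2) (real n') x (w \<times> w')" using safe n'(2) by blast
      have dNn: "2 * K * d / N \<le> 2 * K" using d2 AB K1 by (simp add: divide_le_eq)
      have Ms1: "M * s \<le> 1" "6 * M * s \<le> 1" using sc(5) by auto
      have KB: "1 \<le> K * B" using mult_mono[of 1 K 1 B] K1 AB by simp
      have q2: "b2 x w \<le> 3 * K * B" "b2 x w' \<le> 3 * K * B"
      proof -
        have MB: "M * s * B \<le> K * B" using Ms1 K1 AB by (intro mult_right_mono) auto
        have KK: "K \<le> K * B" using K1 AB by (simp add: mult_le_cancel_left1)
        show "b2 x w \<le> 3 * K * B" using w(3) MB KB by linarith
        have "b2 x w' \<le> M * s * B + 2 * K * d / N"
          using move[OF lip(1)[OF x] w'(7)] w'(4) by (simp add: inner_diff_left)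
        then show "b2 x w' \<le> 3 * K * B" using MB KK dNn by linarith
      qed
      have q3: "b3 x w \<le> 3 * K * d / N" "b3 x w' \<le> 3 * K * d / N"
      proof -
        have "6 * M * s \<le> K * d" using Ms1 mult_mono[of 1 K 1 d] K1 AB by simp
        then have MB: "6 * M * s / N \<le> K * d / N" using AB by (intro divide_right_mono) auto
        have "0 \<le> K * d / N" using K1 AB by simp
        then show "b3 x w \<le> 3 * K * d / N" using w(4) MB by linarith
        have "b3 x w' \<le> 6 * M * s / N + 2 * K * d / N"
          using move[OF lip(2)[OF x] w'(7)] w'(5) by (simp add: inner_diff_left)
        then show "b3 x w' \<le> 3 * K * d / N" using MB by linarith
      qed
      have q1: "b1 x w \<le> 3 * K * A / \<kappa>" "b1 x w' \<le> 3 * K * A / \<kappa>"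
      proof -
        have "0 \<le> K * A / \<kappa>" using K1 AB by simp
        then have "1 * (K * A / \<kappa>) \<le> 3 * (K * A / \<kappa>)" by (intro mult_right_mono) auto
        also have "3 * (K * A / \<kappa>) = 3 * K * A / \<kappa>" by simp
        finally have "K * A / \<kappa> \<le> 3 * K * A / \<kappa>" by (simp only: mult_1)
        then show "b1 x w \<le> 3 * K * A / \<kappa>" "b1 x w' \<le> 3 * K * A / \<kappa>"
          using c1u[OF x(1) w(6)] c1u[OF x(1) w'(7)] by (auto intro: order_trans)
      qed
      have prod: "K * (\<bar>p\<bar> * \<bar>q\<bar> + \<bar>p'\<bar> * \<bar>q'\<bar>) \<le> K * (2 * (P * Q))"
        if "\<bar>p\<bar> \<le> P" "\<bar>q\<bar> \<le> Q" "\<bar>p'\<bar> \<le> P" "\<bar>q'\<bar> \<le> Q" for p q p' q' P Q :: real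
      proof -
        have "\<bar>p\<bar> * \<bar>q\<bar> \<le> P * Q" "\<bar>p'\<bar> * \<bar>q'\<bar> \<le> P * Q" using that by (auto intro!: mult_mono)
        then show ?thesis using K1 by (intro mult_left_mono) auto
      qed
      \<comment> \<open>At time \<open>n\<close> the first form of \<open>w \<times> w'\<close> may
        exceed its bound by about \<open>d / s\<^sup>2\<close>, while the third has a factor
        \<open>1 / \<kappa>\<close> to spare. Going back in time relaxes the first bound and
        tightens the third.\<close>
      have R1: "a1 x (w \<times> w') \<le> 18 * K ^ 3 * d / A"
      proof -
        have "a1 x (w \<times> w') \<le> K * (2 * ((3 * K * B) * (3 * K * d / N)))"
          using cross_forms(1)[OF x(1), of w w'] prod[OF q2(1) q3(2) q2(2) q3(1)] by linarith
        also have "\<dots> = 18 * K ^ 3 * d / A" using AB by (simp add: NAB power3_eq_cube)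
        finally show ?thesis .
      qed
      have R2: "a2 x (w \<times> w') \<le> 18 * K ^ 3 * d / (\<kappa> * B)"
      proof -
        have "a2 x (w \<times> w') \<le> K * (2 * ((3 * K * d / N) * (3 * K * A / \<kappa>)))"
          using cross_forms(2)[OF x(1), of w w'] prod[OF q3(1) q1(2) q3(2) q1(1)] by linarith
        also have "\<dots> = 18 * K ^ 3 * d / (\<kappa> * B)" using AB by (simp add: NAB power3_eq_cube mult_ac)
        finally show ?thesis .
      qed
      have R3: "a3 x (w \<times> w') \<le> 18 * K ^ 3 * N / \<kappa>"
      proof -
        have "a3 x (w \<times> w') \<le> K * (2 * ((3 * K * A / \<kappa>) * (3 * K * B)))"
          using cross_forms(3)[OF x(1), of w w'] prod[OF q1(1) q2(2) q1(2) q2(1)] by linarith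
        also have "\<dots> = 18 * K ^ 3 * N / \<kappa>" using AB by (simp add: NAB power3_eq_cube)
        finally show ?thesis .
      qed
      have dpow: "\<kappa> = d ^ 100" "exp (8 * real k / 10) = d ^ 80" "exp (4 * real k / 10) = d ^ 40"
        by (simp_all add: \<kappa>_def d_def exp_of_nat_mult[symmetric])
      \<comment> \<open>The common core of all three bounds: the case assumption replaces
        \<open>s\<^sup>2 * d\<close> by \<open>1 / (8 * K\<^sup>2)\<close>, and
        \<open>432 = 8 * 54\<close>.\<close>
      have key: "54 * K ^ 3 * d \<le> s\<^sup>2 * d ^ 21"
      proof -
        have "432 * K ^ 5 \<le> d" using dbig K1 by (smt (verit) zero_le_power)
        also have "d \<le> d ^ 19" using AB by (simp add: self_le_power)
        finally have a: "432 * K ^ 5 \<le> d ^ 19" .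
        have "1 * (54 * K ^ 3) \<le> (8 * K\<^sup>2 * s\<^sup>2 * d) * (54 * K ^ 3)"
          using False K1 by (intro mult_right_mono) auto
        also have "\<dots> = (432 * K ^ 5) * (s\<^sup>2 * d)" by (simp add: eval_nat_numeral mult_ac)
        also have "\<dots> \<le> d ^ 19 * (s\<^sup>2 * d)" using a AB by (intro mult_right_mono) auto
        finally have "54 * K ^ 3 \<le> s\<^sup>2 * d ^ 20" by (simp add: eval_nat_numeral mult_ac)
        then have "54 * K ^ 3 * d \<le> s\<^sup>2 * d ^ 20 * d" using AB by (intro mult_right_mono) auto
        then show ?thesis by (simp add: eval_nat_numeral mult_ac)
      qed
      have key2: "54 * K ^ 3 * d * y \<le> s\<^sup>2 * (d ^ 21 * y)" if "0 \<le> y" for y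
        using mult_right_mono[OF key that] by (simp add: mult_ac)
      have dm: "d ^ i \<le> d ^ j" if "i \<le> j" for i j using that AB by (intro power_increasing) auto
      have "short (s\<^sup>2) (real n') x (w \<times> w')"
        unfolding short_def
      proof (intro conjI)
        show "int_vec (w \<times> w')" using w w' by (intro int_vec_cross)
        have "exp (l1 * real \<sigma>) \<ge> d ^ 40"
        proof -
          have "(1/2) * (8 * real k / 10) \<le> l1 * real \<sigma>" using \<sigma>(1) l_half by (intro mult_mono) auto
          then have "exp (4 * real k / 10) \<le> exp (l1 * real \<sigma>)" by simp
          then show ?thesis by (simp only: dpow(3))
        qed
        then have "d ^ 21 \<le> exp (l1 * real \<sigma>)" using dm[of 21 40] by linarith
        then have "s\<^sup>2 * d ^ 21 \<le> s\<^sup>2 * exp (l1 * real \<sigma>)" by (intro mult_left_mono) auto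
        moreover have "18 * K ^ 3 * d \<le> 54 * K ^ 3 * d" using K1 AB by simp
        ultimately have "18 * K ^ 3 * d \<le> s\<^sup>2 * exp (l1 * real \<sigma>)" using key by linarith
        then have "18 * K ^ 3 * d / A \<le> s\<^sup>2 * exp (l1 * real \<sigma>) / A"
          using AB by (intro divide_right_mono) auto
        also have "\<dots> = s\<^sup>2 / exp (l1 * real n')"
          by (simp add: n' A_def right_diff_distrib exp_diff)
        finally show "a1 x (w \<times> w') \<le> s\<^sup>2 / exp (l1 * real n')" using R1 by linarith
        have "18 * K ^ 3 * d / (\<kappa> * B) \<le> s\<^sup>2 / B"
        proof -
          have "s\<^sup>2 * d ^ 21 \<le> s\<^sup>2 * \<kappa>" unfolding dpow by (intro mult_left_mono dm) auto
          then have "18 * K ^ 3 * d \<le> s\<^sup>2 * \<kappa>" using key \<open>18 * K ^ 3 * d \<le> 54 * K ^ 3 * d\<close> by linarith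
          then show ?thesis using AB by (simp add: divide_le_eq mult_ac)
        qed
        also have "s\<^sup>2 / B \<le> s\<^sup>2 / exp (l2 * real n')"
          unfolding B_def using n' l by (intro divide_left_mono) (auto intro!: mult_left_mono)
        finally show "a2 x (w \<times> w') \<le> s\<^sup>2 / exp (l2 * real n')" using R2 by linarith
        have "exp (real \<sigma>) \<le> 3 * d ^ 80"
        proof -
          have "exp (real \<sigma>) \<le> exp (8 * real k / 10 + 1)" using \<sigma>(2) by simp
          also have "\<dots> = d ^ 80 * exp 1" by (simp only: exp_add dpow)
          also have "\<dots> \<le> d ^ 80 * 3" using exp_le AB by (intro mult_left_mono) auto
          finally show ?thesis by simp
        qed
        then have "18 * K ^ 3 * exp (real \<sigma>) \<le> 18 * K ^ 3 * (3 * d ^ 80)" using K1 by (intro mult_left_mono) auto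
        also have "\<dots> = 54 * K ^ 3 * d * d ^ 79" by (simp add: power_Suc[symmetric] mult.assoc del: power_Suc)
        also have "\<dots> \<le> s\<^sup>2 * (d ^ 21 * d ^ 79)" by (rule key2) (use AB in simp)
        also have "d ^ 21 * d ^ 79 = \<kappa>" by (simp add: dpow power_add[symmetric])
        finally have "18 * K ^ 3 * exp (real \<sigma>) \<le> s\<^sup>2 * \<kappa>" .
        then have "18 * K ^ 3 * exp (real \<sigma>) * (N / (\<kappa> * exp (real \<sigma>))) \<le> s\<^sup>2 * \<kappa> * (N / (\<kappa> * exp (real \<sigma>)))"
          using AB by (intro mult_right_mono) auto
        moreover have "s\<^sup>2 * \<kappa> * (N / (\<kappa> * exp (real \<sigma>))) = s\<^sup>2 * exp (real n')"
          using AB by (simp add: n' exp_diff N_def)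
        moreover have "18 * K ^ 3 * exp (real \<sigma>) * (N / (\<kappa> * exp (real \<sigma>))) = 18 * K ^ 3 * N / \<kappa>" by simp
        ultimately show "a3 x (w \<times> w') \<le> s\<^sup>2 * exp (real n')" using R3 by linarith
      qed (rule ne)
      with ns show False by blast
    qed
    show ?thesis
    proof (rule goal[of w'])
      define q where "q = (w \<bullet> w') / (w \<bullet> w)"
      have q: "w' = q *\<^sub>R w" unfolding q_def by (rule cross_zero_parallel[OF par w(2)])
      show "w' = w \<or> (norm w' > 0 \<and> b3 x' w * norm w' = b3 x' w' * norm w)"
        using w'(2) by (simp add: q abs_mult)
      have "(b3 x' w' * N) * A \<le> (6 * M * s) * (3 * \<kappa> * norm w')"
      proof (rule mult_mono[OF _ less_imp_le[OF w'(6)]])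
        show "b3 x' w' * N \<le> 6 * M * s" using w'(5) AB(3) by (simp add: le_divide_eq)
      qed (use AB M0 s(1) in auto)
      also have "\<dots> = 18 * (M * s * (\<kappa> * norm w'))" by simp
      also have "\<dots> \<le> 300 * K ^ 3 * (M * s * (\<kappa> * norm w'))"
      proof (rule mult_right_mono)
        have "1 \<le> K ^ 3" using K1 by simp
        then show "18 \<le> 300 * K ^ 3" by linarith
      qed (use M0 s AB in auto)
      finally have "(b3 x' w' * N) * A * norm w \<le> 300 * K ^ 3 * (M * s * (\<kappa> * norm w')) * norm w"
        by (intro mult_right_mono) auto
      then show "b3 x' w' * (N * A) * norm w \<le> 300 * K ^ 3 * M * s * \<kappa> * norm w * norm w'"
        by (simp add: mult_ac)
    qed
  qed
qed

end

lemma card_nat_between: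
  assumes "finite T" "\<And>n. n \<in> T \<Longrightarrow> p \<le> real n \<and> real n \<le> q" "0 \<le> q - p"
  shows "real (card T) \<le> q - p + 1"
proof (cases "T = {}")
  case False
  have "T \<subseteq> {Min T..Max T}" using assms(1) by auto
  then have "card T \<le> Suc (Max T) - Min T" using card_mono[of "{Min T..Max T}" T] by simp
  moreover have "Min T \<le> Max T" using False assms(1) by simp
  ultimately have "real (card T) \<le> real (Max T) - real (Min T) + 1" by linarith
  moreover have "p \<le> real (Min T)" "real (Max T) \<le> q"
    using assms(2) Min_in[OF assms(1) False] Max_in[OF assms(1) False] by auto
  ultimately show ?thesis by linarith
qed (use assms in simp)

context moving_frame
begin

text \<open>Bob's radius drops by at most the factor \<beta> per turn, so the first ball after the
  start with radius at most \<open>rhat n k\<close> has its radius in this window. There the class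
  is announced. The index \<open>k\<close> comes first because the sums run over \<open>n\<close>
  for fixed \<open>k\<close>.\<close>

definition idx :: "real \<Rightarrow> real \<Rightarrow> (nat \<times> nat) set" where
  "idx \<beta> \<rho> = {(k, n). real k \<le> l1 * n \<and> \<beta> * rhat n k \<le> \<rho> \<and> \<rho> \<le> rhat n k}"

lemma rhat_le:
  assumes "real k \<le> l1 * n"
  shows "rhat n k \<le> exp (- real n / 2)"
proof -
  have "l1 * real n \<le> 1 * real n" using l_half by (intro mult_right_mono) auto
  then show ?thesis unfolding rhat_def using assms by (simp add: algebra_simps)
qed

lemma idx_finite:
  assumes "0 < \<rho>"
  shows "\<exists>m. idx \<beta> \<rho> \<subseteq> Sigma {..m} (\<lambda>_. {..m})"
proof -
  obtain m :: nat where m: "- 2 * ln \<rho> \<le> real m" using real_arch_simple by blast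
  have "k \<le> m \<and> n \<le> m" if "(k, n) \<in> idx \<beta> \<rho>" for k n
  proof -
    have k: "real k \<le> l1 * n" "\<rho> \<le> rhat n k" using that by (auto simp: idx_def)
    then have "\<rho> \<le> exp (- real n / 2)" using rhat_le by (meson order_trans)
    then have "ln \<rho> \<le> - real n / 2" using assms by (simp add: ln_le_cancel_iff[symmetric] del: ln_le_cancel_iff)
    then have n: "real n \<le> real m" using m by linarith
    have "l1 * real n \<le> 1 * real n" using l_half by (intro mult_right_mono) auto
    then show ?thesis using n k(1) by linarith
  qed
  then show ?thesis by (intro exI[of _ m]) auto
qed

lemma thick_le:
  assumes "0 < s" "\<beta> * rhat n k \<le> \<rho>" "0 < \<beta>"
  shows "thick s n k \<le> (300 * K ^ 3 * M * s / \<beta>) * (exp (- real k / 100) * \<rho>)"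
proof -
  have M0: "0 < M" using K1 by (simp add: M_def)
  have "thick s n k = (300 * K ^ 3 * M * s / \<beta>) * (exp (- real k / 100) * (\<beta> * rhat n k))"
    using assms(3) by (simp add: thick_def rhat_def mult_exp_exp algebra_simps)
  also have "\<dots> \<le> (300 * K ^ 3 * M * s / \<beta>) * (exp (- real k / 100) * \<rho>)"
    using assms K1 M0 by (intro mult_left_mono) auto
  finally show ?thesis .
qed

lemma thick_pos: "0 < s \<Longrightarrow> 0 < thick s n k"
  using K1 by (simp add: thick_def M_def)

text \<open>For fixed \<open>k\<close> the window confines \<open>(1 + l1) * n\<close> to an
  interval of length \<open>- ln \<beta>\<close>.\<close>

lemma idx_card:
  assumes "0 < \<beta>" "\<beta> < 1" "0 < \<rho>"
  shows "real (card {n. (k, n) \<in> idx \<beta> \<rho>}) \<le> 1 - ln \<beta>"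
proof -
  obtain m where m: "idx \<beta> \<rho> \<subseteq> Sigma {..m} (\<lambda>_. {..m})" using idx_finite[OF assms(3)] by blast
  have fin: "finite {n. (k, n) \<in> idx \<beta> \<rho>}" by (rule finite_subset[of _ "{..m}"]) (use m in auto)
  define u where "u = (1 + 1/100) * real k - ln \<rho>"
  have lb: "ln \<beta> \<le> 0" using assms by simp
  have "real (card {n. (k, n) \<in> idx \<beta> \<rho>}) \<le> u / (1 + l1) - (u + ln \<beta>) / (1 + l1) + 1"
  proof (rule card_nat_between[OF fin])
    fix n assume "n \<in> {n. (k, n) \<in> idx \<beta> \<rho>}"
    then have 1: "\<beta> * rhat n k \<le> \<rho>" "\<rho> \<le> rhat n k" by (auto simp: idx_def)
    have "ln (\<beta> * rhat n k) \<le> ln \<rho>" using 1(1) assms by (simp add: rhat_def)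
    then have a: "u + ln \<beta> \<le> real n * (1 + l1)"
      using assms by (simp add: ln_mult rhat_def u_def algebra_simps)
    have "ln \<rho> \<le> ln (rhat n k)"
      by (subst ln_le_cancel_iff) (use 1(2) assms in \<open>auto simp: rhat_def\<close>)
    then have b: "real n * (1 + l1) \<le> u" by (simp add: rhat_def u_def algebra_simps)
    show "(u + ln \<beta>) / (1 + l1) \<le> real n \<and> real n \<le> u / (1 + l1)"
      using a b l_half by (simp add: divide_le_eq le_divide_eq)
    next
    have "(u + ln \<beta>) / (1 + l1) \<le> u / (1 + l1)" using lb l_half by (intro divide_right_mono) auto
    then show "0 \<le> u / (1 + l1) - (u + ln \<beta>) / (1 + l1)" by simp
  qed
  also have "u / (1 + l1) - (u + ln \<beta>) / (1 + l1) = - ln \<beta> / (1 + l1)"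
    by (simp add: diff_divide_distrib[symmetric])
  also have "\<dots> \<le> - ln \<beta> / 1" using lb l_half by (intro divide_left_mono) auto
  finally show ?thesis by simp
qed

text \<open>By \<open>thick_le\<close> the relative width is of order exp(-k/100), so the weights
  are dominated by a geometric series in \<open>k\<close>, with boundedly many \<open>n\<close> for
  each \<open>k\<close>. The bound tends to 0 with \<open>s\<close>, which lets it fit any
  budget.\<close>

lemma idx_budget:
  assumes "0 < \<beta>" "\<beta> < 1" "0 < \<rho>" "0 < \<gamma>" "0 < s"
  shows "(\<Sum>(k, n)\<in>idx \<beta> \<rho>. thick s n k powr \<gamma>) \<le>
    (1 - ln \<beta>) * ((300 * K ^ 3 * M * s / \<beta>) powr \<gamma> / (1 - exp (- \<gamma> / 100))) * \<rho> powr \<gamma>"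
proof -
  have M0: "0 < M" using K1 by (simp add: M_def)
  obtain m where m: "idx \<beta> \<rho> \<subseteq> Sigma {..m} (\<lambda>_. {..m})" using idx_finite[OF assms(3)] by blast
  define Q where "Q = (300 * K ^ 3 * M * s / \<beta>) powr \<gamma> * \<rho> powr \<gamma>"
  define z where "z = exp (- \<gamma> / 100)"
  have z: "0 < z" "z < 1" using assms by (auto simp: z_def)
  have Q0: "0 \<le> Q" by (simp add: Q_def)
  have lb: "ln \<beta> \<le> 0" using assms by simp
  have idx: "idx \<beta> \<rho> = (SIGMA k:{..m}. {n. (k, n) \<in> idx \<beta> \<rho>})" using m by auto
  have fin: "finite {n. (k, n) \<in> idx \<beta> \<rho>}" for k by (rule finite_subset[of _ "{..m}"]) (use m in auto)
  have "(\<Sum>(k, n)\<in>idx \<beta> \<rho>. thick s n k powr \<gamma>) = (\<Sum>k\<le>m. \<Sum>n\<in>{n. (k, n) \<in> idx \<beta> \<rho>}. thick s n k powr \<gamma>)"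
    by (subst idx, subst sum.Sigma[symmetric]) (use fin in auto)
  also have "\<dots> \<le> (\<Sum>k\<le>m. (1 - ln \<beta>) * (Q * z ^ k))"
  proof (rule sum_mono)
    fix k
    have "(\<Sum>n\<in>{n. (k, n) \<in> idx \<beta> \<rho>}. thick s n k powr \<gamma>) \<le> (\<Sum>n\<in>{n. (k, n) \<in> idx \<beta> \<rho>}. Q * z ^ k)"
    proof (rule sum_mono)
      fix n assume "n \<in> {n. (k, n) \<in> idx \<beta> \<rho>}"
      then have "\<beta> * rhat n k \<le> \<rho>" by (auto simp: idx_def)
      then have "thick s n k powr \<gamma> \<le> ((300 * K ^ 3 * M * s / \<beta>) * (exp (- real k / 100) * \<rho>)) powr \<gamma>"
        using thick_le thick_pos assms by (intro powr_mono2) (auto simp: less_imp_le)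
      also have "\<dots> = Q * z ^ k"
      proof -
        have "exp (- real k / 100) powr \<gamma> = z ^ k"
          by (simp add: z_def exp_of_nat_mult[symmetric] exp_powr_real)
        moreover have "0 \<le> 300 * K ^ 3 * M * s / \<beta>" using K1 M0 assms by simp
        ultimately show ?thesis unfolding Q_def using assms(3) by (subst powr_mult) (simp_all add: powr_mult)
      qed
      finally show "thick s n k powr \<gamma> \<le> Q * z ^ k" .
    qed
    also have "\<dots> = real (card {n. (k, n) \<in> idx \<beta> \<rho>}) * (Q * z ^ k)" by simp
    also have "\<dots> \<le> (1 - ln \<beta>) * (Q * z ^ k)"
      using idx_card[OF assms(1-3)] Q0 z by (intro mult_right_mono) auto
    finally show "(\<Sum>n\<in>{n. (k, n) \<in> idx \<beta> \<rho>}. thick s n k powr \<gamma>) \<le> (1 - ln \<beta>) * (Q * z ^ k)" .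
  qed
  also have "\<dots> = (1 - ln \<beta>) * (Q * (\<Sum>k\<le>m. z ^ k))" by (simp add: sum_distrib_left)
  also have "\<dots> \<le> (1 - ln \<beta>) * (Q * (1 / (1 - z)))"
  proof -
    have "(\<Sum>k\<le>m. z ^ k) \<le> (\<Sum>k. z ^ k)"
      using z by (intro sum_le_suminf summable_geometric) auto
    also have "\<dots> = 1 / (1 - z)" using z by (intro suminf_geometric) auto
    finally show ?thesis using Q0 lb by (intro mult_left_mono) auto
  qed
  finally show ?thesis by (simp add: Q_def z_def)
qed

lemma wins_from_frame:
  assumes \<beta>: "0 < \<beta>" "\<beta> < 1/3" and X: "ball x0 R \<subseteq> X" "0 < R"
    and strict: "strict_deriv c3 T x0"
    and surj: "\<And>u. norm u = 1 \<Longrightarrow> \<exists>\<xi>. u \<bullet> T \<xi> \<noteq> 0"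
    and S: "\<And>x \<epsilon>. x \<in> X \<Longrightarrow> 0 < \<epsilon> \<Longrightarrow> (\<And>n v. \<not> short \<epsilon> (real n) x v) \<Longrightarrow> x \<in> S"
  shows "\<exists>\<delta>>0. \<forall>b. 0 < snd b \<longrightarrow> ball_set b \<subseteq> ball x0 \<delta> \<longrightarrow> (\<exists>\<sigma>. wins_from \<beta> S b \<sigma>)"
proof -
  have M0: "0 < M" using K1 by (simp add: M_def)
  obtain \<delta> \<gamma> \<kappa> :: real where D: "0 < \<delta>" "0 < \<gamma>" "0 < \<kappa>"
    and strat: "\<forall>\<F> b. 0 < snd b \<and> ball_set b \<subseteq> ball x0 \<delta> \<and> thin_strips \<gamma> \<kappa> \<F> \<longrightarrow>
      (\<exists>\<sigma>. legal_strategy \<beta> \<sigma> \<and> (\<forall>B. play_against \<beta> UNIV \<sigma> B \<and> B 0 = b \<longrightarrow>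
        (\<forall>e>0. \<exists>i. snd (B i) < e) \<and>
        (\<forall>m i j x. m \<le> i \<and> j \<in> \<F> (B m) \<and> x \<in> ball_set (B i) \<and> \<bar>fst j \<bullet> c3 x\<bar> \<le> snd j \<longrightarrow>
          snd j \<le> snd (B i))))"
    using surj that by (rule avoid_strips[OF \<beta> strict])
  show ?thesis
  proof (intro exI[of _ "min \<delta> R"] conjI allI impI)
    show "0 < min \<delta> R" using D X by simp
    fix b :: "'a \<times> real"
    assume b: "0 < snd b" "ball_set b \<subseteq> ball x0 (min \<delta> R)"

    \<comment> \<open>Shortness and strips for the given first ball\<close>
    define C where "C = 300 * K ^ 3 * M / \<beta>"
    have C0: "0 < C" using K1 M0 \<beta> by (simp add: C_def)
    define E where "E = (1 - ln \<beta>) / (1 - exp (- \<gamma> / 100))"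
    have lb: "ln \<beta> < 0" using \<beta> by simp
    have E0: "0 < E" using lb D by (simp add: E_def)
    \<comment> \<open>The three bounds serve, in this order, \<open>small_consequences\<close>, the
      claim that every class that occurs has \<open>rhat\<close> below the first radius, and the
      budget \<kappa>.\<close>
    define s where "s = Min {1 / (100000 * K ^ 6), snd b / (3 * K), (\<kappa> / E) powr (1 / \<gamma>) / C}"
    have s: "0 < s" "s \<le> 1 / (100000 * K ^ 6)" "s \<le> snd b / (3 * K)" "s \<le> (\<kappa> / E) powr (1 / \<gamma>) / C"
      using K1 b D E0 C0 by (auto simp: s_def)
    have s6: "100000 * K ^ 6 * s \<le> 1" using s(2) K1 by (simp add: le_divide_eq mult.commute)
    have sb: "2 * K * s < snd b"
    proof -
      have "3 * K * s \<le> snd b" using s(3) K1 by (simp add: le_divide_eq mult.commute)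
      moreover have "0 < K * s" using K1 s(1) by simp
      ultimately show ?thesis by linarith
    qed
    have bud: "E * (C * s) powr \<gamma> \<le> \<kappa>"
    proof -
      have "C * s \<le> (\<kappa> / E) powr (1 / \<gamma>)" using s(4) C0 by (simp add: le_divide_eq mult.commute)
      then have "(C * s) powr \<gamma> \<le> ((\<kappa> / E) powr (1 / \<gamma>)) powr \<gamma>" using C0 s(1) D by (intro powr_mono2) auto
      also have "\<dots> = \<kappa> / E" using D E0 by (simp add: powr_powr)
      finally show ?thesis using E0 by (simp add: le_divide_eq mult.commute)
    qed
    define nonempty where "nonempty b' k n \<longleftrightarrow> (\<exists>w x v. x \<in> ball_set b' \<inter> X \<and> cls s n k x v w)" for b' k n
    \<comment> \<open>The choice depends on the ball and the class only, so that \<open>\<F>\<close>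
      is a function of the ball, as the game requires; \<open>cls_cover\<close> takes care of the
      points with other dual vectors.\<close>
    define rep where "rep b' k n = (SOME w. \<exists>x v. x \<in> ball_set b' \<inter> X \<and> cls s n k x v w)" for b' k n
    have rep: "\<exists>x v. x \<in> ball_set b' \<inter> X \<and> cls s n k x v (rep b' k n)" if "nonempty b' k n" for b' k n
      using that unfolding nonempty_def rep_def by (rule someI_ex)
    have rep0: "rep b' k n \<noteq> 0" if "nonempty b' k n" for b' k n
      using rep[OF that] by (auto simp: cls_def)
    define \<F> where "\<F> b' = (\<lambda>(k, n). (rep b' k n /\<^sub>R norm (rep b' k n), thick s n k)) `
      {(k, n) \<in> idx \<beta> (snd b'). nonempty b' k n}" for b'
    have F: "finite (\<F> b') \<and> (\<forall>j\<in>\<F> b'. norm (fst j) = 1 \<and> 0 < snd j) \<and>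
        (\<Sum>j\<in>\<F> b'. snd j powr \<gamma>) \<le> \<kappa> * snd b' powr \<gamma>" if b': "0 < snd b'" for b'
    proof (intro conjI)
      obtain m where m: "idx \<beta> (snd b') \<subseteq> Sigma {..m} (\<lambda>_. {..m})" using idx_finite[OF b'] by blast
      have fi: "finite (idx \<beta> (snd b'))" by (rule finite_subset[OF m]) auto
      have fJ: "finite {(k, n) \<in> idx \<beta> (snd b'). nonempty b' k n}"
        by (rule finite_subset[OF _ fi]) auto
      then show "finite (\<F> b')" unfolding \<F>_def by (rule finite_imageI)
      show "\<forall>j\<in>\<F> b'. norm (fst j) = 1 \<and> 0 < snd j"
        unfolding \<F>_def using rep0 thick_pos[OF s(1)] by auto
      have "(\<Sum>j\<in>\<F> b'. snd j powr \<gamma>) \<le>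
          sum ((\<lambda>j. snd j powr \<gamma>) \<circ> (\<lambda>(k, n). (rep b' k n /\<^sub>R norm (rep b' k n), thick s n k)))
            {(k, n) \<in> idx \<beta> (snd b'). nonempty b' k n}"
        unfolding \<F>_def by (rule sum_image_le[OF fJ]) auto
      also have "\<dots> = (\<Sum>(k, n)\<in>{(k, n) \<in> idx \<beta> (snd b'). nonempty b' k n}. thick s n k powr \<gamma>)"
        by (rule sum.cong) auto
      also have "\<dots> \<le> (\<Sum>(k, n)\<in>idx \<beta> (snd b'). thick s n k powr \<gamma>)"
        by (rule sum_mono2[OF fi]) auto
      also have "\<dots> \<le> (E * (C * s) powr \<gamma>) * snd b' powr \<gamma>"
        using idx_budget[OF \<beta>(1) _ b' D(2) s(1)] \<beta> by (simp add: E_def C_def mult_ac)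
      also have "\<dots> \<le> \<kappa> * snd b' powr \<gamma>" using bud by (intro mult_right_mono) auto
      finally show "(\<Sum>j\<in>\<F> b'. snd j powr \<gamma>) \<le> \<kappa> * snd b' powr \<gamma>" .
    qed
    have "thin_strips \<gamma> \<kappa> \<F>" unfolding thin_strips_def using F by blast
    moreover have "ball_set b \<subseteq> ball x0 \<delta>" using b(2) by auto
    ultimately have "0 < snd b \<and> ball_set b \<subseteq> ball x0 \<delta> \<and> thin_strips \<gamma> \<kappa> \<F>" using b(1) by simp
    from strat[THEN spec, THEN spec, THEN mp, OF this] obtain \<sigma> where leg: "legal_strategy \<beta> \<sigma>"
      and \<sigma>0: "\<forall>B. play_against \<beta> UNIV \<sigma> B \<and> B 0 = b \<longrightarrow>
        (\<forall>e>0. \<exists>i. snd (B i) < e) \<and>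
        (\<forall>m i j x. m \<le> i \<and> j \<in> \<F> (B m) \<and> x \<in> ball_set (B i) \<and> \<bar>fst j \<bullet> c3 x\<bar> \<le> snd j \<longrightarrow>
          snd j \<le> snd (B i))"
      by (elim exE conjE)
    note \<sigma> = \<sigma>0[THEN spec, THEN mp, OF conjI]
    have "(\<Inter>i. ball_set (B i)) \<inter> S \<noteq> {}" if P: "play_against \<beta> UNIV \<sigma> B" and B0: "B 0 = b" for B
    proof -

      \<comment> \<open>No short vectors along the play\<close>
      note pos = play_radius_pos[OF P \<beta>(1)]
      have conv: "\<exists>i. snd (B i) < e" if "0 < e" for e using \<sigma>[OF P B0] that by blast
      have avoid: "snd j \<le> snd (B i)"
        if "m \<le> i" "j \<in> \<F> (B m)" "x \<in> ball_set (B i)" "\<bar>fst j \<bullet> c3 x\<bar> \<le> snd j" for m i j x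
        using \<sigma>[OF P B0] that by blast
      have inX: "x \<in> X" if "x \<in> ball_set (B i)" for x i
      proof -
        have "x \<in> ball x0 (min \<delta> R)" using play_nested[OF P, of 0 i] B0 b(2) that by blast
        then show ?thesis using X(1) by auto
      qed
      \<comment> \<open>Induction on \<open>n\<close> with ball, point and vector arbitrary:
        \<open>cls_cover\<close> asks for the earlier times at the other point \<open>x1\<close> of
        the larger ball \<open>B m\<close>.\<close>
      have safe: "\<not> short (s\<^sup>2) (real n) x v"
        if "x \<in> ball_set (B i)" "snd (B i) \<le> exp (- (1 + l1) * real n)" for n i x v
        using that
      proof (induction n arbitrary: i x v rule: less_induct)
        case (less n)
        show ?case
        proof
          assume sh: "short (s\<^sup>2) (real n) x v"
          note x = inX[OF less.prems(1)]
          have t1: "1 \<le> 3 * K\<^sup>2 * s\<^sup>2 * exp (real n)" using short_time[OF x sh] by simp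
          have "3 * (8 * K\<^sup>2 * s\<^sup>2) < 1" using small_consequences(7)[OF s(1) s6] by linarith
          then have n0: "n \<noteq> 0" using t1 by (intro notI) simp
          have dec: "exp (- (1 + l1) * real n) \<le> exp (- (1 + l1) * real n')" if "n' \<le> n" for n'
            using that l_half by simp
          have "\<not> short (s\<^sup>2) (real (n - 1)) x v"
          proof (rule less.IH[OF _ less.prems(1)])
            show "n - 1 < n" using n0 by simp
            show "snd (B i) \<le> exp (- (1 + l1) * real (n - 1))"
              using less.prems(2) dec[OF diff_le_self] by (rule order_trans)
          qed
          then have "\<not> short (s\<^sup>2) (real n - 1) x v" using n0 by (simp add: of_nat_diff)
          from exists_cls[OF x s(1) s6 _ sh this] n0 obtain k w where kw: "cls s n k x v w" by blast
          have kl: "real k \<le> l1 * n" using kw by (simp add: cls_def)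
          have rh: "exp (- (1 + l1) * real n) \<le> rhat n k" by (simp add: rhat_def)
          \<comment> \<open>So the first ball of radius at most \<open>rhat n k\<close> has a
            predecessor of larger radius, which puts its own radius into the window of
            \<open>idx\<close>.\<close>
          have "rhat n k < snd (B 0)"
          proof -
            have "(exp (- real n / 2))\<^sup>2 = 1 / exp (real n)"
              by (simp add: power2_eq_square mult_exp_exp exp_minus inverse_eq_divide)
            also have "\<dots> \<le> 3 * K\<^sup>2 * s\<^sup>2" using t1 by (simp add: divide_le_eq)
            also have "\<dots> \<le> (2 * K * s)\<^sup>2" by (simp add: power_mult_distrib)
            finally have "exp (- real n / 2) \<le> 2 * K * s"
              by (rule power2_le_imp_le) (use K1 s(1) in simp)
            then show ?thesis using rhat_le[OF kl] sb B0 by simp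
          qed
          define m where "m = (LEAST m. snd (B m) \<le> rhat n k)"
          have ex: "snd (B i) \<le> rhat n k" using less.prems(2) rh by linarith
          have m: "snd (B m) \<le> rhat n k" "m \<le> i"
            unfolding m_def using ex by (rule LeastI, rule Least_le)
          have m0: "m \<noteq> 0" using m(1) \<open>rhat n k < snd (B 0)\<close> by (intro notI) simp
          then have "rhat n k < snd (B (m - 1))"
            using not_less_Least[of "m - 1" "\<lambda>m. snd (B m) \<le> rhat n k"] unfolding m_def[symmetric] by simp
          then have "\<beta> * rhat n k \<le> \<beta> * snd (B (m - 1))" using \<beta> by simp
          also have "\<dots> \<le> snd (B m)" using playD(4)[OF P, of "m - 1"] m0 by simp
          finally have id: "(k, n) \<in> idx \<beta> (snd (B m))" using m(1) kl by (simp add: idx_def)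
          have xm: "x \<in> ball_set (B m)" using play_nested[OF P m(2)] less.prems(1) by blast
          have ne: "nonempty (B m) k n" unfolding nonempty_def using xm x kw by blast
          define w0 where "w0 = rep (B m) k n"
          obtain x1 v1 where x1: "x1 \<in> ball_set (B m)" "x1 \<in> X" "cls s n k x1 v1 w0"
            using rep[OF ne] unfolding w0_def by blast
          have w0: "w0 \<noteq> 0" using x1(3) by (simp add: cls_def)
          have "norm (x1 - x) \<le> 2 * snd (B m)"
          proof -
            have "dist x1 x \<le> dist (fst (B m)) x1 + dist (fst (B m)) x" by (rule dist_triangle3)
            then show ?thesis using x1(1) xm by (simp add: ball_set_def dist_norm)
          qed
          then have cov: "\<bar>c3 x \<bullet> w0\<bar> \<le> thick s n k * norm w0"
            by (rule cls_cover[OF x1(2) x s(1) s6 _ m(1) x1(3) kw])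
              (use less.IH x1(1) in blast)
          have jF: "(w0 /\<^sub>R norm w0, thick s n k) \<in> \<F> (B m)"
            unfolding \<F>_def w0_def using id ne by force
          \<comment> \<open>As \<open>x\<close> lies in \<open>B i\<close> and in the strip,
            \<open>avoid\<close> makes the strip thinner than \<open>B i\<close>. But
            \<open>cls\<close> bounds exp k from below, so that the strip is wider than exp(-(1 +
            l1) n), which bounds the radius of \<open>B i\<close>.\<close>
          have "thick s n k \<le> snd (B i)"
          proof -
            have "\<bar>(w0 /\<^sub>R norm w0) \<bullet> c3 x\<bar> \<le> thick s n k"
            proof -
              have "\<bar>(w0 /\<^sub>R norm w0) \<bullet> c3 x\<bar> = \<bar>c3 x \<bullet> w0\<bar> / norm w0"
                by (simp add: abs_mult inner_commute divide_inverse mult.commute)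
              then show ?thesis using cov w0 by (simp add: divide_le_eq)
            qed
            then show ?thesis using avoid[OF m(2) jF less.prems(1)] by simp
          qed
          also have "\<dots> \<le> exp (- (1 + l1) * real n)" by (rule less.prems(2))
          also have "\<dots> < thick s n k"
          proof -
            have k1: "1 \<le> 24 * K\<^sup>2 * M * s * exp k" using kw by (simp add: cls_def)
            have "K ^ 2 * (M * s * exp k) \<le> K ^ 3 * (M * s * exp k)"
              using K1 M0 s(1) by (intro mult_right_mono power_increasing) auto
            then have "1 < 300 * K ^ 3 * M * s * exp k" using k1 by (simp add: mult_ac)
            then have "1 * exp (- (1 + l1) * real n) < (300 * K ^ 3 * M * s * exp k) * exp (- (1 + l1) * real n)"
              by (intro mult_strict_right_mono) auto
            then show ?thesis by (simp add: thick_def exp_add[symmetric] mult.assoc mult_exp_exp add.commute)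
          qed
          finally show False by simp
        qed
      qed

      \<comment> \<open>The common point of the balls\<close>
      have "(\<Inter>i. ball_set (B i)) \<noteq> {}"
      proof (rule compact_nest)
        show "compact (ball_set (B i))" for i by (simp add: ball_set_def)
        show "ball_set (B i) \<noteq> {}" for i using pos[of i] by (simp add: ball_set_def)
        show "ball_set (B j) \<subseteq> ball_set (B i)" if "i \<le> j" for i j using play_nested[OF P that] .
      qed
      then obtain x where x: "\<And>i. x \<in> ball_set (B i)" by blast
      have "x \<in> S"
      proof (rule S[OF inX[OF x[of 0]], of "s\<^sup>2"])
        show "0 < s\<^sup>2" using s(1) by simp
        fix n v
        obtain i where "snd (B i) < exp (- (1 + l1) * real n)" using conv[of "exp (- (1 + l1) * real n)"] by auto
        then show "\<not> short (s\<^sup>2) (real n) x v" using safe[OF x[of i]] by simp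
      qed
      then show ?thesis using x by blast
    qed
    then show "\<exists>\<sigma>. wins_from \<beta> S b \<sigma>" using leg unfolding wins_from_def by blast
  qed
qed

end

section \<open>Mahler's compactness criterion\<close>

text \<open>Split \<open>b3\<close> into a part in the plane of \<open>b1\<close>, \<open>b2\<close>
  and a normal part. Shifting by integers brings the planar coefficients to at most 1/2, and near
  minimality says that \<open>b3\<close> was hardly longer than the shifted vector. Unit volume
  gives the normal part length \<open>1 / norm (b1 \<times> b2)\<close>, and the bound on
  \<open>b1 \<bullet> b2\<close> keeps this cross product away from 0.\<close>

lemma near_minimal_basis_bound:
  fixes b1 b2 b3 :: "real^3"
  assumes ord: "norm b1 \<le> norm b2" "norm b2 \<le> norm b3" and \<epsilon>: "0 < \<epsilon>" "\<epsilon> \<le> norm b1"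
    and vol: "\<bar>b1 \<bullet> (b2 \<times> b3)\<bar> = 1"
    and m2: "\<And>m::int. (norm b2)\<^sup>2 - \<epsilon>\<^sup>2 / 8 \<le> (norm (b2 + of_int m *\<^sub>R b1))\<^sup>2"
    and m3: "\<And>m n::int. (norm b3)\<^sup>2 - \<epsilon>\<^sup>2 / 8 \<le> (norm (b3 + of_int m *\<^sub>R b1 + of_int n *\<^sub>R b2))\<^sup>2"
  shows "norm b3 \<le> 5 / \<epsilon>\<^sup>2"
proof -
  define p q r where "p = (norm b1)\<^sup>2" and "q = (norm b2)\<^sup>2" and "r = (norm b3)\<^sup>2"
  have pe: "\<epsilon>\<^sup>2 \<le> p" and pq: "p \<le> q" and qr: "q \<le> r"
    using ord \<epsilon> by (auto simp: p_def q_def r_def intro!: power_mono)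
  have e0: "0 < \<epsilon>\<^sup>2" using \<epsilon> by simp
  have p0: "0 < p" "0 < q" using pe pq e0 by linarith+
  then have pq0: "0 < p * q" by simp
  define d where "d = b1 \<bullet> b2"
  have n2: "(norm (x + y))\<^sup>2 = (norm x)\<^sup>2 + 2 * (x \<bullet> y) + (norm y)\<^sup>2" for x y :: "real^3"
    by (simp add: power2_norm_eq_inner inner_add_left inner_add_right inner_commute)
  \<comment> \<open>Comparison with \<open>b2 + b1\<close> and \<open>b2 - b1\<close>. An exact
    minimum would give 1/2; the tolerance, at most \<open>p / 8\<close>, makes it 9/16.\<close>
  have "\<bar>2 * d\<bar> \<le> p + \<epsilon>\<^sup>2 / 8"
    using m2[of 1] m2[of "-1"] unfolding n2 by (simp add: d_def p_def inner_commute)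
  then have d: "\<bar>d\<bar> \<le> 9/16 * p" using pe by linarith
  define c where "c = b1 \<times> b2"
  define C where "C = (norm c)\<^sup>2"
  have C: "C = p * q - d\<^sup>2" by (simp add: C_def c_def norm_cross p_def q_def d_def)
  have "d\<^sup>2 \<le> (9/16 * p)\<^sup>2" using d by (simp add: abs_le_square_iff[symmetric])
  also have "\<dots> = 81/256 * (p * p)" by (simp add: power2_eq_square)
  also have "p * p \<le> p * q" using pq p0 by (intro mult_left_mono) auto
  finally have "p * q / 2 \<le> C" using pq0 unfolding C by linarith
  moreover have "\<epsilon>\<^sup>2 * \<epsilon>\<^sup>2 \<le> p * q" using pe pq e0 p0 by (intro mult_mono) auto
  ultimately have Cb: "\<epsilon>\<^sup>2 * \<epsilon>\<^sup>2 / 2 \<le> C" by linarith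
  then have C0: "0 < C" using e0 by (smt (verit) half_gt_zero mult_pos_pos)
  define x y z where "x = ((b2 \<times> c) \<bullet> b3) / C" and "y = ((c \<times> b1) \<bullet> b3) / C" and "z = (c \<bullet> b3) / C"
  have "b1 \<bullet> (b2 \<times> c) = C"
    using cross_triple[of b1 b2 c] by (simp add: c_def C_def power2_norm_eq_inner inner_commute)
  then have "C *\<^sub>R b3 = ((b2 \<times> c) \<bullet> b3) *\<^sub>R b1 + ((c \<times> b1) \<bullet> b3) *\<^sub>R b2 + (c \<bullet> b3) *\<^sub>R c"
    using coframe_expand[of b1 b2 c b3] by (simp add: c_def)
  then have "(1/C) *\<^sub>R (C *\<^sub>R b3) = (1/C) *\<^sub>R (((b2 \<times> c) \<bullet> b3) *\<^sub>R b1 + ((c \<times> b1) \<bullet> b3) *\<^sub>R b2 + (c \<bullet> b3) *\<^sub>R c)"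
    by simp
  then have b3: "b3 = x *\<^sub>R b1 + y *\<^sub>R b2 + z *\<^sub>R c"
    using C0 by (simp add: x_def y_def z_def scaleR_add_right)
  define m n where "m = - round x" and "n = - round y"
  define x' y' where "x' = x + of_int m" and "y' = y + of_int n"
  have xy: "\<bar>x'\<bar> \<le> 1/2" "\<bar>y'\<bar> \<le> 1/2"
    using of_int_round_abs_le[of x] of_int_round_abs_le[of y] by (auto simp: x'_def y'_def m_def n_def abs_minus_commute)
  define w where "w = x' *\<^sub>R b1 + y' *\<^sub>R b2"
  have v: "b3 + of_int m *\<^sub>R b1 + of_int n *\<^sub>R b2 = w + z *\<^sub>R c"
    by (subst b3) (simp add: w_def x'_def y'_def scaleR_add_left)
  have wc: "w \<bullet> c = 0"
    by (simp add: w_def c_def inner_add_left dot_cross_self)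
  have x2: "x'\<^sup>2 \<le> 1/4" "y'\<^sup>2 \<le> 1/4"
    using power_mono[OF xy(1), of 2] power_mono[OF xy(2), of 2] by (simp_all add: power2_eq_square)
  have xyd: "x' * y' * d \<le> 1/4 * (9/16 * p)"
  proof -
    have "x' * y' * d \<le> \<bar>x'\<bar> * \<bar>y'\<bar> * \<bar>d\<bar>" by (simp add: abs_mult[symmetric])
    also have "\<dots> \<le> (1/2 * (1/2)) * (9/16 * p)" using xy d by (intro mult_mono) auto
    finally show ?thesis by simp
  qed
  have "(norm w)\<^sup>2 = x'\<^sup>2 * p + 2 * (x' * y' * d) + y'\<^sup>2 * q"
    unfolding w_def n2 by (simp add: p_def q_def d_def power_mult_distrib)
  also have "\<dots> \<le> 1/4 * p + 2 * (1/4 * (9/16 * p)) + 1/4 * q"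
    using x2 xyd p0 by (intro add_mono mult_right_mono) auto
  also have "\<dots> \<le> 25/32 * r" using pq qr pe e0 by linarith
  finally have wr: "(norm w)\<^sup>2 \<le> 25/32 * r" .
  have zc: "(norm (z *\<^sub>R c))\<^sup>2 = 1 / C"
  proof -
    have "\<bar>c \<bullet> b3\<bar> = 1"
      using vol cross_triple[of b1 b2 b3] cross_triple[of b2 b3 b1] by (simp add: c_def inner_commute)
    then have "(c \<bullet> b3)\<^sup>2 = 1" by (metis power2_abs one_power2)
    then have "z\<^sup>2 = 1 / (C * C)" by (simp add: z_def power_divide power2_eq_square)
    moreover have "(norm (z *\<^sub>R c))\<^sup>2 = z\<^sup>2 * C" by (simp add: power_mult_distrib C_def)
    ultimately show ?thesis using C0 by simp
  qed
  have "r - \<epsilon>\<^sup>2 / 8 \<le> (norm (w + z *\<^sub>R c))\<^sup>2" using m3[of m n] v by (simp add: r_def)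
  also have "\<dots> = (norm w)\<^sup>2 + 1 / C" unfolding n2 zc by (simp add: wc)
  \<comment> \<open>What remains of \<open>r\<close> after the tolerance 1/8 and the planar part
    \<open>25/32 = 1/4 + 9/32 + 1/4\<close>.\<close>
  finally have "3/32 * r \<le> 1 / C" using wr pe pq qr by linarith
  also have "1 / C \<le> 2 / (\<epsilon>\<^sup>2 * \<epsilon>\<^sup>2)"
    using Cb C0 e0 by (simp add: field_simps)
  finally have "r \<le> 64/3 / (\<epsilon>\<^sup>2 * \<epsilon>\<^sup>2)" by simp
  also have "\<dots> \<le> (5 / \<epsilon>\<^sup>2)\<^sup>2"
  proof -
    have "(5 / \<epsilon>\<^sup>2)\<^sup>2 = 25 / (\<epsilon>\<^sup>2 * \<epsilon>\<^sup>2)" by (simp add: power_divide power2_eq_square)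
    moreover have "64/3 / (\<epsilon>\<^sup>2 * \<epsilon>\<^sup>2) \<le> 25 / (\<epsilon>\<^sup>2 * \<epsilon>\<^sup>2)" by (intro divide_right_mono) auto
    ultimately show ?thesis by (simp only:)
  qed
  finally show ?thesis unfolding r_def by (rule power2_le_imp_le) (use e0 in simp)
qed

definition col_mat :: "real^3 \<Rightarrow> real^3 \<Rightarrow> real^3 \<Rightarrow> real^3^3" where
  "col_mat a b c = transpose (vector [a, b, c])"

lemma col_mat_nth: "col_mat a b c $ i $ 1 = a $ i" "col_mat a b c $ i $ 2 = b $ i" "col_mat a b c $ i $ 3 = c $ i"
  by (simp_all add: col_mat_def transpose_def)

lemma det_col_mat: "det (col_mat a b c) = a \<bullet> (b \<times> c)"
  unfolding col_mat_def det_transpose dot_cross_det ..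

lemma mult_col_mat: "B ** col_mat a b c = col_mat (B *v a) (B *v b) (B *v c)"
  by (simp add: vec_eq_iff forall_3 matrix_matrix_mult_def matrix_vector_mult_def col_mat_nth)

lemma triple_matrix_mult:
  fixes B :: "real^3^3"
  shows "(B *v a) \<bullet> ((B *v b) \<times> (B *v c)) = det B * (a \<bullet> (b \<times> c))"
  unfolding det_col_mat[symmetric] mult_col_mat[symmetric] det_mul ..

lemma SL3Z_iff: "\<gamma> \<in> SL3Z \<longleftrightarrow> det \<gamma> = 1 \<and> (\<forall>i j. \<gamma> $ i $ j \<in> \<int>)"
  by (simp add: SL3Z_def SL3R_def)

text \<open>Changing one vector of a basis changes one summand of \<open>f\<close>, so near
  minimality of the sum gives near minimality of each vector. Working within
  \<open>\<epsilon>\<^sup>2 / 8\<close> of the infimum makes it immaterial whether a minimum is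
  attained.\<close>

lemma mahler_reduction:
  fixes B :: "real^3^3"
  assumes "det B = 1" "0 < \<epsilon>" and short: "\<And>v. int_vec v \<Longrightarrow> v \<noteq> 0 \<Longrightarrow> \<epsilon> \<le> norm (B *v v)"
  shows "\<exists>\<gamma>\<in>SL3Z. \<forall>i j. \<bar>(B ** \<gamma>) $ i $ j\<bar> \<le> 5 / \<epsilon>\<^sup>2"
proof -
  \<comment> \<open>Bases of the integer lattice of either orientation, so that vectors may be
    swapped to sort them; the sign \<open>s\<close> repairs the orientation at the end.\<close>
  define T where "T = {(u1, u2, u3). int_vec u1 \<and> int_vec u2 \<and> int_vec u3 \<and> \<bar>u1 \<bullet> (u2 \<times> u3)\<bar> = 1}"
  define f where "f = (\<lambda>(u1, u2, u3). (norm (B *v u1))\<^sup>2 + (norm (B *v u2))\<^sup>2 + (norm (B *v u3))\<^sup>2)"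
  have iax: "int_vec (axis i 1)" for i by (auto simp: int_vec_def axis_def)
  have T0: "(axis 1 1, axis 2 1, axis 3 1) \<in> T"
    by (auto simp: T_def iax cross_basis inner_axis)
  have f0: "0 \<le> f u" for u by (cases u) (auto simp: f_def)
  have bdd: "bdd_below (f ` T)" using f0 by (intro bdd_belowI2)
  have "Inf (f ` T) < Inf (f ` T) + \<epsilon>\<^sup>2 / 8" using assms(2) by simp
  then obtain u where u: "u \<in> T" "f u < Inf (f ` T) + \<epsilon>\<^sup>2 / 8"
    using cInf_lessD[of "f ` T" "Inf (f ` T) + \<epsilon>\<^sup>2 / 8"] T0 by blast
  define near where "near t \<longleftrightarrow> t \<in> T \<and> (\<forall>t'\<in>T. f t \<le> f t' + \<epsilon>\<^sup>2 / 8)" for t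
  have nu: "near u" unfolding near_def
    using u cInf_lower[OF _ bdd] by (fastforce intro: less_imp_le order_trans)
  have swap12: "near (b, a, c)" and swap23: "near (a, c, b)" if "near (a, b, c)" for a b c
  proof -
    have "b \<bullet> (a \<times> c) = - (a \<bullet> (b \<times> c))" "a \<bullet> (c \<times> b) = - (a \<bullet> (b \<times> c))"
      by (simp_all add: cross3_simps)
    then have 1: "(b, a, c) \<in> T" "(a, c, b) \<in> T" using that by (auto simp: near_def T_def)
    have "f (b, a, c) = f (a, b, c)" "f (a, c, b) = f (a, b, c)" by (auto simp: f_def)
    then show "near (b, a, c)" "near (a, c, b)" using that 1 by (auto simp: near_def)
  qed
  have "\<exists>u1 u2 u3. near (u1, u2, u3) \<and> norm (B *v u1) \<le> norm (B *v u2) \<and> norm (B *v u2) \<le> norm (B *v u3)"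
  proof -
    obtain a b c where abc: "near (a, b, c)" using nu by (cases u) auto
    have all: "near (a, b, c)" "near (b, a, c)" "near (a, c, b)" "near (c, a, b)" "near (b, c, a)" "near (c, b, a)"
      using abc swap12[OF abc] swap23[OF abc] swap12[OF swap23[OF abc]] swap23[OF swap12[OF abc]]
        swap23[OF swap12[OF swap23[OF abc]]] by auto
    consider "norm (B *v a) \<le> norm (B *v b)" "norm (B *v b) \<le> norm (B *v c)"
      | "norm (B *v b) \<le> norm (B *v a)" "norm (B *v a) \<le> norm (B *v c)"
      | "norm (B *v a) \<le> norm (B *v c)" "norm (B *v c) \<le> norm (B *v b)"
      | "norm (B *v c) \<le> norm (B *v a)" "norm (B *v a) \<le> norm (B *v b)"
      | "norm (B *v b) \<le> norm (B *v c)" "norm (B *v c) \<le> norm (B *v a)"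
      | "norm (B *v c) \<le> norm (B *v b)" "norm (B *v b) \<le> norm (B *v a)"
      by linarith
    then show ?thesis using all by cases blast+
  qed
  then obtain u1 u2 u3 where n: "near (u1, u2, u3)"
    and ord: "norm (B *v u1) \<le> norm (B *v u2)" "norm (B *v u2) \<le> norm (B *v u3)" by blast
  have ui: "int_vec u1" "int_vec u2" "int_vec u3" and vol: "\<bar>u1 \<bullet> (u2 \<times> u3)\<bar> = 1"
    using n by (auto simp: near_def T_def)
  have nmin: "f (u1, u2, u3) \<le> f t' + \<epsilon>\<^sup>2 / 8" if "t' \<in> T" for t' using n that by (auto simp: near_def)
  have u10: "u1 \<noteq> 0" using vol by auto
  have iv: "int_vec (v + of_int m *\<^sub>R w)" if "int_vec v" "int_vec w" for v w m
    using that by (auto simp: int_vec_def)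
  have b3: "norm (B *v u3) \<le> 5 / \<epsilon>\<^sup>2"
  proof (rule near_minimal_basis_bound[OF ord assms(2) short[OF ui(1) u10]])
    show "\<bar>(B *v u1) \<bullet> ((B *v u2) \<times> (B *v u3))\<bar> = 1" using vol assms(1) by (simp add: triple_matrix_mult)
    fix m n :: int
    have "u1 \<bullet> ((u2 + of_int m *\<^sub>R u1) \<times> u3) = u1 \<bullet> (u2 \<times> u3)"
      by (simp add: cross_add_left inner_add_right cross_mult_left dot_cross_self)
    then have "(u1, u2 + of_int m *\<^sub>R u1, u3) \<in> T" using ui vol iv by (auto simp: T_def)
    from nmin[OF this] show "(norm (B *v u2))\<^sup>2 - \<epsilon>\<^sup>2 / 8 \<le> (norm (B *v u2 + of_int m *\<^sub>R (B *v u1)))\<^sup>2"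
      by (simp add: f_def matrix_vector_right_distrib matrix_vector_mult_scaleR)
    have "u1 \<bullet> (u2 \<times> (u3 + of_int m *\<^sub>R u1 + of_int n *\<^sub>R u2)) = u1 \<bullet> (u2 \<times> u3)"
      by (simp add: cross_add_right inner_add_right cross_mult_right dot_cross_self)
    then have "(u1, u2, u3 + of_int m *\<^sub>R u1 + of_int n *\<^sub>R u2) \<in> T" using ui vol iv by (auto simp: T_def)
    from nmin[OF this] show "(norm (B *v u3))\<^sup>2 - \<epsilon>\<^sup>2 / 8 \<le>
        (norm (B *v u3 + of_int m *\<^sub>R (B *v u1) + of_int n *\<^sub>R (B *v u2)))\<^sup>2"
      by (simp add: f_def matrix_vector_right_distrib matrix_vector_mult_scaleR)
  qed
  define s where "s = u1 \<bullet> (u2 \<times> u3)"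
  have s: "s = 1 \<or> s = -1" using vol by (auto simp: s_def)
  define \<gamma> where "\<gamma> = col_mat (s *\<^sub>R u1) (s *\<^sub>R u2) (s *\<^sub>R u3)"
  have "det \<gamma> = s * s * s * s"
    by (simp add: \<gamma>_def det_col_mat cross_mult_left cross_mult_right s_def)
  then have "det \<gamma> = 1" using s by auto
  moreover have "\<gamma> $ i $ j \<in> \<int>" for i j
  proof -
    have "s \<in> \<int>" using s by auto
    then have "\<forall>j. \<gamma> $ i $ j \<in> \<int>" using ui unfolding forall_3 by (auto simp: \<gamma>_def col_mat_nth int_vec_def)
    then show ?thesis ..
  qed
  ultimately have "\<gamma> \<in> SL3Z" by (simp add: SL3Z_iff)
  moreover have "\<bar>(B ** \<gamma>) $ i $ j\<bar> \<le> 5 / \<epsilon>\<^sup>2" for i j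
  proof -
    have "\<bar>(s *\<^sub>R (B *v w)) $ i\<bar> \<le> 5 / \<epsilon>\<^sup>2" if "norm (B *v w) \<le> 5 / \<epsilon>\<^sup>2" for w
      using component_le_norm_cart[of "B *v w" i] that s by auto
    then have "\<forall>j. \<bar>(B ** \<gamma>) $ i $ j\<bar> \<le> 5 / \<epsilon>\<^sup>2"
      unfolding forall_3 \<gamma>_def mult_col_mat matrix_vector_mult_scaleR col_mat_nth using b3 ord by (meson order_trans)
    then show ?thesis ..
  qed
  ultimately show ?thesis by blast
qed

section \<open>The contragredient matrix\<close>

text \<open>The cofactor matrix, for determinant 1 the inverse transpose. Being polynomial in the
  entries, it visibly preserves integrality, bounds on entries and strict differentiability.\<close>

definition cofm :: "real^3^3 \<Rightarrow> real^3^3" where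
  "cofm B = vector [(B $ 2) \<times> (B $ 3), (B $ 3) \<times> (B $ 1), (B $ 1) \<times> (B $ 2)]"

lemma cofm_nth: "cofm B $ 1 = (B $ 2) \<times> (B $ 3)" "cofm B $ 2 = (B $ 3) \<times> (B $ 1)" "cofm B $ 3 = (B $ 1) \<times> (B $ 2)"
  by (simp_all add: cofm_def)

lemma mult_transpose_cofm: "B ** transpose (cofm B) = mat (det B)"
  by (simp add: vec_eq_iff forall_3 matrix_matrix_mult_def transpose_def cofm_nth cross_components mat_def
      sum_3 det_3 algebra_simps)

lemma cofm_eq:
  assumes "det B = 1" "B ** transpose C = mat 1"
  shows "cofm B = C"
proof -
  have 1: "B ** transpose (cofm B) = mat 1" using mult_transpose_cofm[of B] assms(1) by simp
  then have 2: "transpose (cofm B) ** B = mat 1" by (simp add: matrix_left_right_inverse)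
  have "transpose (cofm B) = transpose (cofm B) ** (B ** transpose C)" using assms(2) by simp
  also have "\<dots> = transpose C" using 2 by (simp add: matrix_mul_assoc)
  finally show ?thesis by (metis transpose_transpose)
qed

lemma det_cofm: "det B = 1 \<Longrightarrow> det (cofm B) = 1"
  using arg_cong[OF mult_transpose_cofm, of det B] by (simp add: det_mul det_transpose)

lemma cofm_mult:
  assumes "det A = 1" "det B = 1"
  shows "cofm (A ** B) = cofm A ** cofm B"
proof (rule cofm_eq)
  show "det (A ** B) = 1" using assms by (simp add: det_mul)
  have "A ** B ** transpose (cofm A ** cofm B) = A ** (B ** transpose (cofm B)) ** transpose (cofm A)"
    by (simp add: matrix_transpose_mul matrix_mul_assoc)
  then show "A ** B ** transpose (cofm A ** cofm B) = mat 1"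
    using assms by (simp add: mult_transpose_cofm)
qed

lemma cofm_cofm:
  assumes "det B = 1"
  shows "cofm (cofm B) = B"
proof (rule cofm_eq)
  have "transpose (B ** transpose (cofm B)) = transpose (mat 1)" using assms by (simp add: mult_transpose_cofm)
  then show "cofm B ** transpose B = mat 1" by (simp add: matrix_transpose_mul)
qed (rule det_cofm[OF assms])

lemma cofm_mat_1 [simp]: "cofm (mat 1) = mat 1"
  by (rule cofm_eq) auto

lemma cofm_SL3Z: "\<gamma> \<in> SL3Z \<Longrightarrow> cofm \<gamma> \<in> SL3Z"
  unfolding SL3Z_iff
  by (auto simp: det_cofm forall_3 cofm_nth cross_components intro!: Ints_diff Ints_mult)

lemma cofm_bound:
  assumes "\<And>i j. \<bar>B $ i $ j\<bar> \<le> C"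
  shows "\<bar>cofm B $ i $ j\<bar> \<le> 2 * C\<^sup>2"
proof -
  have "\<bar>B $ a $ b * B $ c $ d - B $ a' $ b' * B $ c' $ d'\<bar> \<le> 2 * C\<^sup>2" for a b c d a' b' c' d'
  proof -
    have m: "\<bar>B $ a $ b\<bar> * \<bar>B $ c $ d\<bar> \<le> C * C" for a b c d
      using assms[of a b] assms[of c d] abs_ge_zero[of "B $ a $ b"] by (intro mult_mono) linarith+
    have "\<bar>B $ a $ b * B $ c $ d - B $ a' $ b' * B $ c' $ d'\<bar> \<le>
        \<bar>B $ a $ b\<bar> * \<bar>B $ c $ d\<bar> + \<bar>B $ a' $ b'\<bar> * \<bar>B $ c' $ d'\<bar>"
      unfolding abs_mult[symmetric] by linarith
    then show ?thesis using m[of a b c d] m[of a' b' c' d'] by (simp add: power2_eq_square)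
  qed
  then have "\<forall>i j. \<bar>cofm B $ i $ j\<bar> \<le> 2 * C\<^sup>2"
    by (simp add: forall_3 cofm_nth cross_components)
  then show ?thesis by blast
qed

section \<open>Growth of linear forms under a diagonalizable matrix\<close>

text \<open>
  The determinant of the complex matrix expands, row by row, into those of the real matrices built from
  real and imaginary parts, so one of these does not vanish.
\<close>

lemma det3_real_part_choice:
  fixes a b c :: "complex^3"
  assumes "a$1 * b$2 * c$3 + a$2 * b$3 * c$1 + a$3 * b$1 * c$2 - a$1 * b$3 * c$2 - a$2 * b$1 * c$3 - a$3 * b$2 * c$1 \<noteq> 0"
  defines "re \<equiv> \<lambda>v::complex^3. (\<chi> i. Re (v $ i)) :: real^3" and "im \<equiv> \<lambda>v::complex^3. (\<chi> i. Im (v $ i)) :: real^3"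
  shows "\<exists>p\<in>{re a, im a}. \<exists>q\<in>{re b, im b}. \<exists>r\<in>{re c, im c}. p \<bullet> (q \<times> r) \<noteq> 0"
proof (rule ccontr)
  assume "\<not> ?thesis"
  then have z: "p \<bullet> (q \<times> r) = 0" if "p \<in> {re a, im a}" "q \<in> {re b, im b}" "r \<in> {re c, im c}" for p q r
    using that by blast
  have exp: "p \<bullet> (q \<times> r) = p$1*q$2*r$3 + p$2*q$3*r$1 + p$3*q$1*r$2 - p$1*q$3*r$2 - p$2*q$1*r$3 - p$3*q$2*r$1"
    for p q r :: "real^3"
    by (simp add: cross3_simps)
  let ?d = "a$1 * b$2 * c$3 + a$2 * b$3 * c$1 + a$3 * b$1 * c$2 - a$1 * b$3 * c$2 - a$2 * b$1 * c$3 - a$3 * b$2 * c$1"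
  have "Re ?d = re a \<bullet> (re b \<times> re c) - re a \<bullet> (im b \<times> im c) - im a \<bullet> (re b \<times> im c) - im a \<bullet> (im b \<times> re c)"
    unfolding exp by (simp add: re_def im_def algebra_simps)
  moreover have "Im ?d = im a \<bullet> (re b \<times> re c) + re a \<bullet> (im b \<times> re c) + re a \<bullet> (re b \<times> im c) - im a \<bullet> (im b \<times> im c)"
    unfolding exp by (simp add: re_def im_def algebra_simps)
  ultimately have "Re ?d = 0" "Im ?d = 0" using z by auto
  then have "?d = 0" by (rule complex_eqI[of _ 0, simplified])
  then show False using assms(1) by simp
qed

text \<open>A lower bound on lengths is all that Mahler's criterion asks for. It refers to the value
  of \<open>m\<close> at time 0, so it is insensitive to the rotation that a complex eigenvalue adds
  to the growth.\<close>

definition grows :: "(nat \<Rightarrow> real^3^3) \<Rightarrow> real^3 \<Rightarrow> real \<Rightarrow> bool" where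
  "grows H m \<mu> \<longleftrightarrow> (\<exists>c>0. \<forall>n u. c * exp (\<mu> * real n) * \<bar>m \<bullet> u\<bar> \<le> norm (H n *v u))"

text \<open>The modulus of the eigenform \<open>l\<close> is multiplied by exactly
  \<open>cmod d\<close> in each step; it dominates \<open>m\<close> at the start and is dominated by
  the norm at time \<open>n\<close>.\<close>

lemma grows_of_eigenform:
  fixes q :: "complex^3" and d :: complex
  assumes H: "H 0 = mat 1" "\<And>n. H (Suc n) = h ** H n" and d: "d \<noteq> 0"
    and eig: "\<And>u. (\<Sum>j\<in>UNIV. q $ j * complex_of_real ((h *v u) $ j)) = d * (\<Sum>j\<in>UNIV. q $ j * complex_of_real (u $ j))"
    and m: "m = (\<chi> i. Re (q $ i)) \<or> m = (\<chi> i. Im (q $ i))"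
  shows "grows H m (ln (cmod d))"
proof -
  define l where "l u = (\<Sum>j\<in>UNIV. q $ j * complex_of_real (u $ j))" for u :: "real^3"
  define C where "C = 1 + (\<Sum>j\<in>UNIV. cmod (q $ j))"
  have C0: "0 < C" by (simp add: C_def add_pos_nonneg sum_nonneg)
  have lH: "l (H n *v u) = d ^ n * l u" for n u
  proof (induction n)
    case (Suc n)
    have "l (H (Suc n) *v u) = l (h *v (H n *v u))" by (simp add: H matrix_vector_mul_assoc)
    also have "\<dots> = d * l (H n *v u)" using eig by (simp add: l_def)
    finally show ?case using Suc by simp
  qed (simp add: H)
  have lC: "cmod (l y) \<le> C * norm y" for y
  proof -
    have "cmod (l y) \<le> (\<Sum>j\<in>UNIV. cmod (q $ j * complex_of_real (y $ j)))" unfolding l_def by (rule norm_sum)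
    also have "\<dots> \<le> (\<Sum>j\<in>UNIV. cmod (q $ j) * norm y)"
      by (intro sum_mono) (auto simp: norm_mult component_le_norm_cart intro!: mult_left_mono)
    also have "\<dots> \<le> C * norm y" by (simp add: C_def sum_distrib_right[symmetric] distrib_right)
    finally show ?thesis .
  qed
  have ml: "\<bar>m \<bullet> u\<bar> \<le> cmod (l u)" for u
  proof -
    have "m \<bullet> u = Re (l u) \<or> m \<bullet> u = Im (l u)"
      using m by (auto simp: l_def inner_vec_def)
    then show ?thesis using abs_Re_le_cmod[of "l u"] abs_Im_le_cmod[of "l u"] by auto
  qed
  have "1 / C * exp (ln (cmod d) * real n) * \<bar>m \<bullet> u\<bar> \<le> norm (H n *v u)" for n u
  proof -
    have "exp (ln (cmod d) * real n) = cmod d ^ n"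
      using d by (simp add: mult.commute exp_of_nat_mult)
    then have "exp (ln (cmod d) * real n) * \<bar>m \<bullet> u\<bar> \<le> cmod d ^ n * cmod (l u)"
      using ml by (simp add: mult_left_mono)
    also have "\<dots> = cmod (l (H n *v u))" by (simp add: lH norm_mult norm_power)
    also have "\<dots> \<le> C * norm (H n *v u)" by (rule lC)
    finally show ?thesis using C0 by (simp add: divide_le_eq mult.commute)
  qed
  then show ?thesis unfolding grows_def using C0 by (intro exI[of _ "1 / C"]) auto
qed

text \<open>By \<open>conj\<close> the rows of \<open>Q\<close> are left eigenvectors of
  \<open>h\<close>, that is, complex eigenforms.\<close>

lemma growing_forms:
  fixes h :: "real^3^3" and Q D :: "complex^3^3"
  assumes H: "H 0 = mat 1" "\<And>n. H (Suc n) = h ** H n"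
    and conj: "Q ** map_matrix complex_of_real h = D ** Q" and diag: "\<And>i j. i \<noteq> j \<Longrightarrow> D $ i $ j = 0"
    and "det Q \<noteq> 0" and D0: "\<And>i. D $ i $ i \<noteq> 0"
  shows "\<exists>m. m 1 \<bullet> (m 2 \<times> m 3) \<noteq> 0 \<and> (\<forall>i::3. grows H (m i) (ln (cmod (D $ i $ i))))"
proof -
  have eig: "(\<Sum>j\<in>UNIV. Q $ i $ j * complex_of_real ((h *v u) $ j)) = D $ i $ i * (\<Sum>j\<in>UNIV. Q $ i $ j * complex_of_real (u $ j))"
    for i u
  proof -
    define uc where "uc = (\<chi> j. complex_of_real (u $ j))"
    have 1: "(map_matrix complex_of_real h *v uc) $ j = complex_of_real ((h *v u) $ j)" for j
      by (simp add: matrix_vector_mult_def uc_def map_matrix_def)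
    have "(\<Sum>j\<in>UNIV. Q $ i $ j * complex_of_real ((h *v u) $ j)) = (Q *v (map_matrix complex_of_real h *v uc)) $ i"
      unfolding matrix_vector_mult_def[of Q] by (simp add: 1)
    also have "\<dots> = (D *v (Q *v uc)) $ i" by (simp add: matrix_vector_mul_assoc conj)
    also have "\<dots> = (\<Sum>j\<in>UNIV. D $ i $ j * (Q *v uc) $ j)" by (simp add: matrix_vector_mult_def)
    also have "\<dots> = D $ i $ i * (Q *v uc) $ i"
      by (subst sum.remove[of _ i]) (auto simp: diag intro!: sum.neutral)
    finally show ?thesis by (simp add: matrix_vector_mult_def uc_def)
  qed
  define re im where "re = (\<lambda>v::complex^3. (\<chi> i. Re (v $ i)) :: real^3)" and "im = (\<lambda>v::complex^3. (\<chi> i. Im (v $ i)) :: real^3)"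
  have "\<exists>p\<in>{re (Q$1), im (Q$1)}. \<exists>q\<in>{re (Q$2), im (Q$2)}. \<exists>r\<in>{re (Q$3), im (Q$3)}. p \<bullet> (q \<times> r) \<noteq> 0"
    unfolding re_def im_def by (rule det3_real_part_choice) (use \<open>det Q \<noteq> 0\<close> in \<open>simp add: det_3\<close>)
  then obtain p q r where pqr: "p \<in> {re (Q$1), im (Q$1)}" "q \<in> {re (Q$2), im (Q$2)}" "r \<in> {re (Q$3), im (Q$3)}"
    "p \<bullet> (q \<times> r) \<noteq> 0" by blast
  define m :: "3 \<Rightarrow> real^3" where "m i = (if i = 1 then p else if i = 2 then q else r)" for i
  have m: "m 1 = p" "m 2 = q" "m 3 = r" by (simp_all add: m_def)
  have "grows H (m i) (ln (cmod (D $ i $ i)))" if "m i \<in> {re (Q $ i), im (Q $ i)}" for i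
    by (rule grows_of_eigenform[OF H D0 eig]) (use that in \<open>auto simp: re_def im_def\<close>)
  then have "\<forall>i::3. grows H (m i) (ln (cmod (D $ i $ i)))"
    unfolding forall_3 using pqr m by auto
  then show ?thesis using pqr(4) m by (intro exI[of _ m]) auto
qed

lemma sorted_growing_forms:
  fixes m :: "3 \<Rightarrow> real^3" and \<mu> :: "3 \<Rightarrow> real"
  assumes vol: "m 1 \<bullet> (m 2 \<times> m 3) \<noteq> 0" and g: "\<And>i. grows H (m i) (\<mu> i)" and sum: "\<mu> 1 + \<mu> 2 + \<mu> 3 = 0"
    and two: "i \<noteq> j" "0 \<le> \<mu> i" "0 \<le> \<mu> j"
  obtains m1 m2 m3 l1 l2 where "m1 \<bullet> (m2 \<times> m3) \<noteq> 0" "0 \<le> l2" "l2 \<le> l1"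
    "grows H m1 l1" "grows H m2 l2" "grows H m3 (- (l1 + l2))"
proof -
  \<comment> \<open>Swaps and cyclic shifts preserve this relation, so any two indices can be put in
    front.\<close>
  define P where "P a b c \<longleftrightarrow> m a \<bullet> (m b \<times> m c) \<noteq> 0 \<and> \<mu> c = - (\<mu> a + \<mu> b)" for a b c
  have sw: "P b a c \<longleftrightarrow> P a b c" for a b c
    by (simp add: P_def add.commute) (metis (no_types, lifting) cross_skew cross_triple inner_commute inner_minus_right neg_equal_0_iff_equal)
  have "m 2 \<bullet> (m 3 \<times> m 1) = m 1 \<bullet> (m 2 \<times> m 3)" "m 3 \<bullet> (m 1 \<times> m 2) = m 1 \<bullet> (m 2 \<times> m 3)"
    by (rule triple_rotate, metis triple_rotate)
  then have P: "P 1 2 3" "P 2 3 1" "P 3 1 2" using vol sum unfolding P_def by auto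
  have "\<exists>k. P i j k"
    using exhaust_3[of i] exhaust_3[of j] two(1) P sw by metis
  then obtain k where k: "P i j k" by blast
  show ?thesis
  proof (cases "\<mu> j \<le> \<mu> i")
    case True
    then show ?thesis using that[of "m i" "m j" "m k" "\<mu> j" "\<mu> i"] k two g[of i] g[of j] g[of k] by (simp add: P_def)
  next
    case False
    have k': "P j i k" using k sw by blast
    then show ?thesis using that[of "m j" "m i" "m k" "\<mu> i" "\<mu> j"] False two g[of i] g[of j] g[of k] by (simp add: P_def)
  qed
qed

lemma two_nonneg_or_two_nonpos:
  fixes \<mu> :: "3 \<Rightarrow> real"
  shows "\<exists>i j. i \<noteq> j \<and> (0 \<le> \<mu> i \<and> 0 \<le> \<mu> j \<or> \<mu> i \<le> 0 \<and> \<mu> j \<le> 0)"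
proof -
  have d: "(1::3) \<noteq> 2" "(1::3) \<noteq> 3" "(2::3) \<noteq> 3" by auto
  consider "0 \<le> \<mu> 1 \<and> 0 \<le> \<mu> 2 \<or> \<mu> 1 \<le> 0 \<and> \<mu> 2 \<le> 0" | "0 \<le> \<mu> 1 \<and> 0 \<le> \<mu> 3 \<or> \<mu> 1 \<le> 0 \<and> \<mu> 3 \<le> 0"
    | "0 \<le> \<mu> 2 \<and> 0 \<le> \<mu> 3 \<or> \<mu> 2 \<le> 0 \<and> \<mu> 3 \<le> 0"
    by linarith
  then show ?thesis using d by cases blast+
qed

section \<open>Strict differentiability\<close>

lemma finite_pos_lower_bound:
  fixes A :: "real set"
  assumes "finite A" "\<And>a. a \<in> A \<Longrightarrow> 0 < a"
  obtains \<delta> where "0 < \<delta>" "\<And>a. a \<in> A \<Longrightarrow> \<delta> \<le> a"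
proof
  show "0 < Min (insert 1 A)" using assms by (subst Min_gr_iff) auto
  show "Min (insert 1 A) \<le> a" if "a \<in> A" for a using assms(1) that by (intro Min_le) auto
qed

lemma strict_derivD:
  assumes "strict_deriv f T x0" "0 < \<eta>"
  obtains \<delta> where "0 < \<delta>" "\<And>x y. x \<in> ball x0 \<delta> \<Longrightarrow> y \<in> ball x0 \<delta> \<Longrightarrow> norm (f y - f x - T (y - x)) \<le> \<eta> * norm (y - x)"
  using assms unfolding strict_deriv_def by meson

lemma strict_deriv_lipschitz:
  assumes "strict_deriv f T x0"
  obtains L \<delta> where "0 < L" "0 < \<delta>"
    "\<And>x y. x \<in> ball x0 \<delta> \<Longrightarrow> y \<in> ball x0 \<delta> \<Longrightarrow> norm (f y - f x) \<le> L * norm (y - x)"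
proof -
  have bl: "bounded_linear T" using assms by (simp add: strict_deriv_def)
  obtain K where K: "0 < K" "\<And>v. norm (T v) \<le> norm v * K" using bounded_linear.pos_bounded[OF bl] by blast
  obtain \<delta> where \<delta>: "0 < \<delta>"
    "\<And>x y. x \<in> ball x0 \<delta> \<Longrightarrow> y \<in> ball x0 \<delta> \<Longrightarrow> norm (f y - f x - T (y - x)) \<le> 1 * norm (y - x)"
    by (rule strict_derivD[OF assms, of 1]) auto
  have "norm (f y - f x) \<le> (1 + K) * norm (y - x)" if "x \<in> ball x0 \<delta>" "y \<in> ball x0 \<delta>" for x y
  proof -
    have "norm (f y - f x) \<le> norm (f y - f x - T (y - x)) + norm (T (y - x))"
      by (metis add.commute diff_add_cancel norm_triangle_ineq)
    then show ?thesis using \<delta>(2)[OF that] K(2)[of "y - x"] by (simp add: algebra_simps)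
  qed
  then show ?thesis using that[of "1 + K" \<delta>] K(1) \<delta>(1) by auto
qed

lemma strict_deriv_bounded:
  assumes "strict_deriv f T x0"
  obtains M \<delta> where "0 < M" "0 < \<delta>" "\<And>x. x \<in> ball x0 \<delta> \<Longrightarrow> norm (f x) \<le> M"
proof -
  obtain L \<delta> where L: "0 < L" "0 < \<delta>"
    "\<And>x y. x \<in> ball x0 \<delta> \<Longrightarrow> y \<in> ball x0 \<delta> \<Longrightarrow> norm (f y - f x) \<le> L * norm (y - x)"
    using strict_deriv_lipschitz[OF assms] by metis
  have "norm (f x) \<le> 1 + norm (f x0) + L * \<delta>" if "x \<in> ball x0 \<delta>" for x
  proof -
    have "norm (x - x0) \<le> \<delta>" using that by (simp add: dist_norm norm_minus_commute)
    then have "L * norm (x - x0) \<le> L * \<delta>" using L by simp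
    moreover have "norm (f x - f x0) \<le> L * norm (x - x0)" using L(3)[of x0 x] that L(2) by simp
    moreover have "norm (f x) \<le> norm (f x0) + norm (f x - f x0)" by (metis add.commute diff_add_cancel norm_triangle_ineq)
    ultimately show ?thesis by linarith
  qed
  then show ?thesis using that[of "1 + norm (f x0) + L * \<delta>" \<delta>] L by (simp add: add_pos_nonneg)
qed

lemma strict_deriv_linear_comp:
  assumes f: "strict_deriv f T x0" and A: "bounded_linear A"
  shows "strict_deriv (\<lambda>x. A (f x)) (\<lambda>\<xi>. A (T \<xi>)) x0"
  unfolding strict_deriv_def
proof (intro conjI allI impI)
  show "bounded_linear (\<lambda>\<xi>. A (T \<xi>))"
    using f A by (simp add: strict_deriv_def bounded_linear_compose)
  fix \<eta> :: real assume \<eta>: "0 < \<eta>"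
  obtain K where K: "0 < K" "\<And>v. norm (A v) \<le> norm v * K" using bounded_linear.pos_bounded[OF A] by blast
  obtain \<delta> where \<delta>: "0 < \<delta>"
    "\<And>x y. x \<in> ball x0 \<delta> \<Longrightarrow> y \<in> ball x0 \<delta> \<Longrightarrow> norm (f y - f x - T (y - x)) \<le> (\<eta> / K) * norm (y - x)"
    using strict_derivD[OF f, of "\<eta> / K"] \<eta> K by auto
  have "norm (A (f y) - A (f x) - A (T (y - x))) \<le> \<eta> * norm (y - x)" if "x \<in> ball x0 \<delta>" "y \<in> ball x0 \<delta>" for x y
  proof -
    have "A (f y) - A (f x) - A (T (y - x)) = A (f y - f x - T (y - x))"
      using A by (simp add: bounded_linear.linear linear_diff)
    also have "norm \<dots> \<le> norm (f y - f x - T (y - x)) * K" by (rule K(2))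
    also have "\<dots> \<le> (\<eta> / K) * norm (y - x) * K" using \<delta>(2)[OF that] K(1) by (intro mult_right_mono) auto
    also have "\<dots> = \<eta> * norm (y - x)" using K(1) by simp
    finally show ?thesis .
  qed
  then show "\<exists>\<delta>>0. \<forall>x\<in>ball x0 \<delta>. \<forall>y\<in>ball x0 \<delta>. norm (A (f y) - A (f x) - A (T (y - x))) \<le> \<eta> * norm (y - x)"
    using \<delta>(1) by blast
qed

lemma strict_deriv_add:
  assumes f: "strict_deriv f T x0" and g: "strict_deriv g U x0"
  shows "strict_deriv (\<lambda>x. f x + g x) (\<lambda>\<xi>. T \<xi> + U \<xi>) x0"
  unfolding strict_deriv_def
proof (intro conjI allI impI)
  show "bounded_linear (\<lambda>\<xi>. T \<xi> + U \<xi>)"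
    using f g by (simp add: strict_deriv_def bounded_linear_add)
  fix \<eta> :: real assume \<eta>: "0 < \<eta>"
  then have \<eta>2: "0 < \<eta> / 2" by simp
  obtain d where d: "0 < d" "\<And>x y. x \<in> ball x0 d \<Longrightarrow> y \<in> ball x0 d \<Longrightarrow> norm (f y - f x - T (y - x)) \<le> \<eta> / 2 * norm (y - x)"
    using strict_derivD[OF f \<eta>2] by metis
  obtain e where e: "0 < e" "\<And>x y. x \<in> ball x0 e \<Longrightarrow> y \<in> ball x0 e \<Longrightarrow> norm (g y - g x - U (y - x)) \<le> \<eta> / 2 * norm (y - x)"
    using strict_derivD[OF g \<eta>2] by metis
  have "norm (f y + g y - (f x + g x) - (T (y - x) + U (y - x))) \<le> \<eta> * norm (y - x)"
    if "x \<in> ball x0 (min d e)" "y \<in> ball x0 (min d e)" for x y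
  proof -
    have "f y + g y - (f x + g x) - (T (y - x) + U (y - x)) = (f y - f x - T (y - x)) + (g y - g x - U (y - x))" by simp
    also have "norm \<dots> \<le> norm (f y - f x - T (y - x)) + norm (g y - g x - U (y - x))" by (rule norm_triangle_ineq)
    also have "\<dots> \<le> \<eta> / 2 * norm (y - x) + \<eta> / 2 * norm (y - x)"
      using that by (intro add_mono d(2) e(2)) auto
    finally show ?thesis by simp
  qed
  then show "\<exists>\<delta>>0. \<forall>x\<in>ball x0 \<delta>. \<forall>y\<in>ball x0 \<delta>.
      norm (f y + g y - (f x + g x) - (T (y - x) + U (y - x))) \<le> \<eta> * norm (y - x)"
    using d(1) e(1) by (intro exI[of _ "min d e"]) auto
qed

lemma strict_deriv_comp:
  assumes g: "strict_deriv g T x0" and f: "strict_deriv f U (g x0)"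
  shows "strict_deriv (\<lambda>x. f (g x)) (\<lambda>\<xi>. U (T \<xi>)) x0"
  unfolding strict_deriv_def
proof (intro conjI allI impI)
  have bl: "bounded_linear T" "bounded_linear U" using f g by (auto simp: strict_deriv_def)
  show "bounded_linear (\<lambda>\<xi>. U (T \<xi>))" by (rule bounded_linear_compose[OF bl(2,1)])
  fix \<eta> :: real assume \<eta>: "0 < \<eta>"
  obtain KU where KU: "0 < KU" "\<And>v. norm (U v) \<le> norm v * KU" using bounded_linear.pos_bounded[OF bl(2)] by blast
  obtain L e where L: "0 < L" "0 < e" "\<And>x y. x \<in> ball x0 e \<Longrightarrow> y \<in> ball x0 e \<Longrightarrow> norm (g y - g x) \<le> L * norm (y - x)"
    using strict_deriv_lipschitz[OF g] by metis
  obtain d1 where d1: "0 < d1" "\<And>x y. x \<in> ball x0 d1 \<Longrightarrow> y \<in> ball x0 d1 \<Longrightarrow> norm (g y - g x - T (y - x)) \<le> \<eta> / (2 * KU) * norm (y - x)"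
    using strict_derivD[OF g, of "\<eta> / (2 * KU)"] \<eta> KU by auto
  obtain d2 where d2: "0 < d2" "\<And>x y. x \<in> ball (g x0) d2 \<Longrightarrow> y \<in> ball (g x0) d2 \<Longrightarrow> norm (f y - f x - U (y - x)) \<le> \<eta> / (2 * L) * norm (y - x)"
    using strict_derivD[OF f, of "\<eta> / (2 * L)"] \<eta> L by auto
  obtain \<delta> where \<delta>: "0 < \<delta>" "\<And>a. a \<in> {e, d1, d2 / L} \<Longrightarrow> \<delta> \<le> a"
  proof (rule finite_pos_lower_bound)
    show "0 < a" if "a \<in> {e, d1, d2 / L}" for a using that L(1,2) d1(1) d2(1) by auto
  qed auto
  have sub: "x \<in> ball x0 e" "x \<in> ball x0 d1" "g x \<in> ball (g x0) d2" if "x \<in> ball x0 \<delta>" for x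
  proof -
    have lt: "dist x0 x < a" if "a \<in> {e, d1, d2 / L}" for a
      using \<open>x \<in> ball x0 \<delta>\<close> \<delta>(2)[OF that] by simp
    then show 1: "x \<in> ball x0 e" "x \<in> ball x0 d1" by simp_all
    have "norm (x - x0) < d2 / L" using lt[of "d2 / L"] by (simp add: dist_commute dist_norm[symmetric])
    then have "L * norm (x - x0) < d2" using L by (simp add: less_divide_eq mult.commute)
    moreover have "norm (g x - g x0) \<le> L * norm (x - x0)" using L(2) 1 by (intro L(3)) auto
    ultimately show "g x \<in> ball (g x0) d2" by (simp add: dist_norm norm_minus_commute)
  qed
  have "norm (f (g y) - f (g x) - U (T (y - x))) \<le> \<eta> * norm (y - x)" if x: "x \<in> ball x0 \<delta>" and y: "y \<in> ball x0 \<delta>" for x y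
  proof -
    have "f (g y) - f (g x) - U (T (y - x)) = (f (g y) - f (g x) - U (g y - g x)) + U (g y - g x - T (y - x))"
      using bl(2) by (simp add: bounded_linear.linear linear_diff)
    also have "norm \<dots> \<le> norm (f (g y) - f (g x) - U (g y - g x)) + norm (U (g y - g x - T (y - x)))"
      by (rule norm_triangle_ineq)
    also have "\<dots> \<le> \<eta> / 2 * norm (y - x) + \<eta> / 2 * norm (y - x)"
    proof (rule add_mono)
      have "norm (f (g y) - f (g x) - U (g y - g x)) \<le> \<eta> / (2 * L) * norm (g y - g x)"
        by (rule d2(2)[OF sub(3)[OF x] sub(3)[OF y]])
      also have "\<dots> \<le> \<eta> / (2 * L) * (L * norm (y - x))"
        using L(3)[OF sub(1)[OF x] sub(1)[OF y]] \<eta> L by (intro mult_left_mono) auto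
      finally show "norm (f (g y) - f (g x) - U (g y - g x)) \<le> \<eta> / 2 * norm (y - x)" using L(1) by simp
      have "norm (U (g y - g x - T (y - x))) \<le> norm (g y - g x - T (y - x)) * KU" by (rule KU(2))
      also have "\<dots> \<le> (\<eta> / (2 * KU) * norm (y - x)) * KU"
        using d1(2)[OF sub(2)[OF x] sub(2)[OF y]] KU by (intro mult_right_mono) auto
      finally show "norm (U (g y - g x - T (y - x))) \<le> \<eta> / 2 * norm (y - x)" using KU(1) by simp
    qed
    finally show ?thesis by simp
  qed
  then show "\<exists>\<delta>>0. \<forall>x\<in>ball x0 \<delta>. \<forall>y\<in>ball x0 \<delta>. norm (f (g y) - f (g x) - U (T (y - x))) \<le> \<eta> * norm (y - x)"
    using \<delta>(1) by blast
qed

lemma strict_deriv_bounded_bilinear: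
  assumes h: "bounded_bilinear h"
  shows "strict_deriv (\<lambda>z. h (fst z) (snd z)) (\<lambda>\<xi>. h a (snd \<xi>) + h (fst \<xi>) b) (a, b)"
  unfolding strict_deriv_def
proof (intro conjI allI impI)
  interpret h: bounded_bilinear h by (rule h)
  show "bounded_linear (\<lambda>\<xi>. h a (snd \<xi>) + h (fst \<xi>) b)"
    by (intro bounded_linear_add bounded_linear_compose[OF h.bounded_linear_right bounded_linear_snd]
        bounded_linear_compose[OF h.bounded_linear_left bounded_linear_fst])
  fix \<eta> :: real assume \<eta>: "0 < \<eta>"
  obtain K where K: "0 < K" "\<And>p q. norm (h p q) \<le> norm p * norm q * K" using h.pos_bounded by blast
  define d where "d = \<eta> / (2 * K)"
  have d: "0 < d" "d * K = \<eta> / 2" using \<eta> K(1) by (auto simp: d_def)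
  have "norm (h (fst y) (snd y) - h (fst x) (snd x) - (h a (snd (y - x)) + h (fst (y - x)) b)) \<le> \<eta> * norm (y - x)"
    if x: "x \<in> ball (a, b) d" and y: "y \<in> ball (a, b) d" for x y
  proof -
    have near: "norm (fst y - a) \<le> d" "norm (snd x - b) \<le> d"
      using dist_fst_le[of y "(a, b)"] dist_snd_le[of x "(a, b)"] x y by (auto simp: dist_commute dist_norm[symmetric])
    have le: "norm (fst y - fst x) \<le> norm (y - x)" "norm (snd y - snd x) \<le> norm (y - x)"
      using dist_fst_le[of y x] dist_snd_le[of y x] by (simp_all add: dist_norm)
    \<comment> \<open>An exact identity: the remainder is a sum of two products, each of an
      increment with a distance to the base point.\<close>
    have "h (fst y) (snd y) - h (fst x) (snd x) - (h a (snd (y - x)) + h (fst (y - x)) b) =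
        h (fst y - a) (snd y - snd x) + h (fst y - fst x) (snd x - b)"
      by (simp add: h.diff_left h.diff_right fst_diff snd_diff)
    also have "norm \<dots> \<le> norm (fst y - a) * norm (snd y - snd x) * K + norm (fst y - fst x) * norm (snd x - b) * K"
      by (intro order_trans[OF norm_triangle_ineq] add_mono K(2))
    also have "\<dots> \<le> d * norm (y - x) * K + norm (y - x) * d * K"
      using near le d(1) K(1) by (intro add_mono mult_right_mono mult_mono) auto
    also have "\<dots> = 2 * (d * K) * norm (y - x)" by simp
    finally show ?thesis by (simp add: d(2))
  qed
  then show "\<exists>\<delta>>0. \<forall>x\<in>ball (a, b) \<delta>. \<forall>y\<in>ball (a, b) \<delta>.
      norm (h (fst y) (snd y) - h (fst x) (snd x) - (h a (snd (y - x)) + h (fst (y - x)) b)) \<le> \<eta> * norm (y - x)"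
    using d(1) by blast
qed

lemma strict_deriv_bilinear:
  assumes f: "strict_deriv f T x0" and g: "strict_deriv g U x0" and h: "bounded_bilinear h"
  shows "strict_deriv (\<lambda>x. h (f x) (g x)) (\<lambda>\<xi>. h (f x0) (U \<xi>) + h (T \<xi>) (g x0)) x0"
proof -
  have "strict_deriv (\<lambda>x. (f x, 0) + (0, g x)) (\<lambda>\<xi>. (T \<xi>, 0) + (0, U \<xi>)) x0"
    by (intro strict_deriv_add strict_deriv_linear_comp[OF f] strict_deriv_linear_comp[OF g]
        bounded_linear_Pair bounded_linear_zero bounded_linear_ident)
  then have "strict_deriv (\<lambda>x. (f x, g x)) (\<lambda>\<xi>. (T \<xi>, U \<xi>)) x0" by simp
  from strict_deriv_comp[OF this strict_deriv_bounded_bilinear[OF h]] show ?thesis by simp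
qed

text \<open>Mean value inequality for \<open>f\<close> minus its linear part at \<open>x0\<close>,
  whose derivative is small near \<open>x0\<close> by continuity.\<close>

lemma strict_deriv_C1:
  fixes f :: "'a::real_normed_vector \<Rightarrow> 'b::real_normed_vector"
  assumes "C1_on f S" "open S" "x0 \<in> S"
  shows "strict_deriv f (frechet_derivative f (at x0)) x0"
proof -
  obtain f' :: "'a \<Rightarrow> 'a \<Rightarrow>\<^sub>L 'b" where f': "\<And>x. x \<in> S \<Longrightarrow> (f has_derivative blinfun_apply (f' x)) (at x)"
    and cont: "continuous_on S f'"
    using assms(1) unfolding C1_on_def by blast
  have fd: "frechet_derivative f (at x0) = blinfun_apply (f' x0)"
    using frechet_derivative_at[OF f'[OF assms(3)]] by simp
  show ?thesis
    unfolding fd strict_deriv_def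
  proof (intro conjI allI impI)
    show "bounded_linear (blinfun_apply (f' x0))" by (rule blinfun.bounded_linear_right)
    fix \<eta> :: real assume \<eta>: "0 < \<eta>"
    have "isCont f' x0" using cont assms(2,3) by (simp add: continuous_on_eq_continuous_at)
    then obtain d where d: "0 < d" "\<And>x. dist x x0 < d \<Longrightarrow> dist (f' x) (f' x0) < \<eta>"
      using \<eta> unfolding continuous_at_eps_delta by blast
    obtain e where e: "0 < e" "ball x0 e \<subseteq> S" using assms(2,3) open_contains_ball by blast
    have "norm (f y - f x - f' x0 (y - x)) \<le> \<eta> * norm (y - x)"
      if x: "x \<in> ball x0 (min d e)" and y: "y \<in> ball x0 (min d e)" for x y
    proof -
      have "norm ((f y - f' x0 y) - (f x - f' x0 x)) \<le> \<eta> * norm (y - x)"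
      proof (rule differentiable_bound[of "ball x0 (min d e)" "\<lambda>z. f z - f' x0 z" "\<lambda>z. blinfun_apply (f' z - f' x0)"])
        fix z assume z: "z \<in> ball x0 (min d e)"
        then have "(f has_derivative blinfun_apply (f' z)) (at z)" using e(2) f' by auto
        then have "((\<lambda>z. f z - f' x0 z) has_derivative (\<lambda>h. f' z h - f' x0 h)) (at z)"
          by (intro has_derivative_diff bounded_linear_imp_has_derivative blinfun.bounded_linear_right)
        then show "((\<lambda>z. f z - f' x0 z) has_derivative blinfun_apply (f' z - f' x0)) (at z within ball x0 (min d e))"
        proof -
          have "blinfun_apply (f' z - f' x0) = (\<lambda>h. f' z h - f' x0 h)" by (rule ext) (rule blinfun.diff_left)
          then show ?thesis using \<open>((\<lambda>z. f z - f' x0 z) has_derivative (\<lambda>h. f' z h - f' x0 h)) (at z)\<close>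
            by (simp only: has_derivative_at_withinI)
        qed
        have "norm (f' z - f' x0) \<le> \<eta>" using d(2)[of z] z by (simp add: dist_norm[symmetric] dist_commute)
        then show "onorm (blinfun_apply (f' z - f' x0)) \<le> \<eta>" by (simp add: norm_blinfun.rep_eq)
      qed (use x y in auto)
      then show ?thesis by (simp add: blinfun.diff_right algebra_simps)
    qed
    then show "\<exists>\<delta>>0. \<forall>x\<in>ball x0 \<delta>. \<forall>y\<in>ball x0 \<delta>. norm (f y - f x - f' x0 (y - x)) \<le> \<eta> * norm (y - x)"
      using d(1) e(1) by (intro exI[of _ "min d e"]) auto
  qed
qed

text \<open>The error is first controlled relative to \<open>norm (G y - G x)\<close>. With the
  factor 1/2 this makes \<open>G\<close> Lipschitz, and then the error is controlled relative to
  \<open>norm (y - x)\<close>.\<close>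

lemma strict_deriv_inverse:
  assumes F: "strict_deriv F T (G x0)" and "open V" "x0 \<in> V" and G: "continuous_on V G" "\<And>x. x \<in> V \<Longrightarrow> F (G x) = x"
    and Ti: "bounded_linear Ti" "\<And>v. Ti (T v) = v"
  shows "strict_deriv G Ti x0"
proof -
  obtain K where K: "0 < K" "\<And>v. norm (Ti v) \<le> norm v * K" using bounded_linear.pos_bounded[OF Ti(1)] by blast
  have main: "\<exists>\<delta>>0. \<forall>x\<in>ball x0 \<delta>. \<forall>y\<in>ball x0 \<delta>. norm (G y - G x - Ti (y - x)) \<le> K * \<eta> * norm (G y - G x)"
    if \<eta>: "0 < \<eta>" for \<eta>
  proof -
    obtain d where d: "0 < d" "\<And>x y. x \<in> ball (G x0) d \<Longrightarrow> y \<in> ball (G x0) d \<Longrightarrow> norm (F y - F x - T (y - x)) \<le> \<eta> * norm (y - x)"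
      using strict_derivD[OF F \<eta>] by metis
    have "isCont G x0" using G(1) assms(2,3) by (simp add: continuous_on_eq_continuous_at)
    then obtain e where e: "0 < e" "\<And>x. dist x x0 < e \<Longrightarrow> dist (G x) (G x0) < d"
      using d(1) unfolding continuous_at_eps_delta by blast
    obtain e' where e': "0 < e'" "ball x0 e' \<subseteq> V" using assms(2,3) open_contains_ball by blast
    have "norm (G y - G x - Ti (y - x)) \<le> K * \<eta> * norm (G y - G x)"
      if x: "x \<in> ball x0 (min e e')" and y: "y \<in> ball x0 (min e e')" for x y
    proof -
      have V: "x \<in> V" "y \<in> V" using x y e'(2) by auto
      have "G x \<in> ball (G x0) d" "G y \<in> ball (G x0) d" using e(2)[of x] e(2)[of y] x y by (auto simp: dist_commute)
      from d(2)[OF this] have 1: "norm (y - x - T (G y - G x)) \<le> \<eta> * norm (G y - G x)" using V G(2) by simp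
      have "G y - G x - Ti (y - x) = - Ti (y - x - T (G y - G x))"
        using Ti by (simp add: bounded_linear.linear linear_diff)
      also have "norm \<dots> \<le> norm (y - x - T (G y - G x)) * K" using K(2) by simp
      also have "\<dots> \<le> (\<eta> * norm (G y - G x)) * K" using 1 K(1) by (intro mult_right_mono) auto
      finally show ?thesis by (simp add: mult_ac)
    qed
    then show ?thesis using e(1) e'(1) by (intro exI[of _ "min e e'"]) auto
  qed
  have "0 < 1 / (2 * K)" using K by simp
  from main[OF this] obtain d0 where d0: "0 < d0"
    "\<And>x y. x \<in> ball x0 d0 \<Longrightarrow> y \<in> ball x0 d0 \<Longrightarrow> norm (G y - G x - Ti (y - x)) \<le> K * (1 / (2 * K)) * norm (G y - G x)"
    by metis
  have lip: "norm (G y - G x) \<le> 2 * K * norm (y - x)" if "x \<in> ball x0 d0" "y \<in> ball x0 d0" for x y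
  proof -
    have "norm (G y - G x) \<le> norm (G y - G x - Ti (y - x)) + norm (Ti (y - x))"
      by (metis add.commute diff_add_cancel norm_triangle_ineq)
    then show ?thesis using d0(2)[OF that] K(1) K(2)[of "y - x"] by (simp add: mult_ac)
  qed
  show ?thesis
    unfolding strict_deriv_def
  proof (intro conjI allI impI)
    fix \<eta> :: real assume \<eta>: "0 < \<eta>"
    then have "0 < \<eta> / (2 * K * K)" using K by simp
    from main[OF this] obtain d where d: "0 < d"
      "\<And>x y. x \<in> ball x0 d \<Longrightarrow> y \<in> ball x0 d \<Longrightarrow> norm (G y - G x - Ti (y - x)) \<le> K * (\<eta> / (2 * K * K)) * norm (G y - G x)"
      by metis
    have "norm (G y - G x - Ti (y - x)) \<le> \<eta> * norm (y - x)" if "x \<in> ball x0 (min d d0)" "y \<in> ball x0 (min d d0)" for x y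
    proof -
      have "norm (G y - G x - Ti (y - x)) \<le> K * (\<eta> / (2 * K * K)) * norm (G y - G x)" using that by (intro d(2)) auto
      also have "\<dots> \<le> K * (\<eta> / (2 * K * K)) * (2 * K * norm (y - x))"
        using lip[of x y] that \<eta> K(1) by (intro mult_left_mono) auto
      also have "\<dots> = \<eta> * norm (y - x)" using K(1) by simp
      finally show ?thesis .
    qed
    then show "\<exists>\<delta>>0. \<forall>x\<in>ball x0 \<delta>. \<forall>y\<in>ball x0 \<delta>. norm (G y - G x - Ti (y - x)) \<le> \<eta> * norm (y - x)"
      using d(1) d0(1) by (intro exI[of _ "min d d0"]) auto
  qed (rule Ti(1))
qed

section \<open>Lifts to the group\<close>

text \<open>
  The tangent space of the group at a matrix M consists of the products of M with a matrix of trace 0;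
  the derivative of a local lift has to cover it.
\<close>

definition local_lift :: "('a::euclidean_space \<Rightarrow> real^3^3) \<Rightarrow> 'a \<Rightarrow> bool" where
  "local_lift B x0 \<longleftrightarrow> (\<exists>\<delta>>0. \<forall>x\<in>ball x0 \<delta>. det (B x) = 1) \<and>
    (\<exists>T. strict_deriv B T x0 \<and> (\<forall>H. trace H = 0 \<longrightarrow> (\<exists>\<xi>. T \<xi> = B x0 ** H)))"

text \<open>Infinitesimal form of the fact that cross products transform by the inverse transpose
  under matrices of determinant 1.\<close>

lemma traceless_cross:
  fixes H :: "real^3^3"
  assumes "trace H = 0"
  shows "a \<times> (transpose H *v b) + (transpose H *v a) \<times> b = - (H *v (a \<times> b))"
proof -
  have t: "H $ 3 $ 3 = - H $ 1 $ 1 - H $ 2 $ 2" using assms by (simp add: trace_def sum_3)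
  show ?thesis
    by (simp add: vec_eq_iff forall_3 cross_components matrix_vector_mult_def transpose_def sum_3 t algebra_simps)
qed

lemma traceless_moves:
  fixes b u :: "real^3"
  assumes "b \<noteq> 0" "u \<noteq> 0"
  shows "\<exists>H::real^3^3. trace H = 0 \<and> u \<bullet> (H *v b) \<noteq> 0"
proof (intro exI conjI)
  \<comment> \<open>The rank one matrix that sends \<open>b\<close> to a multiple of
    \<open>u\<close>, corrected to trace 0; by Cauchy-Schwarz the correction takes at most a third
    of the value.\<close>
  let ?H = "(\<chi> i j. u $ i * b $ j) - ((u \<bullet> b) / 3) *\<^sub>R (mat 1 :: real^3^3)"
  show "trace ?H = 0" by (simp add: trace_def sum_3 inner_vec_def mat_def field_simps)
  have "?H *v b = (b \<bullet> b) *\<^sub>R u - ((u \<bullet> b) / 3) *\<^sub>R b"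
    by (simp add: vec_eq_iff forall_3 matrix_vector_mult_def sum_3 inner_vec_def mat_def algebra_simps)
  then have "u \<bullet> (?H *v b) = (norm u * norm b)\<^sup>2 - (u \<bullet> b)\<^sup>2 / 3"
    by (simp add: inner_diff_right power2_norm_eq_inner[symmetric] power_mult_distrib power2_eq_square)
  moreover have "(u \<bullet> b)\<^sup>2 \<le> (norm u * norm b)\<^sup>2"
    using Cauchy_Schwarz_ineq2[of u b] by (metis abs_ge_zero power2_abs power_mono)
  moreover have "0 < (norm u * norm b)\<^sup>2" using assms by simp
  ultimately show "u \<bullet> (?H *v b) \<noteq> 0" by linarith
qed

lemma bounded_bilinear_cross: "bounded_bilinear (cross3)"
  by (rule bilinear_conv_bounded_bilinear[THEN iffD1])
    (auto simp: bilinear_def linear_iff cross_add_left cross_add_right cross_mult_left cross_mult_right)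

lemma bounded_linear_transpose_mult: "bounded_linear (\<lambda>B::real^3^3. transpose B *v m)"
  by (rule linear_conv_bounded_linear[THEN iffD1])
    (simp add: linear_iff vec_eq_iff matrix_vector_mult_def transpose_def sum.distrib sum_distrib_left algebra_simps)

text \<open>Here \<open>r m x\<close> is the form \<open>m\<close> pulled back by
  \<open>B x\<close>. Moving \<open>B\<close> in the direction \<open>B x0 ** H\<close> moves
  \<open>r m1 x \<times> r m2 x\<close> by \<open>- H\<close> applied to it, and traceless
  \<open>H\<close> push a nonzero vector out of every plane; so every strip has a nonzero
  normal.\<close>

lemma wins_from_lift:
  fixes B :: "'a::euclidean_space \<Rightarrow> real^3^3"
  assumes \<beta>: "0 < \<beta>" "\<beta> < 1/3" and lift: "local_lift B x0" and l: "0 \<le> l2" "l2 \<le> l1" "l1 + l2 = 1"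
    and m: "m1 \<bullet> (m2 \<times> m3) \<noteq> 0" and "0 < \<delta>0"
    and S: "\<And>x \<epsilon>. x \<in> ball x0 \<delta>0 \<Longrightarrow> 0 < \<epsilon> \<Longrightarrow>
      (\<And>n v. int_vec v \<Longrightarrow> v \<noteq> 0 \<Longrightarrow> \<epsilon> < exp (l1 * real n) * \<bar>m1 \<bullet> (B x *v v)\<bar> \<or>
         \<epsilon> < exp (l2 * real n) * \<bar>m2 \<bullet> (B x *v v)\<bar> \<or> \<epsilon> < exp (- real n) * \<bar>m3 \<bullet> (B x *v v)\<bar>) \<Longrightarrow> x \<in> S"
  shows "\<exists>\<delta>>0. \<forall>b. 0 < snd b \<longrightarrow> ball_set b \<subseteq> ball x0 \<delta> \<longrightarrow> (\<exists>\<sigma>. wins_from \<beta> S b \<sigma>)"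
proof -
  obtain \<delta>1 T where \<delta>1: "0 < \<delta>1" "\<And>x. x \<in> ball x0 \<delta>1 \<Longrightarrow> det (B x) = 1"
    and T: "strict_deriv B T x0" "\<And>H. trace H = 0 \<Longrightarrow> \<exists>\<xi>. T \<xi> = B x0 ** H"
    using lift unfolding local_lift_def by blast
  define r where "r m x = transpose (B x) *v m" for m x
  have rm: "r m x \<bullet> v = m \<bullet> (B x *v v)" for m x v
    unfolding r_def by (simp add: dot_lmul_matrix[symmetric] vector_transpose_matrix)
  have r: "strict_deriv (r m) (\<lambda>\<xi>. transpose (T \<xi>) *v m) x0" for m
    unfolding r_def by (rule strict_deriv_linear_comp[OF T(1) bounded_linear_transpose_mult])
  have c: "strict_deriv (\<lambda>x. r m x \<times> r m' x)
      (\<lambda>\<xi>. r m x0 \<times> (transpose (T \<xi>) *v m') + (transpose (T \<xi>) *v m) \<times> r m' x0) x0" for m m'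
    by (rule strict_deriv_bilinear[OF r r bounded_bilinear_cross])
  have vol: "r m1 x \<bullet> (r m2 x \<times> r m3 x) = m1 \<bullet> (m2 \<times> m3)" if "x \<in> ball x0 \<delta>1" for x
    unfolding r_def triple_matrix_mult using \<delta>1(2)[OF that] by (simp add: det_transpose)
  obtain Mr dr where Mr: "\<And>m. 0 < Mr m" "\<And>m. 0 < dr m" "\<And>m x. x \<in> ball x0 (dr m) \<Longrightarrow> norm (r m x) \<le> Mr m"
  proof -
    have "\<forall>m. \<exists>M d. 0 < M \<and> 0 < d \<and> (\<forall>x\<in>ball x0 d. norm (r m x) \<le> M)"
      using strict_deriv_bounded[OF r] by metis
    then show ?thesis using that by metis
  qed
  obtain Mc dc where Mc: "\<And>m m'. 0 < Mc m m'" "\<And>m m'. 0 < dc m m'"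
    "\<And>m m' x. x \<in> ball x0 (dc m m') \<Longrightarrow> norm (r m x \<times> r m' x) \<le> Mc m m'"
  proof -
    have "\<forall>m m'. \<exists>M d. 0 < M \<and> 0 < d \<and> (\<forall>x\<in>ball x0 d. norm (r m x \<times> r m' x) \<le> M)"
      using strict_deriv_bounded[OF c] by metis
    then show ?thesis using that by metis
  qed
  obtain Lc ec where Lc: "\<And>m m'. 0 < Lc m m'" "\<And>m m'. 0 < ec m m'"
    "\<And>m m' x y. x \<in> ball x0 (ec m m') \<Longrightarrow> y \<in> ball x0 (ec m m') \<Longrightarrow>
      norm (r m y \<times> r m' y - r m x \<times> r m' x) \<le> Lc m m' * norm (y - x)"
  proof -
    have "\<forall>m m'. \<exists>M d. 0 < M \<and> 0 < d \<and> (\<forall>x\<in>ball x0 d. \<forall>y\<in>ball x0 d.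
        norm (r m y \<times> r m' y - r m x \<times> r m' x) \<le> M * norm (y - x))"
      using strict_deriv_lipschitz[OF c] by metis
    then show ?thesis using that by metis
  qed
  define K where "K = Max {1, Mr m1, Mr m2, Mr m3, Mc m2 m3, Mc m3 m1, Mc m1 m2, Lc m3 m1, Lc m1 m2, 1 / \<bar>m1 \<bullet> (m2 \<times> m3)\<bar>}"
  define RR where "RR = {\<delta>0, \<delta>1, dr m1, dr m2, dr m3, dc m2 m3, dc m3 m1, dc m1 m2, ec m3 m1, ec m1 m2}"
  obtain R where R0: "0 < R" and R: "\<And>a. a \<in> RR \<Longrightarrow> R \<le> a"
  proof (rule finite_pos_lower_bound)
    show "0 < a" if "a \<in> RR" for a
      using that Mr(2) Mc(2) Lc(2) \<delta>1(1) \<open>0 < \<delta>0\<close> unfolding RR_def by blast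
  qed (auto simp: RR_def)
  define KK where "KK = {1, Mr m1, Mr m2, Mr m3, Mc m2 m3, Mc m3 m1, Mc m1 m2, Lc m3 m1, Lc m1 m2, 1 / \<bar>m1 \<bullet> (m2 \<times> m3)\<bar>}"
  have "finite KK" by (simp add: KK_def)
  then have KK: "a \<le> Max KK" if "a \<in> KK" for a using that by (rule Max_ge)
  define K where "K = Max KK"
  have K: "1 \<le> K" "Mr m1 \<le> K" "Mr m2 \<le> K" "Mr m3 \<le> K" "Mc m2 m3 \<le> K" "Mc m3 m1 \<le> K" "Mc m1 m2 \<le> K" "Lc m3 m1 \<le> K" "Lc m1 m2 \<le> K"
    "1 / \<bar>m1 \<bullet> (m2 \<times> m3)\<bar> \<le> K"
    unfolding K_def by (rule KK, simp add: KK_def)+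
  have RS: "ball x0 R \<subseteq> ball x0 e" if "e \<in> RR" for e
    by (rule subset_ball[OF R[OF that]])
  interpret F: moving_frame "r m1" "r m2" "r m3" "ball x0 R" K l1 l2
  proof
    show "1 \<le> K" by (rule K(1))
    fix x assume x: "x \<in> ball x0 R"
    have xe: "x \<in> ball x0 e" if "e \<in> RR" for e
      using RS[OF that] x by blast
    show "norm (r m1 x) \<le> K" by (rule order_trans[OF Mr(3) K(2)]) (rule xe, simp add: RR_def)
    show "norm (r m2 x) \<le> K" by (rule order_trans[OF Mr(3) K(3)]) (rule xe, simp add: RR_def)
    show "norm (r m3 x) \<le> K" by (rule order_trans[OF Mr(3) K(4)]) (rule xe, simp add: RR_def)
    show "norm (r m2 x \<times> r m3 x) \<le> K" by (rule order_trans[OF Mc(3) K(5)]) (rule xe, simp add: RR_def)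
    show "norm (r m3 x \<times> r m1 x) \<le> K" by (rule order_trans[OF Mc(3) K(6)]) (rule xe, simp add: RR_def)
    show "norm (r m1 x \<times> r m2 x) \<le> K" by (rule order_trans[OF Mc(3) K(7)]) (rule xe, simp add: RR_def)
    have "x \<in> ball x0 \<delta>1" by (rule xe) (simp add: RR_def)
    then show "1 \<le> K * \<bar>r m1 x \<bullet> (r m2 x \<times> r m3 x)\<bar>" using K(10) m by (simp add: vol divide_le_eq)
    fix y assume y: "y \<in> ball x0 R"
    have ye: "y \<in> ball x0 e" if "e \<in> RR" for e
      using RS[OF that] y by blast
    have "norm (r m3 x \<times> r m1 x - r m3 y \<times> r m1 y) \<le> Lc m3 m1 * norm (x - y)" by (rule Lc(3)) (rule xe ye, simp add: RR_def)+
    also have "\<dots> \<le> K * norm (x - y)" using K by (intro mult_right_mono) auto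
    finally show "norm (r m3 x \<times> r m1 x - r m3 y \<times> r m1 y) \<le> K * norm (x - y)" .
    have "norm (r m1 x \<times> r m2 x - r m1 y \<times> r m2 y) \<le> Lc m1 m2 * norm (x - y)" by (rule Lc(3)) (rule xe ye, simp add: RR_def)+
    also have "\<dots> \<le> K * norm (x - y)" using K by (intro mult_right_mono) auto
    finally show "norm (r m1 x \<times> r m2 x - r m1 y \<times> r m2 y) \<le> K * norm (x - y)" .
  qed (use l in auto)
  have x0R: "x0 \<in> ball x0 \<delta>1" using \<delta>1(1) by simp
  have c30: "r m1 x0 \<times> r m2 x0 \<noteq> 0"
  proof
    assume "r m1 x0 \<times> r m2 x0 = 0"
    then have "r m1 x0 \<bullet> (r m2 x0 \<times> r m3 x0) = 0" using cross_triple[of "r m1 x0" "r m2 x0" "r m3 x0"] by (simp add: inner_commute)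
    then show False using vol[OF x0R] m by simp
  qed
  show ?thesis
  proof (rule F.wins_from_frame[OF \<beta> subset_refl R0 c])
    fix u :: "real^3" assume "norm u = 1"
    then have "u \<noteq> 0" by auto
    from traceless_moves[OF c30 this] obtain H where H: "trace H = 0" "u \<bullet> (H *v (r m1 x0 \<times> r m2 x0)) \<noteq> 0" by blast
    obtain \<xi> where \<xi>: "T \<xi> = B x0 ** H" using T(2)[OF H(1)] by blast
    have t: "transpose (T \<xi>) *v m = transpose H *v r m x0" for m
      unfolding \<xi> r_def matrix_transpose_mul by (rule matrix_vector_mul_assoc[symmetric])
    have "r m1 x0 \<times> (transpose (T \<xi>) *v m2) + (transpose (T \<xi>) *v m1) \<times> r m2 x0 = - (H *v (r m1 x0 \<times> r m2 x0))"
      unfolding t by (rule traceless_cross[OF H(1)])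
    then show "\<exists>\<xi>. u \<bullet> (r m1 x0 \<times> (transpose (T \<xi>) *v m2) + (transpose (T \<xi>) *v m1) \<times> r m2 x0) \<noteq> 0"
      using H(2) by (intro exI[of _ \<xi>]) simp
  next
    fix x \<epsilon> assume x: "x \<in> ball x0 R" and \<epsilon>: "0 < \<epsilon>" and ns: "\<And>n v. \<not> F.short \<epsilon> (real n) x v"
    show "x \<in> S"
    proof (rule S[OF _ \<epsilon>])
      show "x \<in> ball x0 \<delta>0" using RS[of \<delta>0] x by (auto simp: RR_def)
      fix n :: nat and v assume v: "int_vec v" "v \<noteq> 0"
      have "\<not> (\<bar>r m1 x \<bullet> v\<bar> \<le> \<epsilon> / exp (l1 * n) \<and> \<bar>r m2 x \<bullet> v\<bar> \<le> \<epsilon> / exp (l2 * n) \<and> \<bar>r m3 x \<bullet> v\<bar> \<le> \<epsilon> * exp n)"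
        using ns[of n v] v by (simp add: F.short_def)
      then show "\<epsilon> < exp (l1 * real n) * \<bar>m1 \<bullet> (B x *v v)\<bar> \<or> \<epsilon> < exp (l2 * real n) * \<bar>m2 \<bullet> (B x *v v)\<bar> \<or>
          \<epsilon> < exp (- real n) * \<bar>m3 \<bullet> (B x *v v)\<bar>"
        by (simp add: rm le_divide_eq exp_minus inverse_eq_divide less_divide_eq mult.commute not_le)
    qed
  qed
qed

text \<open>A tangent direction \<open>H\<close> at \<open>B x0\<close> becomes
  \<open>- transpose H\<close> at the contragredient, and this again runs through all matrices of
  trace 0.\<close>

lemma local_lift_cofm:
  fixes B :: "'a::euclidean_space \<Rightarrow> real^3^3"
  assumes "local_lift B x0"
  shows "local_lift (\<lambda>x. cofm (B x)) x0"
proof -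
  obtain \<delta>1 T where \<delta>1: "0 < \<delta>1" "\<And>x. x \<in> ball x0 \<delta>1 \<Longrightarrow> det (B x) = 1"
    and T: "strict_deriv B T x0" "\<And>H. trace H = 0 \<Longrightarrow> \<exists>\<xi>. T \<xi> = B x0 ** H"
    using assms unfolding local_lift_def by blast
  define E :: "3 \<Rightarrow> real^3 \<Rightarrow> real^3^3" where "E i v = axis i v" for i v
  have blE: "bounded_linear (E i)" for i
    by (rule linear_conv_bounded_linear[THEN iffD1]) (simp add: E_def linear_iff vec_eq_iff axis_def)
  have blr: "bounded_linear (\<lambda>B::real^3^3. B $ i)" for i by (rule bounded_linear_vec_nth)
  have cofE: "cofm B = E 1 (B $ 2 \<times> B $ 3) + E 2 (B $ 3 \<times> B $ 1) + E 3 (B $ 1 \<times> B $ 2)" for B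
    by (simp add: vec_eq_iff forall_3 cofm_nth E_def axis_def)
  define D where "D i j \<xi> = B x0 $ i \<times> T \<xi> $ j + T \<xi> $ i \<times> B x0 $ j" for i j \<xi>
  have D: "strict_deriv (\<lambda>x. B x $ i \<times> B x $ j) (D i j) x0" for i j
    unfolding D_def
    by (rule strict_deriv_bilinear[OF strict_deriv_linear_comp[OF T(1) blr] strict_deriv_linear_comp[OF T(1) blr] bounded_bilinear_cross])
  have st: "strict_deriv (\<lambda>x. cofm (B x)) (\<lambda>\<xi>. E 1 (D 2 3 \<xi>) + E 2 (D 3 1 \<xi>) + E 3 (D 1 2 \<xi>)) x0"
    unfolding cofE by (intro strict_deriv_add strict_deriv_linear_comp[OF D blE])
  have "\<exists>\<xi>. E 1 (D 2 3 \<xi>) + E 2 (D 3 1 \<xi>) + E 3 (D 1 2 \<xi>) = cofm (B x0) ** H" if H: "trace H = 0" for H :: "real^3^3"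
  proof -
    define H' where "H' = - transpose H"
    have tr: "trace H' = 0" using H by (simp add: H'_def trace_def transpose_def sum_negf)
    then obtain \<xi> where \<xi>: "T \<xi> = B x0 ** H'" using T(2) by blast
    have row: "(M ** N) $ i = transpose N *v (M $ i)" for M N :: "real^3^3" and i
      by (simp add: vec_eq_iff matrix_matrix_mult_def matrix_vector_mult_def transpose_def mult.commute)
    have DD: "D i j \<xi> = transpose H *v (B x0 $ i \<times> B x0 $ j)" for i j
      unfolding D_def \<xi> row traceless_cross[OF tr]
      by (simp add: H'_def vec_eq_iff matrix_vector_mult_def sum_negf transpose_def)
    have "E 1 (D 2 3 \<xi>) + E 2 (D 3 1 \<xi>) + E 3 (D 1 2 \<xi>) = cofm (B x0) ** H"
    proof -
      have "\<forall>i. (E 1 (D 2 3 \<xi>) + E 2 (D 3 1 \<xi>) + E 3 (D 1 2 \<xi>)) $ i = (cofm (B x0) ** H) $ i"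
        unfolding forall_3 row cofm_nth DD by (simp add: E_def axis_def)
      then show ?thesis by (rule vec_eq_iff[THEN iffD2])
    qed
    then show ?thesis by blast
  qed
  then show ?thesis
    unfolding local_lift_def using st \<delta>1 det_cofm by blast
qed

section \<open>Charts of the homogeneous space\<close>

text \<open>In finite dimension, continuity of the derivative in operator norm follows from
  continuity of its value at each vector.\<close>

lemma C1_onI:
  fixes f :: "'a::euclidean_space \<Rightarrow> 'b::real_normed_vector"
  assumes d: "\<And>x. x \<in> S \<Longrightarrow> (f has_derivative f' x) (at x)" and c: "\<And>h. continuous_on S (\<lambda>x. f' x h)"
  shows "C1_on f S"
  unfolding C1_on_def
proof (intro exI conjI ballI)
  have bl: "blinfun_apply (Blinfun (f' x)) = f' x" if "x \<in> S" for x
    by (rule bounded_linear_Blinfun_apply[OF has_derivative_bounded_linear[OF d[OF that]]])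
  show "(f has_derivative blinfun_apply (Blinfun (f' x))) (at x)" if "x \<in> S" for x
    using d[OF that] bl[OF that] by simp
  show "continuous_on S (\<lambda>x. Blinfun (f' x))"
    by (rule continuous_on_blinfun_componentwise) (simp add: bl c cong: continuous_on_cong)
qed

definition ddet :: "real^3^3 \<Rightarrow> real^3^3 \<Rightarrow> real" where
  "ddet A H = A $ 1 \<bullet> (A $ 2 \<times> H $ 3 + H $ 2 \<times> A $ 3) + H $ 1 \<bullet> (A $ 2 \<times> A $ 3)"

lemma det_rows: "det (A::real^3^3) = A $ 1 \<bullet> (A $ 2 \<times> A $ 3)"
  by (simp add: det_3 inner_vec_def sum_3 cross_components algebra_simps)

lemma has_derivative_nth: "(f has_derivative f') (at x) \<Longrightarrow> ((\<lambda>x. f x $ i) has_derivative (\<lambda>h. f' h $ i)) (at x)"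
  by (rule bounded_linear.has_derivative[OF bounded_linear_vec_nth])

lemma has_derivative_det3:
  fixes f :: "'a::real_normed_vector \<Rightarrow> real^3^3"
  assumes "(f has_derivative f') (at x)"
  shows "((\<lambda>x. det (f x)) has_derivative (\<lambda>h. ddet (f x) (f' h))) (at x)"
  unfolding det_rows ddet_def
  by (intro bounded_bilinear.FDERIV[OF bounded_bilinear_inner] bounded_bilinear.FDERIV[OF bounded_bilinear_cross]
      has_derivative_nth assms)

lemma ddet_mat_1: "ddet (mat 1) H = trace H"
  by (simp add: ddet_def trace_def sum_3 inner_vec_def cross_components mat_def)

lemma continuous_on_cross: "continuous_on S f \<Longrightarrow> continuous_on S g \<Longrightarrow> continuous_on S (\<lambda>x. f x \<times> g x)"
  by (rule bounded_bilinear.continuous_on[OF bounded_bilinear_cross])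

lemma bounded_linear_matrix_mult_left: "bounded_linear (\<lambda>B::real^3^3. A ** B)"
proof (rule linear_conv_bounded_linear[THEN iffD1], rule linearI)
  show "A ** (c *\<^sub>R B) = c *\<^sub>R (A ** B)" for c and B :: "real^3^3"
    by (simp add: vec_eq_iff matrix_matrix_mult_def sum_distrib_left mult_ac)
qed (rule matrix_add_ldistrib)

lemma bounded_linear_trace: "bounded_linear (trace :: real^3^3 \<Rightarrow> real)"
  by (rule linear_conv_bounded_linear[THEN iffD1])
    (simp add: linear_iff trace_def sum.distrib sum_distrib_left)

lemma det_scaleR3: "det (c *\<^sub>R (A::real^3^3)) = c ^ 3 * det A"
  by (simp add: det_3 power3_eq_cube algebra_simps)

lemma trace_scaleR: "trace (c *\<^sub>R (A::real^3^3)) = c * trace A"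
  by (simp add: trace_def sum_distrib_left)

text \<open>Trace 0 means orthogonal to the identity matrix: a hyperplane in dimension 9.\<close>

lemma traceless_iso:
  obtains L :: "real^8 \<Rightarrow> real^3^3" and L' where "linear L" "linear L'" "\<forall>y. trace (L y) = 0" "\<forall>y. L' (L y) = y"
    "\<forall>H. trace H = 0 \<longrightarrow> L (L' H) = H"
proof -
  have tr: "mat 1 \<bullet> H = trace H" for H :: "real^3^3"
    by (simp add: trace_def inner_vec_def sum_3 mat_def)
  have nz: "(mat 1 :: real^3^3) \<noteq> 0" by (simp add: vec_eq_iff mat_def)
  have "dim {H::real^3^3. mat 1 \<bullet> H = 0} = 8" using dim_hyperplane[OF nz] by simp
  then have d: "dim (UNIV :: (real^8) set) = dim {H::real^3^3. mat 1 \<bullet> H = 0}" by simp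
  show ?thesis
  proof (rule isometries_subspaces[OF subspace_UNIV subspace_hyperplane d])
    fix f :: "real^8 \<Rightarrow> real^3^3" and g
    assume fg: "linear f" "linear g" "range f = {H. mat 1 \<bullet> H = 0}" "\<And>x. x \<in> UNIV \<Longrightarrow> g (f x) = x"
      "\<And>y. y \<in> {H. mat 1 \<bullet> H = 0} \<Longrightarrow> f (g y) = y"
    show ?thesis
    proof (rule that[OF fg(1,2)])
      have "mat 1 \<bullet> f y = 0" for y using fg(3) by blast
      then show "\<forall>y. trace (f y) = 0" using tr by simp
      show "\<forall>y. g (f y) = y" using fg(4) by simp
      show "\<forall>H. trace H = 0 \<longrightarrow> f (g H) = H" using fg(5) tr by simp
    qed
  qed
qed

text \<open>A chart without the exponential map: \<open>A0\<close> times \<open>mat 1 + L y\<close>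
  with \<open>L y\<close> traceless, rescaled to determinant 1. Its inverse rescales the inverse of
  \<open>A0\<close> times \<open>A\<close> to trace 3 instead, so the chart domain is given by a
  positive trace and both directions are explicit.\<close>

lemma chart_at:
  fixes A0 :: "real^3^3"
  assumes A0: "det A0 = 1"
  obtains p :: "real^8 \<Rightarrow> real^3^3" and W \<psi> T where "(W, \<psi>) \<in> submanifold_charts (carrier SL3R)"
    "homeomorphism W (\<psi> ` W) \<psi> p" "0 \<in> \<psi> ` W" "p 0 = A0"
    "strict_deriv p T 0" "\<forall>H. trace H = 0 \<longrightarrow> (\<exists>y. T y = A0 ** H)" "open (\<psi> ` W)" "W \<subseteq> carrier SL3R"
proof -
  obtain L :: "real^8 \<Rightarrow> real^3^3" and L' where Ls: "linear L" "linear L'" "\<forall>y. trace (L y) = 0" "\<forall>y. L' (L y) = y"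
    "\<forall>H. trace H = 0 \<longrightarrow> L (L' H) = H"
    by (rule traceless_iso)
  have L: "linear L" "linear L'" "\<And>y. trace (L y) = 0" "\<And>y. L' (L y) = y" "\<And>H. trace H = 0 \<Longrightarrow> L (L' H) = H"
    using Ls by auto
  have blL: "bounded_linear L" "bounded_linear L'" using L(1,2) by (simp_all add: linear_conv_bounded_linear)
  have L0: "L 0 = 0" using L(1) by (rule linear_0)
  define A1 where "A1 = transpose (cofm A0)"
  have "A0 ** A1 = mat 1" using mult_transpose_cofm[of A0] A0 by (simp add: A1_def)
  then have A1: "A1 ** A0 = mat 1" "A0 ** A1 = mat 1" by (simp_all add: matrix_left_right_inverse)
  define N where "N y = mat 1 + L y" for y
  have trN: "trace (N y) = 3" for y by (simp add: N_def trace_add L(3)) (simp add: trace_def mat_def)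
  define Q where "Q = {y. 0 < det (N y)}"
  define s where "s y = det (N y) powr (-1/3)" for y
  define p where "p y = s y *\<^sub>R (A0 ** N y)" for y
  define \<psi> where "\<psi> A = L' ((3 / trace (A1 ** A)) *\<^sub>R (A1 ** A) - mat 1)" for A
  define W where "W = {A. det A = 1 \<and> 0 < trace (A1 ** A)}"
  have s0: "0 < s y" if "y \<in> Q" for y using that by (simp add: s_def Q_def)
  have s3: "s y ^ 3 * det (N y) = 1" if "y \<in> Q" for y
  proof -
    have "s y ^ 3 = det (N y) powr (-1)" using that by (simp add: s_def Q_def powr_power)
    then show ?thesis using that by (simp add: Q_def powr_minus)
  qed
  have A1p: "A1 ** p y = s y *\<^sub>R N y" for y
  proof -
    have "A1 ** p y = s y *\<^sub>R (A1 ** (A0 ** N y))"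
      unfolding p_def by (rule linear_scale) (simp add: bounded_linear.linear[OF bounded_linear_matrix_mult_left])
    then show ?thesis by (simp add: matrix_mul_assoc A1)
  qed
  have pW: "p y \<in> W" if "y \<in> Q" for y
  proof -
    have "det (p y) = 1" using s3[OF that] A0 by (simp add: p_def det_scaleR3 det_mul)
    then show ?thesis using s0[OF that] by (simp add: W_def A1p trace_scaleR trN)
  qed
  have \<psi>p: "\<psi> (p y) = y" if "y \<in> Q" for y
    using s0[OF that] by (simp add: \<psi>_def A1p trace_scaleR trN) (simp add: N_def L(4))
  have \<psi>W: "\<psi> A \<in> Q \<and> p (\<psi> A) = A" if "A \<in> W" for A
  proof -
    define \<tau> where "\<tau> = trace (A1 ** A) / 3"
    have \<tau>: "0 < \<tau>" using that by (simp add: W_def \<tau>_def)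
    have e: "\<psi> A = L' ((1 / \<tau>) *\<^sub>R (A1 ** A) - mat 1)" by (simp add: \<psi>_def \<tau>_def)
    have "trace ((1 / \<tau>) *\<^sub>R (A1 ** A) - mat 1) = 0"
      using \<tau> by (simp add: trace_sub trace_scaleR) (simp add: \<tau>_def trace_def mat_def)
    then have N: "N (\<psi> A) = (1 / \<tau>) *\<^sub>R (A1 ** A)" by (simp add: N_def e L(5))
    have dA1: "det A1 = 1" using arg_cong[OF A1(1), of det] A0 by (simp add: det_mul)
    have dN: "det (N (\<psi> A)) = (1 / \<tau>) ^ 3" using that by (simp add: N det_scaleR3 det_mul dA1 W_def)
    then have Q: "\<psi> A \<in> Q" using \<tau> by (simp add: Q_def)
    have "s (\<psi> A) ^ 3 = \<tau> ^ 3" using s3[OF Q] \<tau> unfolding dN by (simp add: power_divide)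
    then have "s (\<psi> A) = \<tau>" using s0[OF Q] \<tau> by (meson less_imp_le power_eq_iff_eq_base zero_less_numeral)
    then have "p (\<psi> A) = \<tau> *\<^sub>R (A0 ** ((1 / \<tau>) *\<^sub>R (A1 ** A)))" by (simp add: p_def N)
    also have "A0 ** ((1 / \<tau>) *\<^sub>R (A1 ** A)) = (1 / \<tau>) *\<^sub>R (A0 ** (A1 ** A))"
      by (rule linear_scale) (simp add: bounded_linear.linear[OF bounded_linear_matrix_mult_left])
    finally have "p (\<psi> A) = A" using \<tau> by (simp add: matrix_mul_assoc A1)
    then show ?thesis using Q by simp
  qed
  have img: "\<psi> ` W = Q" using \<psi>W \<psi>p pW by (force simp: image_iff)
  have contL: "continuous_on S L" for S by (rule linear_continuous_on[OF blL(1)])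
  have contN: "continuous_on S N" for S unfolding N_def by (intro continuous_intros contL)
  have contdet: "continuous_on S (\<lambda>y. det (N y))" for S
    unfolding det_rows by (intro continuous_intros continuous_on_cross contN)
  have openO: "open Q" unfolding Q_def by (rule open_Collect_less) (intro continuous_intros contdet)+
  define ds where "ds y h = s y * (ddet (N y) (L h) * (-1/3) / det (N y))" for y h
  define p' where "p' y h = s y *\<^sub>R (A0 ** L h) + ds y h *\<^sub>R (A0 ** N y)" for y h
  have dp: "(p has_derivative p' y) (at y)" if y: "y \<in> Q" for y
  proof -
    have dN: "(N has_derivative L) (at y)"
      unfolding N_def using has_derivative_add[OF has_derivative_const bounded_linear_imp_has_derivative[OF blL(1)]] by simp
    have dA: "((\<lambda>y. A0 ** N y) has_derivative (\<lambda>h. A0 ** L h)) (at y)"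
      by (rule bounded_linear.has_derivative[OF bounded_linear_matrix_mult_left dN])
    have "(s has_derivative (\<lambda>h. (det (N y) powr (-1/3)) * (0 * ln (det (N y)) + ddet (N y) (L h) * (-1/3) / det (N y)))) (at y)"
      unfolding s_def using y
      by (intro has_derivative_powr has_derivative_det3 dN has_derivative_const) (auto simp: Q_def)
    moreover have "(\<lambda>h. (det (N y) powr (-1/3)) * (0 * ln (det (N y)) + ddet (N y) (L h) * (-1/3) / det (N y))) = ds y"
      by (rule ext) (simp add: ds_def s_def)
    ultimately have dds: "(s has_derivative ds y) (at y)" by (simp only:)
    show ?thesis unfolding p_def p'_def by (rule has_derivative_scaleR[OF dds dA])
  qed
  have C1: "C1_on p Q"
  proof (rule C1_onI[OF dp])
    fix h
    have cs: "continuous_on Q s" unfolding s_def by (intro continuous_intros contdet) (auto simp: Q_def)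
    have cd: "continuous_on Q (\<lambda>y. ds y h)"
      unfolding ds_def ddet_def by (intro continuous_intros continuous_on_cross contN contdet cs) (auto simp: Q_def)
    show "continuous_on Q (\<lambda>y. p' y h)"
      unfolding p'_def
      by (intro continuous_intros cs cd bounded_linear.continuous_on[OF bounded_linear_matrix_mult_left] contN)
  qed
  have imm: "C1_immersion_on p Q"
    unfolding C1_immersion_on_def
  proof (intro conjI ballI C1)
    fix y assume y: "y \<in> Q"
    have fd: "frechet_derivative p (at y) = p' y" using frechet_derivative_at[OF dp[OF y]] by simp
    have lin: "linear (p' y)" using has_derivative_bounded_linear[OF dp[OF y]] by (rule bounded_linear.linear)
    show "inj (frechet_derivative p (at y))"
      unfolding fd linear_injective_0[OF lin]
    proof (intro allI impI)
      fix h assume h: "p' y h = 0"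
      have lA: "linear (\<lambda>B::real^3^3. A1 ** B)" by (rule bounded_linear.linear[OF bounded_linear_matrix_mult_left])
      have "A1 ** p' y h = s y *\<^sub>R (A1 ** (A0 ** L h)) + ds y h *\<^sub>R (A1 ** (A0 ** N y))"
        unfolding p'_def by (simp add: linear_add[OF lA] linear_scale[OF lA])
      moreover have "A1 ** p' y h = 0" using linear_0[OF lA] h by simp
      ultimately have e: "s y *\<^sub>R L h + ds y h *\<^sub>R N y = 0" by (simp add: matrix_mul_assoc A1)
      \<comment> \<open>The trace annihilates \<open>L h\<close> and is 3 on \<open>N y\<close>,
        which separates the two summands.\<close>
      have "trace (s y *\<^sub>R L h + ds y h *\<^sub>R N y) = 3 * ds y h" by (simp add: trace_add trace_scaleR L(3) trN)
      then have "ds y h = 0" unfolding e by (simp add: trace_def)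
      then have "L h = 0" using e s0[OF y] by simp
      then show "h = 0" using L(4)[of h] linear_0[OF L(2)] by simp
    qed
  qed
  have contp: "continuous_on Q p"
    using dp openO by (meson has_derivative_continuous continuous_at_imp_continuous_on)
  have cont\<psi>: "continuous_on W \<psi>"
    unfolding \<psi>_def
    by (intro bounded_linear.continuous_on[OF blL(2)] continuous_intros bounded_linear.continuous_on[OF bounded_linear_trace]
        bounded_linear.continuous_on[OF bounded_linear_matrix_mult_left]) (auto simp: W_def)
  have hom: "homeomorphism W (\<psi> ` W) \<psi> p"
    unfolding homeomorphism_def img using contp cont\<psi> \<psi>p \<psi>W pW img by (auto simp: image_iff)
  have Wsub: "W \<subseteq> carrier SL3R" by (auto simp: W_def SL3R_def)
  have "openin (top_of_set (carrier SL3R)) W"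
  proof -
    have "W = carrier SL3R \<inter> {A. 0 < trace (A1 ** A)}" by (auto simp: W_def SL3R_def)
    moreover have "open {A. 0 < trace (A1 ** A)}"
      by (rule open_Collect_less)
        (intro continuous_intros bounded_linear.continuous_on[OF bounded_linear_trace]
          bounded_linear.continuous_on[OF bounded_linear_matrix_mult_left])+
    ultimately show ?thesis by (simp add: openin_open_Int)
  qed
  then have chart: "(W, \<psi>) \<in> submanifold_charts (carrier SL3R)"
    unfolding submanifold_charts_def using hom imm openO img by auto
  have N0: "N 0 = mat 1" by (simp add: N_def L0)
  have O0: "0 \<in> Q" by (simp add: Q_def N0)
  have p0: "p 0 = A0" by (simp add: p_def s_def N0)
  have "p' 0 = (\<lambda>h. A0 ** L h)"
    by (rule ext) (simp add: p'_def ds_def N0 ddet_mat_1 L(3) s_def)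
  then have st: "strict_deriv p (\<lambda>h. A0 ** L h) 0"
    using strict_deriv_C1[OF C1 openO O0] frechet_derivative_at[OF dp[OF O0]] by simp
  show ?thesis
  proof (rule that[OF chart hom _ p0 st])
    show "\<forall>H. trace H = 0 \<longrightarrow> (\<exists>y. A0 ** L y = A0 ** H)" using L(5) by metis
  qed (use O0 img openO Wsub in auto)
qed

text \<open>Read in a group chart, the projection followed by \<phi> is a C1 map \<open>F\<close>
  with injective derivative between spaces of equal dimension. The lift is the parametrization
  \<open>p\<close> after a local inverse of \<open>F\<close>.\<close>

lemma chart_local_lift:
  assumes A: "X_atlas \<A>" "(U, \<phi>) \<in> \<A>" and x0: "x0 \<in> \<phi> ` U"
  obtains B \<delta> where "0 < \<delta>" "local_lift B x0"
    "\<And>x. x \<in> ball x0 \<delta> \<Longrightarrow> det (B x) = 1 \<and> coset_proj (B x) \<in> U \<and> \<phi> (coset_proj (B x)) = x"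
proof -
  have opU: "openin X_space U" using A unfolding X_atlas_def C1_atlas_def by fastforce
  then have oU: "U \<subseteq> lcosets\<^bsub>SL3R\<^esub> SL3Z" "openin (top_of_set (carrier SL3R)) {A \<in> carrier SL3R. coset_proj A \<in> U}"
    unfolding openin_X_space by auto
  obtain A0 where A0: "A0 \<in> carrier SL3R" "coset_proj A0 \<in> U" "\<phi> (coset_proj A0) = x0"
    using x0 oU(1) by (force simp: LCOSETS_def coset_proj_def)
  have d0: "det A0 = 1" using A0(1) by (simp add: SL3R_def)
  obtain p :: "real^8 \<Rightarrow> real^3^3" and W \<psi> T where ch: "(W, \<psi>) \<in> submanifold_charts (carrier SL3R)"
    "homeomorphism W (\<psi> ` W) \<psi> p" "0 \<in> \<psi> ` W" "p 0 = A0"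
    "strict_deriv p T 0" "\<forall>H. trace H = 0 \<longrightarrow> (\<exists>y. T y = A0 ** H)" "open (\<psi> ` W)" "W \<subseteq> carrier SL3R"
    by (rule chart_at[OF d0])
  have p\<psi>: "\<And>A. A \<in> W \<Longrightarrow> p (\<psi> A) = A" "\<And>y. y \<in> \<psi> ` W \<Longrightarrow> \<psi> (p y) = y" "\<And>y. y \<in> \<psi> ` W \<Longrightarrow> p y \<in> W"
    "continuous_on (\<psi> ` W) p"
    using ch(2) by (auto simp: homeomorphism_def)
  have inj: "inj_on \<psi> W" using p\<psi>(1) by (metis inj_onI)
  have ii: "inv_into W \<psi> y = p y" if "y \<in> \<psi> ` W" for y
    using p\<psi>(2,3)[OF that] inj by (metis inv_into_f_f)
  define \<Omega> where "\<Omega> = \<psi> ` (W \<inter> coset_proj -` U)"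
  define F where "F = \<phi> \<circ> coset_proj \<circ> inv_into W \<psi>"
  have imm: "C1_immersion_on F \<Omega>"
    using A ch(1) unfolding X_atlas_def local_C1_diffeo_def F_def \<Omega>_def by fastforce
  have \<Omega>sub: "\<Omega> \<subseteq> \<psi> ` W" by (auto simp: \<Omega>_def)
  obtain T' where T': "open T'" "{A \<in> carrier SL3R. coset_proj A \<in> U} = carrier SL3R \<inter> T'"
    using oU(2) by (auto simp: openin_open)
  have T'iff: "A \<in> T' \<longleftrightarrow> coset_proj A \<in> U" if "A \<in> carrier SL3R" for A
    using T'(2) that by (metis (mono_tags, lifting) Int_iff mem_Collect_eq)
  have \<Omega>eq: "\<Omega> = \<psi> ` W \<inter> p -` T'"
  proof (intro Set.set_eqI iffI)
    fix y assume "y \<in> \<Omega>"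
    then obtain A where "A \<in> W" "coset_proj A \<in> U" "y = \<psi> A" by (auto simp: \<Omega>_def)
    then show "y \<in> \<psi> ` W \<inter> p -` T'" using p\<psi>(1)[of A] T'iff[of A] ch(8) by auto
  next
    fix y assume y: "y \<in> \<psi> ` W \<inter> p -` T'"
    then have "p y \<in> W" "coset_proj (p y) \<in> U" "\<psi> (p y) = y"
      using p\<psi>(2,3)[of y] T'iff[of "p y"] ch(8) by auto
    then show "y \<in> \<Omega>" unfolding \<Omega>_def by (metis IntI imageI vimageI)
  qed
  have op\<Omega>: "open \<Omega>" unfolding \<Omega>eq by (rule continuous_open_preimage[OF p\<psi>(4) ch(7) T'(1)])
  have Fy: "coset_proj (p y) \<in> U" "F y = \<phi> (coset_proj (p y))" "det (p y) = 1" if "y \<in> \<Omega>" for y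
    using that \<Omega>eq p\<psi>(3)[of y] T'iff[of "p y"] ch(8) ii[of y] by (auto simp: F_def SL3R_def)
  have O0: "0 \<in> \<Omega>" using ch(3,4) A0 T'iff[of A0] by (auto simp: \<Omega>eq)
  have F0: "F 0 = x0" using Fy(2)[OF O0] ch(4) A0(3) by simp
  obtain f' :: "real^8 \<Rightarrow> ((real^8) \<Rightarrow>\<^sub>L (real^8))" where f': "\<And>x. x \<in> \<Omega> \<Longrightarrow> (F has_derivative blinfun_apply (f' x)) (at x)"
    "continuous_on \<Omega> f'"
    using imm unfolding C1_immersion_on_def C1_on_def by blast
  have fd: "frechet_derivative F (at 0) = blinfun_apply (f' 0)"
    using frechet_derivative_at[OF f'(1)[OF O0]] by simp
  have "inj (blinfun_apply (f' 0))" using imm O0 fd unfolding C1_immersion_on_def by metis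
  moreover have "linear (blinfun_apply (f' 0))" by (rule bounded_linear.linear[OF blinfun.bounded_linear_right])
  ultimately obtain Ti where Ti: "linear Ti" "\<And>v. Ti (f' 0 v) = v"
    using linear_injective_left_inverse by (metis comp_apply id_apply)
  have blTi: "bounded_linear Ti" using Ti(1) by (simp add: linear_conv_bounded_linear)
  have "Blinfun Ti o\<^sub>L f' 0 = id_blinfun"
    by (rule blinfun_eqI) (simp add: bounded_linear_Blinfun_apply[OF blTi] Ti(2))
  from inverse_function_theorem[OF op\<Omega> f' O0 this] obtain U' V g where
    iv: "open U'" "U' \<subseteq> \<Omega>" "0 \<in> U'" "open V" "F 0 \<in> V" "homeomorphism U' V F g" by metis
  have g: "\<And>x. x \<in> V \<Longrightarrow> F (g x) = x" "\<And>x. x \<in> V \<Longrightarrow> g x \<in> \<Omega>" "continuous_on V g" "g x0 = 0"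
    using iv F0 by (auto simp: homeomorphism_def)
  have stF: "strict_deriv F (blinfun_apply (f' 0)) (g x0)"
    using strict_deriv_C1[of F \<Omega> 0] imm op\<Omega> O0 fd g(4) by (simp add: C1_immersion_on_def)
  have x0V: "x0 \<in> V" using iv(5) F0 by simp
  have stg: "strict_deriv g Ti x0"
    by (rule strict_deriv_inverse[OF stF iv(4) x0V g(3,1) blTi Ti(2)])
  have "strict_deriv p T (g x0)" using ch(5) g(4) by simp
  from strict_deriv_comp[OF stg this] have stB: "strict_deriv (\<lambda>x. p (g x)) (\<lambda>\<xi>. T (Ti \<xi>)) x0" .
  obtain \<delta> where \<delta>: "0 < \<delta>" "ball x0 \<delta> \<subseteq> V" using iv(4) x0V open_contains_ball by blast
  have pr: "det (p (g x)) = 1 \<and> coset_proj (p (g x)) \<in> U \<and> \<phi> (coset_proj (p (g x))) = x" if "x \<in> ball x0 \<delta>" for x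
  proof -
    have "x \<in> V" using that \<delta>(2) by blast
    then show ?thesis using g(1,2)[of x] Fy[of "g x"] by auto
  qed
  \<comment> \<open>\<open>Ti\<close> undoes the derivative of \<open>F\<close>, so
    \<open>f' 0 y\<close> is a preimage of \<open>y\<close> under it.\<close>
  have surj: "\<exists>\<xi>. T (Ti \<xi>) = p (g x0) ** H" if tr: "trace H = 0" for H
  proof -
    obtain y where "T y = A0 ** H" using ch(6) tr by blast
    then have "T (Ti (f' 0 y)) = p (g x0) ** H" using Ti(2) g(4) ch(4) by simp
    then show ?thesis by blast
  qed
  have "local_lift (\<lambda>x. p (g x)) x0"
    unfolding local_lift_def using \<delta>(1) pr stB surj by blast
  then show ?thesis using that[OF \<delta>(1) _ pr] by blast
qed

section \<open>Bounded orbits\<close>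

lemma SL3R_simps: "carrier SL3R = {A. det A = 1}" "A \<otimes>\<^bsub>SL3R\<^esub> B = A ** B"
  by (simp_all add: SL3R_def)

lemma l_coset_coset_proj: "A <#\<^bsub>SL3R\<^esub> coset_proj B = coset_proj (A ** B)"
  unfolding coset_proj_def l_coset_def SL3R_simps by (auto simp: matrix_mul_assoc)

lemma SL3Z_mult: "\<gamma> \<in> SL3Z \<Longrightarrow> \<gamma>' \<in> SL3Z \<Longrightarrow> \<gamma> ** \<gamma>' \<in> SL3Z"
proof -
  assume a: "\<gamma> \<in> SL3Z" "\<gamma>' \<in> SL3Z"
  then have "(\<gamma> ** \<gamma>') $ i $ j \<in> \<int>" for i j
    unfolding SL3Z_iff by (auto simp: matrix_matrix_mult_def intro!: Ints_sum Ints_mult)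
  then show ?thesis using a unfolding SL3Z_iff by (simp add: det_mul)
qed

lemma coset_proj_image: "coset_proj A = (\<lambda>\<gamma>. A ** \<gamma>) ` SL3Z"
  by (auto simp: coset_proj_def l_coset_def SL3R_simps)

lemma coset_proj_mult_SL3Z:
  assumes "\<gamma> \<in> SL3Z"
  shows "coset_proj (A ** \<gamma>) = coset_proj A"
proof -
  define \<gamma>' where "\<gamma>' = transpose (cofm \<gamma>)"
  have "\<gamma>' \<in> SL3Z" using cofm_SL3Z[OF assms] unfolding SL3Z_iff \<gamma>'_def by (simp add: det_transpose) (simp add: transpose_def)
  moreover have "\<gamma> ** \<gamma>' = mat 1" using mult_transpose_cofm[of \<gamma>] assms by (simp add: \<gamma>'_def SL3Z_iff)
  ultimately have 1: "A ** \<delta> = A ** \<gamma> ** (\<gamma>' ** \<delta>) \<and> \<gamma>' ** \<delta> \<in> SL3Z" if "\<delta> \<in> SL3Z" for \<delta>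
    using that SL3Z_mult by (metis matrix_mul_assoc matrix_mul_lid)
  have 2: "A ** \<gamma> ** \<delta> = A ** (\<gamma> ** \<delta>) \<and> \<gamma> ** \<delta> \<in> SL3Z" if "\<delta> \<in> SL3Z" for \<delta>
    using that assms SL3Z_mult by (simp add: matrix_mul_assoc)
  show ?thesis
    unfolding coset_proj_image
  proof (intro equalityI image_subsetI)
    show "A ** \<gamma> ** \<delta> \<in> (\<lambda>\<gamma>. A ** \<gamma>) ` SL3Z" if "\<delta> \<in> SL3Z" for \<delta> using 2[OF that] by (metis imageI)
    show "A ** \<delta> \<in> (\<lambda>\<delta>. A ** \<gamma> ** \<delta>) ` SL3Z" if "\<delta> \<in> SL3Z" for \<delta> using 1[OF that] by (metis imageI)
  qed
qed

lemma compact_bounded_SL3R: "compact {A \<in> carrier SL3R. \<forall>i j. \<bar>A $ i $ j\<bar> \<le> C}"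
proof (rule compact_eq_bounded_closed[THEN iffD2], rule conjI)
  show "bounded {A \<in> carrier SL3R. \<forall>i j. \<bar>A $ i $ j\<bar> \<le> C}"
  proof (rule boundedI)
    fix A :: "real^3^3" assume "A \<in> {A \<in> carrier SL3R. \<forall>i j. \<bar>A $ i $ j\<bar> \<le> C}"
    then have A: "\<bar>A $ i $ j\<bar> \<le> C" for i j by blast
    have "norm (A $ i) \<le> 3 * C" for i
    proof -
      have "norm (A $ i) \<le> (\<Sum>j\<in>UNIV. \<bar>A $ i $ j\<bar>)" by (rule norm_le_l1_cart)
      also have "\<dots> \<le> 3 * C" using A[of i 1] A[of i 2] A[of i 3] by (simp add: sum_3)
      finally show ?thesis .
    qed
    then have n: "norm (A $ 1) \<le> 3 * C" "norm (A $ 2) \<le> 3 * C" "norm (A $ 3) \<le> 3 * C" by auto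
    have "norm A \<le> (\<Sum>i\<in>UNIV. norm (A $ i))" unfolding norm_vec_def by (rule L2_set_le_sum) simp
    then show "norm A \<le> 9 * C" using n by (simp add: sum_3)
  qed
  have "closed {A :: real^3^3. det A = 1}"
    unfolding det_rows
    by (intro closed_Collect_eq continuous_intros continuous_on_cross)
  moreover have "closed {A :: real^3^3. \<forall>i j. \<bar>A $ i $ j\<bar> \<le> C}"
    by (intro closed_Collect_all closed_Collect_le continuous_intros)
  ultimately have "closed ({A :: real^3^3. det A = 1} \<inter> {A. \<forall>i j. \<bar>A $ i $ j\<bar> \<le> C})" by (rule closed_Int)
  moreover have "{A \<in> carrier SL3R. \<forall>i j. \<bar>A $ i $ j\<bar> \<le> C} = {A :: real^3^3. det A = 1} \<inter> {A. \<forall>i j. \<bar>A $ i $ j\<bar> \<le> C}"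
    by (auto simp: SL3R_simps)
  ultimately show "closed {A \<in> carrier SL3R. \<forall>i j. \<bar>A $ i $ j\<bar> \<le> C}" by simp
qed

lemma mult_entry_bound:
  fixes A B :: "real^3^3"
  assumes "\<And>i j. \<bar>A $ i $ j\<bar> \<le> a" "\<And>i j. \<bar>B $ i $ j\<bar> \<le> b"
  shows "\<bar>(A ** B) $ i $ j\<bar> \<le> 3 * (a * b)"
proof -
  have a0: "0 \<le> a" using assms(1)[of 1 1] by linarith
  have "\<bar>(A ** B) $ i $ j\<bar> \<le> (\<Sum>k\<in>UNIV. \<bar>A $ i $ k * B $ k $ j\<bar>)"
    unfolding matrix_matrix_mult_def by (simp add: sum_abs)
  also have "\<dots> \<le> (\<Sum>k\<in>(UNIV::3 set). a * b)"
    by (intro sum_mono) (auto simp: abs_mult intro!: mult_mono assms a0)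
  finally show ?thesis by simp
qed

lemma one_parameter_homD:
  assumes "one_parameter_hom g"
  shows "det (g t) = 1" "g (s + t) = g s ** g t" "g 0 = mat 1" "continuous_on S g"
proof -
  show d: "det (g t) = 1" for t using assms by (auto simp: one_parameter_hom_def SL3R_simps)
  show m: "g (s + t) = g s ** g t" for s t using assms by (simp add: one_parameter_hom_def SL3R_simps)
  show "continuous_on S g" using assms continuous_on_subset unfolding one_parameter_hom_def by blast
  have inv: "transpose (cofm (g 0)) ** g 0 = mat 1"
    using mult_transpose_cofm[of "g 0"] d by (simp add: matrix_left_right_inverse)
  have "g 0 = transpose (cofm (g 0)) ** g 0 ** g 0" using inv by simp
  also have "\<dots> = transpose (cofm (g 0)) ** g (0 + 0)" unfolding m by (simp add: matrix_mul_assoc)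
  finally show "g 0 = mat 1" using inv by simp
qed

text \<open>Integer times suffice, since a time \<open>t \<ge> 0\<close> differs from an integer by
  an element of [0, 1], where \<open>g\<close> is bounded. The representatives then stay in a
  compact set of matrices, whose image is compact.\<close>

lemma bounded_orbit_pointsI:
  assumes g: "one_parameter_hom g" and A: "det A = 1"
    and bd: "\<And>n::nat. \<exists>\<gamma>\<in>SL3Z. \<forall>i j. \<bar>(g (real n) ** A ** \<gamma>) $ i $ j\<bar> \<le> C"
  shows "coset_proj A \<in> bounded_orbit_points (g ` {0..})"
proof -
  note gD = one_parameter_homD[OF g]
  have "compact (g ` {0..1})" by (rule compact_continuous_image[OF gD(4)]) simp
  then obtain N where N: "\<And>t. t \<in> {0..1} \<Longrightarrow> norm (g t) \<le> N"
    using compact_imp_bounded[of "g ` {0..1}"] unfolding bounded_iff by blast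
  have gN: "\<bar>g t $ i $ j\<bar> \<le> N" if "t \<in> {0..1}" for t i j
    using component_le_norm_cart[of "g t $ i" j] Finite_Cartesian_Product.norm_nth_le[of "g t" i] N[OF that] by linarith
  define K where "K = {B \<in> carrier SL3R. \<forall>i j. \<bar>B $ i $ j\<bar> \<le> 3 * (N * C)}"
  have cK: "compactin X_space (coset_proj ` K)"
  proof (rule image_compactin)
    show "compactin (top_of_set (carrier SL3R)) K"
      unfolding compactin_subtopology using compact_bounded_SL3R by (auto simp: K_def)
    show "continuous_map (top_of_set (carrier SL3R)) X_space coset_proj"
      using quotient_map_coset_proj by (rule quotient_imp_continuous_map)
  qed
  have "(\<lambda>h. h <#\<^bsub>SL3R\<^esub> coset_proj A) ` (g ` {0..}) \<subseteq> coset_proj ` K"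
  proof (clarsimp simp: l_coset_coset_proj)
    fix t :: real assume t: "0 \<le> t"
    define n where "n = nat \<lfloor>t\<rfloor>"
    define s where "s = t - real n"
    have s: "s \<in> {0..1}" using t by (auto simp: s_def n_def) linarith+
    obtain \<gamma> where \<gamma>: "\<gamma> \<in> SL3Z" "\<And>i j. \<bar>(g (real n) ** A ** \<gamma>) $ i $ j\<bar> \<le> C" using bd by blast
    have e: "g t ** A ** \<gamma> = g s ** (g (real n) ** A ** \<gamma>)"
      using gD(2)[of s "real n"] by (simp add: s_def matrix_mul_assoc)
    have "g t ** A ** \<gamma> \<in> K"
      unfolding K_def
    proof (intro CollectI conjI allI)
      show "g t ** A ** \<gamma> \<in> carrier SL3R" using gD(1) A \<gamma>(1) by (simp add: SL3R_simps det_mul SL3Z_iff)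
      show "\<bar>(g t ** A ** \<gamma>) $ i $ j\<bar> \<le> 3 * (N * C)" for i j
        unfolding e by (rule mult_entry_bound[OF gN[OF s] \<gamma>(2)])
    qed
    then have "coset_proj (g t ** A ** \<gamma>) \<in> coset_proj ` K" by blast
    then show "coset_proj (g t ** A) \<in> coset_proj ` K" using coset_proj_mult_SL3Z[OF \<gamma>(1), of "g t ** A"] by simp
  qed
  then have "bounded_in X_space ((\<lambda>h. h <#\<^bsub>SL3R\<^esub> coset_proj A) ` (g ` {0..}))"
    unfolding bounded_in_def using cK by blast
  moreover have "coset_proj A \<in> topspace X_space"
    unfolding topspace_X_space LCOSETS_def coset_proj_def using A by (auto simp: SL3R_simps)
  ultimately show ?thesis by (simp add: bounded_orbit_points_def)
qed

text \<open>Passage from normalized to true rates: time \<open>j\<close> of the group is time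
  \<open>(l1 + l2) * j\<close> of the scaled flow, rounded up to an integer. If
  \<open>l1 = 0\<close>, all rates vanish and the hypothesis at time 0 decides; 1 and 0 are then
  just admissible values with sum 1.\<close>

lemma orbit_norm_bound:
  fixes H :: "nat \<Rightarrow> real^3^3" and w :: "real^3"
  assumes l: "0 \<le> l2" "l2 \<le> l1" and k: "k1 = (if l1 = 0 then 1 else l1 / (l1 + l2))" "k2 = (if l1 = 0 then 0 else l2 / (l1 + l2))"
    and c: "0 < c" "\<And>n. c * exp (l1 * real n) * \<bar>m1 \<bullet> w\<bar> \<le> norm (H n *v w)"
      "\<And>n. c * exp (l2 * real n) * \<bar>m2 \<bullet> w\<bar> \<le> norm (H n *v w)"
      "\<And>n. c * exp (- (l1 + l2) * real n) * \<bar>m3 \<bullet> w\<bar> \<le> norm (H n *v w)"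
    and dis: "\<And>n::nat. \<epsilon> < exp (k1 * real n) * \<bar>m1 \<bullet> w\<bar> \<or> \<epsilon> < exp (k2 * real n) * \<bar>m2 \<bullet> w\<bar> \<or> \<epsilon> < exp (- real n) * \<bar>m3 \<bullet> w\<bar>"
  shows "c * (\<epsilon> / 3) \<le> norm (H j *v w)"
proof -
  define n where "n = nat \<lceil>(l1 + l2) * real j\<rceil>"
  have n: "(l1 + l2) * real j \<le> real n" "real n \<le> (l1 + l2) * real j + 1"
    using l by (auto simp: n_def of_nat_ceiling)
  \<comment> \<open>Rounding the time costs at most the factor exp 1, which is at most 3.\<close>
  have key: "\<epsilon> / 3 \<le> exp (l * real j) * y" if "\<epsilon> < exp (k * real n) * y" "k * real n \<le> l * real j + 1" "0 \<le> y" for l k y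
  proof -
    have "exp (k * real n) \<le> exp 1 * exp (l * real j)" using that(2) by (simp add: exp_add[symmetric] add.commute)
    also have "\<dots> \<le> 3 * exp (l * real j)" using exp_le by (intro mult_right_mono) auto
    finally have "exp (k * real n) * y \<le> 3 * exp (l * real j) * y" using that(3) by (intro mult_right_mono)
    then show ?thesis using that(1) by linarith
  qed
  have fin: ?thesis if "\<epsilon> / 3 \<le> exp (l * real j) * y" "c * exp (l * real j) * y \<le> norm (H j *v w)" for l y
  proof -
    have "c * (\<epsilon> / 3) \<le> c * (exp (l * real j) * y)" using that(1) c(1) by (intro mult_left_mono) auto
    then show ?thesis using that(2) by (simp add: mult.assoc)
  qed
  show ?thesis
  proof (cases "l1 = 0")
    case True
    then have l0: "l1 = 0" "l2 = 0" using l by auto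
    from dis[of 0] consider "\<epsilon> < \<bar>m1 \<bullet> w\<bar>" | "\<epsilon> < \<bar>m2 \<bullet> w\<bar>" | "\<epsilon> < \<bar>m3 \<bullet> w\<bar>" by auto
    then show ?thesis
    proof cases
      case 1
      then show ?thesis using fin[OF _ c(2)] l0 by simp
    next
      case 2
      then show ?thesis using fin[OF _ c(3)] l0 by simp
    next
      case 3
      then show ?thesis using fin[OF _ c(4)] l0 by simp
    qed
  next
    case False
    then have s0: "0 < l1 + l2" and kk: "k1 = l1 / (l1 + l2)" "k2 = l2 / (l1 + l2)" using l k by auto
    have kn: "l / (l1 + l2) * real n \<le> l * real j + 1" if "0 \<le> l" "l \<le> l1 + l2" for l
    proof -
      have "l / (l1 + l2) * real n \<le> l / (l1 + l2) * ((l1 + l2) * real j + 1)"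
        using n(2) that s0 by (intro mult_left_mono) auto
      also have "\<dots> = l * real j + l / (l1 + l2)" using s0 by (simp add: distrib_left)
      also have "l / (l1 + l2) \<le> 1" using that s0 by simp
      finally show ?thesis by simp
    qed
    from dis[of n] consider "\<epsilon> < exp (k1 * real n) * \<bar>m1 \<bullet> w\<bar>" | "\<epsilon> < exp (k2 * real n) * \<bar>m2 \<bullet> w\<bar>"
      | "\<epsilon> < exp ((-1) * real n) * \<bar>m3 \<bullet> w\<bar>" by auto
    then show ?thesis
    proof cases
      case 1
      show ?thesis by (rule fin[OF key[OF 1] c(2)]) (use kn[of l1] l kk in auto)
    next
      case 2
      show ?thesis by (rule fin[OF key[OF 2] c(3)]) (use kn[of l2] l kk in auto)
    next
      case 3
      show ?thesis by (rule fin[OF key[OF 3] c(4)]) (use n(1) in \<open>auto simp: algebra_simps\<close>)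
    qed
  qed
qed

lemma wins_from_growth:
  fixes B :: "'a::euclidean_space \<Rightarrow> real^3^3" and H :: "nat \<Rightarrow> real^3^3" and l1 l2 :: real
  assumes \<beta>: "0 < \<beta>" "\<beta> < 1/3" and lift: "local_lift B x0" and "0 < \<delta>0"
    and m: "m1 \<bullet> (m2 \<times> m3) \<noteq> 0" and l: "0 \<le> l2" "l2 \<le> l1"
    and gr: "grows H m1 l1" "grows H m2 l2" "grows H m3 (- (l1 + l2))"
    and S: "\<And>x \<epsilon>. x \<in> ball x0 \<delta>0 \<Longrightarrow> 0 < \<epsilon> \<Longrightarrow>
      (\<And>n v. int_vec v \<Longrightarrow> v \<noteq> 0 \<Longrightarrow> \<epsilon> \<le> norm (H n *v (B x *v v))) \<Longrightarrow> x \<in> S"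
  shows "\<exists>\<delta>>0. \<forall>b. 0 < snd b \<longrightarrow> ball_set b \<subseteq> ball x0 \<delta> \<longrightarrow> (\<exists>\<sigma>. wins_from \<beta> S b \<sigma>)"
proof -
  obtain c1 c2 c3 where c: "0 < c1" "0 < c2" "0 < c3"
    "\<And>n u. c1 * exp (l1 * real n) * \<bar>m1 \<bullet> u\<bar> \<le> norm (H n *v u)"
    "\<And>n u. c2 * exp (l2 * real n) * \<bar>m2 \<bullet> u\<bar> \<le> norm (H n *v u)"
    "\<And>n u. c3 * exp (- (l1 + l2) * real n) * \<bar>m3 \<bullet> u\<bar> \<le> norm (H n *v u)"
    using gr unfolding grows_def by metis
  define c where "c = min c1 (min c2 c3)"
  have c0: "0 < c" and cle: "c \<le> c1" "c \<le> c2" "c \<le> c3" using c(1-3) by (auto simp: c_def)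
  have down: "c * a * y \<le> z" if "c' * a * y \<le> z" "c \<le> c'" "0 \<le> a" "0 \<le> y" for a y z c' :: real
  proof -
    have "c * (a * y) \<le> c' * (a * y)" using that by (intro mult_right_mono) auto
    then show ?thesis using that(1) by (simp add: mult.assoc)
  qed
  have cc: "c * exp (l1 * real n) * \<bar>m1 \<bullet> u\<bar> \<le> norm (H n *v u)"
    "c * exp (l2 * real n) * \<bar>m2 \<bullet> u\<bar> \<le> norm (H n *v u)"
    "c * exp (- (l1 + l2) * real n) * \<bar>m3 \<bullet> u\<bar> \<le> norm (H n *v u)" for n u
    by (rule down[OF c(4) cle(1)] down[OF c(5) cle(2)] down[OF c(6) cle(3)]; simp)+
  define k1 k2 where "k1 = (if l1 = 0 then 1 else l1 / (l1 + l2))" and "k2 = (if l1 = 0 then 0 else l2 / (l1 + l2))"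
  have k: "0 \<le> k2" "k2 \<le> k1" "k1 + k2 = 1"
    using l by (auto simp: k1_def k2_def divide_right_mono add_divide_distrib[symmetric])
  show ?thesis
  proof (rule wins_from_lift[OF \<beta> lift k m \<open>0 < \<delta>0\<close>])
    fix x \<epsilon>
    assume x: "x \<in> ball x0 \<delta>0" and \<epsilon>: "0 < \<epsilon>"
      and dis: "\<And>n v. int_vec v \<Longrightarrow> v \<noteq> 0 \<Longrightarrow> \<epsilon> < exp (k1 * real n) * \<bar>m1 \<bullet> (B x *v v)\<bar> \<or>
         \<epsilon> < exp (k2 * real n) * \<bar>m2 \<bullet> (B x *v v)\<bar> \<or> \<epsilon> < exp (- real n) * \<bar>m3 \<bullet> (B x *v v)\<bar>"
    show "x \<in> S"
    proof (rule S[OF x])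
      show "0 < c * (\<epsilon> / 3)" using c0 \<epsilon> by simp
      show "c * (\<epsilon> / 3) \<le> norm (H n *v (B x *v v))" if "int_vec v" "v \<noteq> 0" for n v
        by (rule orbit_norm_bound[OF l k1_def k2_def c0 cc dis[OF that]])
    qed
  qed
qed

lemma map_matrix_of_real_mult:
  "map_matrix complex_of_real (A ** B) = map_matrix complex_of_real A ** map_matrix complex_of_real B"
  by (simp add: vec_eq_iff matrix_matrix_mult_def map_matrix_def)

lemma map_matrix_of_real_transpose:
  "map_matrix complex_of_real (transpose A) = transpose (map_matrix complex_of_real A)"
  by (simp add: vec_eq_iff transpose_def map_matrix_def)

lemma map_matrix_of_real_mat_1: "map_matrix complex_of_real (mat 1) = mat 1"
  by (simp add: vec_eq_iff mat_def map_matrix_def)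

lemma det_map_matrix_of_real: "det (map_matrix complex_of_real (A::real^3^3)) = of_real (det A)"
  by (simp add: det_3 map_matrix_def)

theorem theorem1p2:
  fixes g :: "real \<Rightarrow> real^3^3"
    and A :: "((real^3^3) set, real^8) chart set"
  assumes "one_parameter_hom g"
    and "\<forall>h\<in>range g. diagonalizable_over_C h"
    and "X_atlas A"
  shows "HAW_on_manifold A (bounded_orbit_points (g ` {0..}))"
proof -
  note gD = one_parameter_homD[OF assms(1)]
  define h where "h = g 1"
  have dh: "det h = 1" using gD(1) by (simp add: h_def)
  let ?c = "map_matrix complex_of_real"
  obtain P D :: "complex^3^3" where P: "invertible P" and Dd: "\<And>i j. i \<noteq> j \<Longrightarrow> D $ i $ j = 0"
    and hP: "?c h = P ** D ** matrix_inv P"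
    using assms(2) unfolding diagonalizable_over_C_def h_def by blast
  define Q where "Q = matrix_inv P"
  have Pi: "P ** Q = mat 1" "Q ** P = mat 1"
    using P unfolding Q_def matrix_inv_def invertible_def by (metis (mono_tags, lifting) someI_ex)+
  have dPQ: "det P * det Q = 1" using arg_cong[OF Pi(1), of det] by (simp add: det_mul)
  have "det (?c h) = det P * det D * det Q" unfolding hP Q_def[symmetric] by (simp add: det_mul)
  then have "det D = 1" using dPQ dh by (simp add: det_map_matrix_of_real mult_ac)
  then have D1: "D $ 1 $ 1 * D $ 2 $ 2 * D $ 3 $ 3 = 1"
    using Dd[of 1 2] Dd[of 1 3] Dd[of 2 1] Dd[of 2 3] Dd[of 3 1] Dd[of 3 2] by (simp add: det_3)
  then have D0: "D $ i $ i \<noteq> 0" for i using exhaust_3[of i] by auto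
  define \<mu> where "\<mu> i = ln (cmod (D $ i $ i))" for i
  have "ln (cmod (D $ 1 $ 1 * D $ 2 $ 2 * D $ 3 $ 3)) = 0" using D1 by simp
  then have sum: "\<mu> 1 + \<mu> 2 + \<mu> 3 = 0" using D0 by (simp add: norm_mult ln_mult \<mu>_def)
  have H: "g (real 0) = mat 1" "\<And>n. g (real (Suc n)) = h ** g (real n)"
    using gD(3) gD(2)[of 1] by (simp_all add: h_def)
  obtain i j where ij: "i \<noteq> j" "0 \<le> \<mu> i \<and> 0 \<le> \<mu> j \<or> \<mu> i \<le> 0 \<and> \<mu> j \<le> 0"
    using two_nonneg_or_two_nonpos[of \<mu>] by blast
  show ?thesis
    unfolding HAW_on_manifold_def HAW_on_def
  proof (clarify)
    fix U \<phi> and \<beta> :: real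
    assume U: "(U, \<phi>) \<in> A" and \<beta>: "0 < \<beta>" "\<beta> < 1/3"
    define E where "E = bounded_orbit_points (g ` {0..})"
    show "\<exists>\<sigma>. winning_strategy \<beta> (\<phi> ` U) (\<phi> ` (E \<inter> U)) \<sigma>"
    proof (rule winning_strategy_local[OF \<beta>])
      fix x0 assume "x0 \<in> \<phi> ` U"
      then obtain B \<delta>0 where \<delta>0: "0 < \<delta>0" and B: "local_lift B x0"
        "\<And>x. x \<in> ball x0 \<delta>0 \<Longrightarrow> det (B x) = 1 \<and> coset_proj (B x) \<in> U \<and> \<phi> (coset_proj (B x)) = x"
        using chart_local_lift[OF assms(3) U] by metis
      have inE: "x \<in> \<phi> ` (E \<inter> U)"
        if x: "x \<in> ball x0 \<delta>0" and bd: "\<And>n::nat. \<exists>\<gamma>\<in>SL3Z. \<forall>i j. \<bar>(g (real n) ** B x ** \<gamma>) $ i $ j\<bar> \<le> C" for x C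
      proof -
        have "coset_proj (B x) \<in> E"
          unfolding E_def by (rule bounded_orbit_pointsI[OF assms(1) _ bd]) (use B(2)[OF x] in blast)
        then show ?thesis using B(2)[OF x] by (metis IntI image_eqI)
      qed
      show "\<exists>\<delta>>0. \<forall>b. 0 < snd b \<longrightarrow> ball_set b \<subseteq> ball x0 \<delta> \<longrightarrow> (\<exists>\<sigma>. wins_from \<beta> (\<phi> ` (E \<inter> U)) b \<sigma>)"
      proof (cases "0 \<le> \<mu> i \<and> 0 \<le> \<mu> j")
        case True
        have QD: "Q ** ?c h = D ** Q"
          unfolding hP Q_def[symmetric] by (simp add: matrix_mul_assoc Pi)
        have dQ: "det Q \<noteq> 0" using dPQ by auto
        have "\<exists>m. m 1 \<bullet> (m 2 \<times> m 3) \<noteq> 0 \<and> (\<forall>i::3. grows (\<lambda>n. g (real n)) (m i) (ln (cmod (D $ i $ i))))"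
          by (rule growing_forms[where H="\<lambda>n. g (real n)", OF H QD Dd dQ D0])
        then obtain m where m: "m 1 \<bullet> (m 2 \<times> m 3) \<noteq> 0" "\<And>i. grows (\<lambda>n. g (real n)) (m i) (\<mu> i)"
          unfolding \<mu>_def by blast
        obtain m1 m2 m3 l1 l2 where mm: "m1 \<bullet> (m2 \<times> m3) \<noteq> 0" and l: "0 \<le> l2" "l2 \<le> l1"
          and gr: "grows (\<lambda>n. g (real n)) m1 l1" "grows (\<lambda>n. g (real n)) m2 l2" "grows (\<lambda>n. g (real n)) m3 (- (l1 + l2))"
          by (rule sorted_growing_forms[OF m sum ij(1)]) (use True in auto)
        show ?thesis
        proof (rule wins_from_growth[OF \<beta> B(1) \<delta>0 mm l gr])
          fix x \<epsilon>
          assume x: "x \<in> ball x0 \<delta>0" and \<epsilon>: "0 < \<epsilon>"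
            and low: "\<And>n v. int_vec v \<Longrightarrow> v \<noteq> 0 \<Longrightarrow> \<epsilon> \<le> norm (g (real n) *v (B x *v v))"
          show "x \<in> \<phi> ` (E \<inter> U)"
          proof (rule inE[OF x])
            show "\<exists>\<gamma>\<in>SL3Z. \<forall>i j. \<bar>(g (real n) ** B x ** \<gamma>) $ i $ j\<bar> \<le> 5 / \<epsilon>\<^sup>2" for n
              by (rule mahler_reduction[OF _ \<epsilon>])
                (use low gD(1) B(2)[OF x] in \<open>auto simp: det_mul matrix_vector_mul_assoc\<close>)
          qed
        qed
      next
        case False
        \<comment> \<open>Two rates are nonpositive here. The contragredient of \<open>h\<close> has
          the inverse eigenvalues, so two of its rates are nonnegative; its eigenforms are the rows
          of \<open>transpose P\<close>.\<close>
        define D' :: "complex^3^3" where "D' = (\<chi> i j. if i = j then 1 / D $ i $ i else 0)"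
        have D'D: "D' ** D = mat 1"
        proof -
          have "(D' ** D) $ i $ j = (mat 1 :: complex^3^3) $ i $ j" for i j
          proof -
            have "(D' ** D) $ i $ j = (\<Sum>k\<in>UNIV. D' $ i $ k * D $ k $ j)" by (simp add: matrix_matrix_mult_def)
            also have "\<dots> = (\<Sum>k\<in>UNIV. (if k = i then 1 / D $ i $ i * D $ i $ j else 0))"
              by (rule sum.cong) (auto simp: D'_def)
            finally show ?thesis using D0[of i] Dd[of i j] by (auto simp: mat_def)
          qed
          then show ?thesis by (simp add: vec_eq_iff)
        qed
        have Dt: "transpose D = D" using Dd by (simp add: vec_eq_iff transpose_def) metis
        have "?c h ** P = P ** D" unfolding hP Q_def[symmetric] by (simp add: matrix_mul_assoc[symmetric] Pi)
        then have "transpose (?c h ** P) = transpose (P ** D)" by simp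
        then have t: "transpose P ** ?c (transpose h) = D ** transpose P"
          by (simp add: matrix_transpose_mul map_matrix_of_real_transpose Dt)
        have "transpose (h ** transpose (cofm h)) = mat 1" using dh by (simp add: mult_transpose_cofm)
        then have "cofm h ** transpose h = mat 1" by (simp add: matrix_transpose_mul)
        then have hc: "transpose h ** cofm h = mat 1" by (simp add: matrix_left_right_inverse)
        have "D ** (transpose P ** ?c (cofm h)) = transpose P ** ?c (transpose h ** cofm h)"
          by (simp add: matrix_mul_assoc t[symmetric] map_matrix_of_real_mult)
        also have "\<dots> = transpose P" by (simp add: hc map_matrix_of_real_mat_1)
        finally have "D' ** (D ** (transpose P ** ?c (cofm h))) = D' ** transpose P" by simp
        then have conj: "transpose P ** ?c (cofm h) = D' ** transpose P"
          by (simp add: matrix_mul_assoc D'D)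
        define G where "G n = cofm (g (real n))" for n :: nat
        have G: "G 0 = mat 1" "\<And>n. G (Suc n) = cofm h ** G n"
          using H dh gD(1) by (simp_all add: G_def cofm_mult)
        have D'0: "D' $ i $ i \<noteq> 0" "ln (cmod (D' $ i $ i)) = - \<mu> i" "\<And>j. i \<noteq> j \<Longrightarrow> D' $ i $ j = 0" for i
          using D0[of i] by (simp_all add: D'_def \<mu>_def norm_divide ln_div)
        have dP: "det (transpose P) \<noteq> 0" using dPQ by (auto simp: det_transpose)
        obtain m where m: "m 1 \<bullet> (m 2 \<times> m 3) \<noteq> 0" "\<And>i. grows G (m i) (- \<mu> i)"
          using growing_forms[of G "cofm h" "transpose P" D', OF G conj D'0(3) dP D'0(1)] D'0(2) by auto
        have sum': "- \<mu> 1 + - \<mu> 2 + - \<mu> 3 = 0" using sum by linarith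
        obtain m1 m2 m3 l1 l2 where mm: "m1 \<bullet> (m2 \<times> m3) \<noteq> 0" and l: "0 \<le> l2" "l2 \<le> l1"
          and gr: "grows G m1 l1" "grows G m2 l2" "grows G m3 (- (l1 + l2))"
          by (rule sorted_growing_forms[OF m sum' ij(1)]) (use False ij(2) in auto)
        show ?thesis
        proof (rule wins_from_growth[OF \<beta> local_lift_cofm[OF B(1)] \<delta>0 mm l gr])
          fix x \<epsilon>
          assume x: "x \<in> ball x0 \<delta>0" and \<epsilon>: "0 < \<epsilon>"
            and low: "\<And>n v. int_vec v \<Longrightarrow> v \<noteq> 0 \<Longrightarrow> \<epsilon> \<le> norm (G n *v (cofm (B x) *v v))"
          have dB: "det (B x) = 1" using B(2)[OF x] by blast
          show "x \<in> \<phi> ` (E \<inter> U)"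
          proof (rule inE[OF x])
            fix n
            have dg: "det (g (real n) ** B x) = 1" using gD(1) dB by (simp add: det_mul)
            have eq: "G n ** cofm (B x) = cofm (g (real n) ** B x)" using gD(1) dB by (simp add: G_def cofm_mult)
            have "\<exists>\<gamma>\<in>SL3Z. \<forall>i j. \<bar>(G n ** cofm (B x) ** \<gamma>) $ i $ j\<bar> \<le> 5 / \<epsilon>\<^sup>2"
            proof (rule mahler_reduction[OF _ \<epsilon>])
              show "det (G n ** cofm (B x)) = 1" by (simp add: eq det_cofm[OF dg])
              show "\<epsilon> \<le> norm ((G n ** cofm (B x)) *v v)" if "int_vec v" "v \<noteq> 0" for v
                using low[OF that, of n] by (simp add: matrix_vector_mul_assoc)
            qed
            then obtain \<gamma> where \<gamma>: "\<gamma> \<in> SL3Z" "\<And>i j. \<bar>(G n ** cofm (B x) ** \<gamma>) $ i $ j\<bar> \<le> 5 / \<epsilon>\<^sup>2"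
              by blast
            \<comment> \<open>Applying \<open>cofm\<close> again returns to the original orbit; it
              keeps the reducing matrix integral and the entries bounded.\<close>
            have "cofm (G n ** cofm (B x) ** \<gamma>) = g (real n) ** B x ** cofm \<gamma>"
              using \<gamma>(1) dg det_cofm[OF dg] unfolding eq by (simp add: cofm_mult cofm_cofm SL3Z_iff)
            then have "\<forall>i j. \<bar>(g (real n) ** B x ** cofm \<gamma>) $ i $ j\<bar> \<le> 2 * (5 / \<epsilon>\<^sup>2)\<^sup>2"
              using cofm_bound[OF \<gamma>(2)] by metis
            then show "\<exists>\<gamma>\<in>SL3Z. \<forall>i j. \<bar>(g (real n) ** B x ** \<gamma>) $ i $ j\<bar> \<le> 2 * (5 / \<epsilon>\<^sup>2)\<^sup>2"
              using cofm_SL3Z[OF \<gamma>(1)] by blast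
          qed
        qed
      qed
    qed
  qed
qed

end
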